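(* Let $\alpha\in(0,\infty)\setminus\{1\}$ and $p>0$. Then $\mathrm{Tr}\,G_{\alpha,p}$ is jointly concave if and only if $0<\alpha<1$ and $p\le1$.
   Context: Notation: $\mathbb{M}_n^+$ (resp. $\mathbb{M}_n^{++}$) is the set of $n\times n$ complex positive semidefinite (resp. positive definite) matrices; $s(A)$ is the support projection of $A\ge0$. $A^{-1}$ denotes the generalized inverse (inverse on the support of $A$, zero on the kernel), and $A^r:=(A^{-1})^{-r}$ for $r<0$. For $\alpha>0$ and $A,B\ge0$ with $s(A)\ge s(B)$, $A\#_\alpha B:=A^{1/2}(A^{-1/2}BA^{-1/2})^{\alpha}A^{1/2}$; for $0<\alpha<1$ and general $A,B\ge0$, $A\#_\alpha B:=\lim_{\varepsilon\searrow0}(A+\varepsilon I)\#_\alpha(B+\varepsilon I)$. Define $G_{\alpha,p}(A,B):=(A^p\#_\alpha B^p)^{1/p}$, with domain (for each $n$) $\mathbb{M}_n^+\times\mathbb{M}_n^+$ if $0<\alpha<1$ and $\{(A,B)\in\mathbb{M}_n^+\times\mathbb{M}_n^+:s(A)\ge s(B)\}$ if $\alpha>1$. "$\mathrm{Tr}\,G_{\alpha,p}$ is jointly concave" means that $(A,B)\mapsto\mathrm{Tr}\,G_{\alpha,p}(A,B)$ is jointly concave on this domain for every $n\in\mathbb{N}$; equivalently, on $\mathbb{M}_n^{++}\times\mathbb{M}_n^{++}$ for every $n\in\mathbb{N}$. *)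

theory Defs
  imports Complex_Main "Jordan_Normal_Form.Schur_Decomposition"
begin

text \<open>
  The dimension \<open>n\<close> is quantified inside the property under study, so matrices are the
  carrier-based ones of \<open>Jordan_Normal_Form\<close>.
\<close>

text \<open>
  The order on \<open>complex\<close> is that of \<open>HOL-Library.Complex_Order\<close>: \<open>0 \<le> z\<close> means that \<open>z\<close> is real
  and nonnegative. Hence a positive semidefinite matrix is automatically Hermitian.
\<close>

definition psd_mats :: "nat \<Rightarrow> complex mat set" where
  "psd_mats n = {A \<in> carrier_mat n n. \<forall>v \<in> carrier_vec n. 0 \<le> (A *\<^sub>v v) \<bullet>c v}"

definition loewner_le :: "complex mat \<Rightarrow> complex mat \<Rightarrow> bool" where
  "loewner_le A B \<longleftrightarrow> B - A \<in> psd_mats (dim_row A)"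

definition unitary_mats :: "nat \<Rightarrow> complex mat set" where
  "unitary_mats n = {U \<in> carrier_mat n n. mat_adjoint U * U = 1\<^sub>m n \<and> U * mat_adjoint U = 1\<^sub>m n}"

text \<open>
  Functional calculus of a Hermitian matrix: \<open>f (U diag(d) U\<^sup>*) = U diag(f d) U\<^sup>*\<close>, which does not
  depend on the chosen diagonalization. The value is unspecified for non-Hermitian matrices.
\<close>

definition mat_fun :: "(real \<Rightarrow> real) \<Rightarrow> complex mat \<Rightarrow> complex mat" where
  "mat_fun f A = (let n = dim_row A in
     THE B. \<exists>U \<in> unitary_mats n. \<exists>d :: nat \<Rightarrow> real.
       A = U * mat_diag n (\<lambda>i. complex_of_real (d i)) * mat_adjoint U \<and>
       B = U * mat_diag n (\<lambda>i. complex_of_real (f (d i))) * mat_adjoint U)"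

definition supp_proj :: "complex mat \<Rightarrow> complex mat" where
  "supp_proj A = mat_fun (\<lambda>x. if x = 0 then 0 else 1) A"

text \<open>
  Since \<open>inverse 0 = 0\<close> and \<open>0 powr r = 0\<close> on the reals, the generalized inverse and all powers
  vanish on the kernel.
\<close>

definition gen_inv :: "complex mat \<Rightarrow> complex mat" where
  "gen_inv A = mat_fun inverse A"

definition mat_powr :: "complex mat \<Rightarrow> real \<Rightarrow> complex mat" where
  "mat_powr A r =
     (if r < 0 then mat_fun (\<lambda>x. x powr (- r)) (gen_inv A) else mat_fun (\<lambda>x. x powr r) A)"

definition geo_mean_supp :: "real \<Rightarrow> complex mat \<Rightarrow> complex mat \<Rightarrow> complex mat" where
  "geo_mean_supp \<alpha> A B =
     mat_powr A (1/2) * mat_powr (mat_powr A (- 1/2) * B * mat_powr A (- 1/2)) \<alpha> * mat_powr A (1/2)"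

definition mat_lim :: "nat \<Rightarrow> real filter \<Rightarrow> (real \<Rightarrow> complex mat) \<Rightarrow> complex mat" where
  "mat_lim n F M = Matrix.mat n n (\<lambda>(i, j). Lim F (\<lambda>\<epsilon>. M \<epsilon> $$ (i, j)))"

text \<open>
  For \<open>\<alpha> < 1\<close> the limit exists for all positive semidefinite \<open>A\<close>, \<open>B\<close>, and it equals
  \<open>geo_mean_supp \<alpha> A B\<close> whenever the support of \<open>A\<close> dominates that of \<open>B\<close>; so the two clauses of the
  textbook definition are compatible. For \<open>\<alpha> > 1\<close> only pairs with dominated support are meaningful.
\<close>

definition geo_mean :: "real \<Rightarrow> complex mat \<Rightarrow> complex mat \<Rightarrow> complex mat" where
  "geo_mean \<alpha> A B =
     (if \<alpha> < 1 then
        (let n = dim_row A in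
         mat_lim n (at_right 0) (\<lambda>\<epsilon>. geo_mean_supp \<alpha>
           (A + complex_of_real \<epsilon> \<cdot>\<^sub>m 1\<^sub>m n) (B + complex_of_real \<epsilon> \<cdot>\<^sub>m 1\<^sub>m n)))
      else geo_mean_supp \<alpha> A B)"

definition G_mean :: "real \<Rightarrow> real \<Rightarrow> complex mat \<Rightarrow> complex mat \<Rightarrow> complex mat" where
  "G_mean \<alpha> p A B = mat_powr (geo_mean \<alpha> (mat_powr A p) (mat_powr B p)) (1/p)"

definition G_dom :: "real \<Rightarrow> nat \<Rightarrow> (complex mat \<times> complex mat) set" where
  "G_dom \<alpha> n =
     (if \<alpha> < 1 then psd_mats n \<times> psd_mats n
      else {(A, B) \<in> psd_mats n \<times> psd_mats n. loewner_le (supp_proj B) (supp_proj A)})"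

definition mat_trace :: "complex mat \<Rightarrow> complex" where
  "mat_trace A = (\<Sum>i<dim_row A. A $$ (i, i))"

definition jointly_concave_on ::
  "(complex mat \<times> complex mat) set \<Rightarrow> (complex mat \<Rightarrow> complex mat \<Rightarrow> real) \<Rightarrow> bool" where
  "jointly_concave_on D f \<longleftrightarrow>
     (\<forall>(A\<^sub>1, B\<^sub>1) \<in> D. \<forall>(A\<^sub>2, B\<^sub>2) \<in> D. \<forall>t \<in> {0..1::real}.
        (1 - t) * f A\<^sub>1 B\<^sub>1 + t * f A\<^sub>2 B\<^sub>2
          \<le> f (complex_of_real (1 - t) \<cdot>\<^sub>m A\<^sub>1 + complex_of_real t \<cdot>\<^sub>m A\<^sub>2)
              (complex_of_real (1 - t) \<cdot>\<^sub>m B\<^sub>1 + complex_of_real t \<cdot>\<^sub>m B\<^sub>2))"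

text \<open>The trace of a positive semidefinite matrix is real, so \<open>Re\<close> only changes the type.\<close>

definition Tr_G_jointly_concave :: "real \<Rightarrow> real \<Rightarrow> bool" where
  "Tr_G_jointly_concave \<alpha> p \<longleftrightarrow>
     (\<forall>n\<ge>1. jointly_concave_on (G_dom \<alpha> n) (\<lambda>A B. Re (mat_trace (G_mean \<alpha> p A B))))"

end

theory Submission
  imports Defs "HOL-Analysis.Analysis" "HOL-Real_Asymp.Real_Asymp"
    "Jordan_Normal_Form.Spectral_Radius"
begin

text \<open>
  For \<open>\<alpha> < 1\<close> and \<open>p \<le> 1\<close>: let \<open>(q : r)(z)\<close> be the infimum of \<open>q(x) + r(w)\<close> over \<open>x + w = z\<close>, which is
  monotone and jointly concave in the quadratic forms \<open>q\<close>, \<open>r\<close>. Up to a constant, the \<open>\<theta>\<close>-geometric mean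
  of \<open>q\<close> and \<open>r\<close> is \<open>\<integral> e\<^bsup>(\<theta>-1)x\<^esup> (q : e\<^sup>x r) dx\<close>. Applied to left and right multiplications this gives Lieb's
  concavity of \<open>Tr Z\<^sup>* A\<^sup>p Z Y\<^bsup>1-p\<^esup>\<close>; applied once more, to \<open>X \<mapsto> Tr X\<^sup>* A\<^sup>p X Y\<^bsup>1-p\<^esup>\<close> and its analogue for \<open>B\<close>,
  it gives joint concavity of \<open>Tr (A\<^sup>p #\<^sub>\<alpha> B\<^sup>p) Y\<^bsup>1-p\<^esup>\<close> in \<open>(A, B, Y)\<close>. By Young's inequality
  \<open>Tr M\<^bsup>1/p\<^esup> = sup\<^sub>Y (Tr M Y\<^bsup>1-p\<^esup> - (1 - p) Tr Y) / p\<close>, and a partial supremum of a jointly concave function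
  is concave.

  For \<open>\<alpha> > 1\<close> scalars already violate concavity. For \<open>\<alpha> < 1 < p\<close> take \<open>B = vv\<^sup>*\<close> with a unit vector \<open>v\<close>; then
  \<open>Tr G = \<langle>v, A\<^bsup>-p\<^esup> v\<rangle>\<^bsup>-(1-\<alpha>)/p\<^esup>\<close>. If \<open>A\<close> is \<open>2 \<times> 2\<close> with one eigenvalue \<open>s\<close> of order one and the other
  tending to infinity, the leading correction to \<open>\<langle>v, A\<^bsup>-p\<^esup> v\<rangle>\<close> has the shape \<open>u\<^sup>2 s\<^bsup>-p\<^esup>\<close>, which is jointly
  convex in \<open>(u, s)\<close> only for \<open>p \<le> 1\<close>.
\<close>

unbundle no vec_syntax and no inner_syntax

section \<open>Spectral theorem and functional calculus\<close>

text \<open>For commuting \<open>A\<close> and \<open>B\<close> the mean is A^(1-\<alpha>)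
  B^\<alpha> whatever \<open>p\<close> is, so a failure at \<open>p > 1\<close> needs non-commuting
  matrices, and size two is the smallest possibility. For concavity the obstacle is that three pairs
  of forms are compared (two endpoints and their mixture), each pair diagonal in its own
  coordinates. An infimal convolution does not mention coordinates: an optimal splitting at the
  mixture is an admissible splitting at both endpoints. Coordinates serve to identify the integral
  of the parallel sums with a weighted geometric mean. In the second use they come from a congruence
  that is usually not unitary, so the interpolation is stated for invertible coordinate changes. The
  exponents p and 1 - p are at once those of Lieb's theorem and those of Young's inequality with
  conjugate exponents 1/p and 1/(1-p). Singular matrices enter through the limit in the definition:
  its existence is itself a case of the interpolation inequality, and a singular \<open>B\<close> in
  the counterexample calls for an explicit evaluation of such a limit.\<close>

lemma index_mult_mat_sum:
  assumes "A \<in> carrier_mat n m" "B \<in> carrier_mat m k" "i < n" "j < k"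
  shows "(A * B) $$ (i, j) = (\<Sum>l<m. A $$ (i, l) * B $$ (l, j))"
  using assms by (auto simp: scalar_prod_def atLeast0LessThan)

lemma mat_adjoint_carrier [simp]: "A \<in> carrier_mat n m \<Longrightarrow> mat_adjoint A \<in> carrier_mat m n"
  by (auto simp: mat_adjoint_def mat_of_rows_def)

lemma index_mat_adjoint [simp]:
  "i < dim_col A \<Longrightarrow> j < dim_row A \<Longrightarrow> mat_adjoint (A :: complex mat) $$ (i, j) = cnj (A $$ (j, i))"
  by (auto simp: mat_adjoint_def mat_of_rows_def)

lemma dim_mat_adjoint [simp]:
  "dim_row (mat_adjoint A) = dim_col A" "dim_col (mat_adjoint A) = dim_row A"
  by (auto simp: mat_adjoint_def mat_of_rows_def)

lemma mat_adjoint_mat_adjoint [simp]: "mat_adjoint (mat_adjoint (A :: complex mat)) = A"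
  by (rule eq_matI) auto

lemma mat_adjoint_mult:
  fixes A B :: "complex mat"
  assumes "A \<in> carrier_mat n m" "B \<in> carrier_mat m k"
  shows "mat_adjoint (A * B) = mat_adjoint B * mat_adjoint A"
proof (rule eq_matI)
  fix i j assume "i < dim_row (mat_adjoint B * mat_adjoint A)"
    "j < dim_col (mat_adjoint B * mat_adjoint A)"
  hence ij: "i < k" "j < n" using assms by auto
  have "mat_adjoint (A * B) $$ (i, j) = cnj ((A * B) $$ (j, i))"
    using assms ij by (subst index_mat_adjoint) auto
  also have "\<dots> = (\<Sum>l<m. cnj (A $$ (j, l)) * cnj (B $$ (l, i)))"
    using index_mult_mat_sum[OF assms ij(2,1)] by simp
  also have "\<dots> = (mat_adjoint B * mat_adjoint A) $$ (i, j)"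
    using assms ij
    by (subst index_mult_mat_sum[of "mat_adjoint B" k m "mat_adjoint A" n i j])
       (auto intro!: sum.cong simp: mult.commute)
  finally show "mat_adjoint (A * B) $$ (i, j) = (mat_adjoint B * mat_adjoint A) $$ (i, j)" .
qed (use assms in auto)

lemma mat_adjoint_one [simp]: "mat_adjoint (1\<^sub>m n :: complex mat) = 1\<^sub>m n"
  by (rule eq_matI) auto

lemma mat_adjoint_diag_real:
  "mat_adjoint (mat_diag n (\<lambda>i. complex_of_real (d i))) = mat_diag n (\<lambda>i. complex_of_real (d i))"
  by (rule eq_matI) (auto simp: mat_diag_def)

lemma mat_trace_mult_comm:
  assumes "A \<in> carrier_mat n m" "B \<in> carrier_mat m n"
  shows "mat_trace (A * B) = mat_trace (B * A)"
proof -
  have "mat_trace (A * B) = (\<Sum>i<n. \<Sum>l<m. A $$ (i, l) * B $$ (l, i))"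
    using assms by (auto simp: mat_trace_def index_mult_mat_sum[OF assms] simp del:
      index_mult_mat(1)
      intro!: sum.cong)
  also have "\<dots> = (\<Sum>l<m. \<Sum>i<n. B $$ (l, i) * A $$ (i, l))"
    by (subst sum.swap) (simp add: mult.commute)
  also have "\<dots> = mat_trace (B * A)"
    using assms by (auto simp: mat_trace_def index_mult_mat_sum[OF assms(2,1)] simp del:
      index_mult_mat(1)
      intro!: sum.cong)
  finally show ?thesis .
qed

lemma mat_trace_add:
  "A \<in> carrier_mat n n \<Longrightarrow> B \<in> carrier_mat n n \<Longrightarrow> mat_trace (A + B) = mat_trace A + mat_trace B"
  by (auto simp: mat_trace_def sum.distrib)

lemma mat_trace_smult: "A \<in> carrier_mat n n \<Longrightarrow> mat_trace (c \<cdot>\<^sub>m A) = c * mat_trace A"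
  by (auto simp: mat_trace_def sum_distrib_left)

lemma unitary_matsD:
  assumes "U \<in> unitary_mats n"
  shows "U \<in> carrier_mat n n" "mat_adjoint U \<in> carrier_mat n n"
    "mat_adjoint U * U = 1\<^sub>m n" "U * mat_adjoint U = 1\<^sub>m n"
  using assms by (auto simp: unitary_mats_def)

lemma unitary_matsI:
  assumes "U \<in> carrier_mat n n" "mat_adjoint U * U = 1\<^sub>m n"
  shows "U \<in> unitary_mats n"
  using assms mat_mult_left_right_inverse[of "mat_adjoint U" n U] by (auto simp: unitary_mats_def)

lemma unitary_mats_mult:
  assumes "U \<in> unitary_mats n" "V \<in> unitary_mats n"
  shows "U * V \<in> unitary_mats n"
proof (rule unitary_matsI)
  note [simp] = unitary_matsD(1,2)[OF assms(1)] unitary_matsD(1,2)[OF assms(2)]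
  show "U * V \<in> carrier_mat n n" by (rule mult_carrier_mat[of _ n n]) simp_all
  have "mat_adjoint (U * V) * (U * V) = mat_adjoint V * (mat_adjoint U * U) * V"
    by (simp add: mat_adjoint_mult[of _ n n _ n] assoc_mult_mat[of _ n n _ n _ n]
      mult_carrier_mat[of _ n n _ n])
  thus "mat_adjoint (U * V) * (U * V) = 1\<^sub>m n"
    using unitary_matsD[OF assms(1)] unitary_matsD[OF assms(2)] right_mult_one_mat[of
      "mat_adjoint V" n n] by simp
qed

lemma unitary_mats_adjoint: "U \<in> unitary_mats n \<Longrightarrow> mat_adjoint U \<in> unitary_mats n"
  by (auto simp: unitary_mats_def)

section \<open>Deflation and the spectral theorem for Hermitian matrices\<close>

definition direct_sum1 :: "complex \<Rightarrow> complex mat \<Rightarrow> complex mat" where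
  "direct_sum1 c M = Matrix.mat (Suc (dim_row M)) (Suc (dim_row M)) (\<lambda>(i, j).
     case i of 0 \<Rightarrow> (case j of 0 \<Rightarrow> c | Suc j' \<Rightarrow> 0)
     | Suc i' \<Rightarrow> (case j of 0 \<Rightarrow> 0 | Suc j' \<Rightarrow> M $$ (i', j')))"

lemma direct_sum1_carrier [simp]: "M \<in> carrier_mat n n \<Longrightarrow> direct_sum1 c M \<in> carrier_mat (Suc n) (Suc
    n)"
  by (auto simp: direct_sum1_def)

lemma direct_sum1_mult:
  assumes "M \<in> carrier_mat n n" "N \<in> carrier_mat n n"
  shows "direct_sum1 a M * direct_sum1 b N = direct_sum1 (a * b) (M * N)"
proof (rule eq_matI)
  note c = direct_sum1_carrier[OF assms(1), of a] direct_sum1_carrier[OF assms(2), of b]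
  fix i j assume "i < dim_row (direct_sum1 (a * b) (M * N))"
    "j < dim_col (direct_sum1 (a * b) (M * N))"
  hence ij: "i < Suc n" "j < Suc n" using assms by (auto simp: direct_sum1_def)
  have "(direct_sum1 a M * direct_sum1 b N) $$ (i, j)
      = (\<Sum>l<Suc n. direct_sum1 a M $$ (i, l) * direct_sum1 b N $$ (l, j))"
    by (rule index_mult_mat_sum[OF c ij])
  also have "\<dots> = direct_sum1 (a * b) (M * N) $$ (i, j)"
    using ij assms by (cases i; cases j)
      (simp_all add: direct_sum1_def sum.lessThan_Suc_shift index_mult_mat_sum[OF assms]
        del: index_mult_mat(1) sum.lessThan_Suc)
  finally show "(direct_sum1 a M * direct_sum1 b N) $$ (i, j) = direct_sum1 (a * b) (M * N) $$ (i,
      j)" .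
qed (use assms in \<open>auto simp: direct_sum1_def\<close>)

lemma mat_adjoint_direct_sum1:
  assumes "M \<in> carrier_mat n n"
  shows "mat_adjoint (direct_sum1 a M) = direct_sum1 (cnj a) (mat_adjoint M)"
  by (rule eq_matI) (use assms in \<open>auto simp: direct_sum1_def split: nat.splits\<close>)

lemma direct_sum1_one: "direct_sum1 1 (1\<^sub>m n) = 1\<^sub>m (Suc n)"
  by (rule eq_matI) (auto simp: direct_sum1_def split: nat.splits)

lemma direct_sum1_diag: "direct_sum1 (f 0) (mat_diag n (\<lambda>i. f (Suc i))) = mat_diag (Suc n) f"
  by (rule eq_matI) (auto simp: direct_sum1_def mat_diag_def split: nat.splits)

text \<open>Gram-Schmidt applied to a basis that starts with \<open>v\<close> yields pairwise
  orthogonal vectors, but not unit ones; dividing each by its norm \<open>nr\<close> gives the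
  columns of \<open>W\<close>. The scalar \<open>c\<close> absorbs the normalization of
  \<open>v\<close>.\<close>

lemma unitary_extension:
  assumes v: "v \<in> carrier_vec n" "v \<noteq> 0\<^sub>v n"
  obtains W c where "W \<in> unitary_mats n" "c \<noteq> 0" "Matrix.col W 0 = c \<cdot>\<^sub>v v" "n > 0"
proof -
  have n: "n > 0" using v by (cases n) auto
  interpret cof_vec_space n "TYPE(complex)" .
  define b where "b = basis_completion v"
  define ws where "ws = gram_schmidt n b"
  from basis_completion[OF v, folded b_def]
  have dist_b: "distinct b" 
    and indep: "\<not> lin_dep (set b)" and b: "set b \<subseteq> carrier_vec n" and hdb: "hd b = v" 
    and len_b: "length b = n" by auto
  from hdb len_b n obtain vs where bv: "b = v # vs" by (cases b, auto)
  from gram_schmidt_result[OF b dist_b indep refl, folded ws_def]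
  have ws: "set ws \<subseteq> carrier_vec n" "corthogonal ws" "length ws = n" 
    by (auto simp: len_b)
  from gram_schmidt_hd[OF v(1), of vs, folded bv] have hdws: "hd ws = v" unfolding ws_def .
  have ws0: "ws ! 0 = v" using hdws ws n by (metis hd_conv_nth length_greater_0_conv)
  have wsc: "ws ! j \<in> carrier_vec n" if "j < n" for j using ws that by auto
  define nr where "nr j = sqrt (Re ((ws ! j) \<bullet>c (ws ! j)))" for j
  have sp: "(ws ! i) \<bullet>c (ws ! j) = (\<Sum>k<n. vec_index (ws ! i) k * cnj (vec_index (ws ! j) k))" if
    "i < n" "j < n" for i j
    using wsc[OF that(1)] wsc[OF that(2)] by (auto simp: scalar_prod_def atLeast0LessThan)
  have orth: "(ws ! i) \<bullet>c (ws ! j) = (if i = j then of_real ((nr i)^2) else 0)" if "i < n" "j < n"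
    for i j
  proof (cases "i = j")
    case True
    have "(ws ! i) \<bullet>c (ws ! i) = of_real (\<Sum>k<n. (cmod (vec_index (ws ! i) k))^2)"
      unfolding sp[OF that(1) that(1)] by (simp only: of_real_sum complex_norm_square)
    moreover have "(\<Sum>k<n. (cmod (vec_index (ws ! i) k))^2) \<ge> 0" by (intro sum_nonneg) auto
    ultimately show ?thesis using True by (simp add: nr_def)
  next
    case False
    thus ?thesis using corthogonalD[OF ws(2), of i j] that ws(3) by auto
  qed
  have nr0: "nr j \<noteq> 0" if "j < n" for j
    using corthogonalD[OF ws(2), of j j] orth[OF that that] that ws(3) by auto
  define W where "W = Matrix.mat n n (\<lambda>(i, j). vec_index (ws ! j) i / of_real (nr j))"
  have W: "W \<in> carrier_mat n n" by (simp add: W_def)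
  have "mat_adjoint W * W = 1\<^sub>m n"
  proof (rule eq_matI)
    fix i j assume "i < dim_row (1\<^sub>m n :: complex mat)" "j < dim_col (1\<^sub>m n :: complex mat)"
    hence ij: "i < n" "j < n" by auto
    have "(mat_adjoint W * W) $$ (i, j) = (\<Sum>l<n. cnj (W $$ (l, i)) * W $$ (l, j))"
      using W ij by (subst index_mult_mat_sum[of _ n n _ n]) auto
    also have "\<dots> = (\<Sum>l<n. (vec_index (ws ! j) l * cnj (vec_index (ws ! i) l)) / (of_real (nr i) *
        of_real (nr j)))"
      using ij by (intro sum.cong) (auto simp: W_def)
    also have "\<dots> = ((ws ! j) \<bullet>c (ws ! i)) / (of_real (nr i) * of_real (nr j))"
      unfolding sp[OF ij(2,1)] by (simp add: sum_divide_distrib)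
    also have "\<dots> = (if i = j then 1 else 0)"
      unfolding orth[OF ij(2,1)] using nr0[OF ij(1)] by (auto simp: power2_eq_square)
    finally show "(mat_adjoint W * W) $$ (i, j) = 1\<^sub>m n $$ (i, j)" using ij by simp
  qed (use W in auto)
  with W have "W \<in> unitary_mats n" by (intro unitary_matsI)
  moreover have "Matrix.col W 0 = (1 / of_real (nr 0)) \<cdot>\<^sub>v v"
    using n v ws0 by (intro eq_vecI) (auto simp: W_def)
  moreover have "1 / complex_of_real (nr 0) \<noteq> 0" using nr0[OF n] by simp
  ultimately show ?thesis using that n by blast
qed

theorem hermitian_spectral:
  assumes "A \<in> carrier_mat n n" "mat_adjoint A = A"
  obtains U d where "U \<in> unitary_mats n"
    "A = U * mat_diag n (\<lambda>i. complex_of_real (d i)) * mat_adjoint U"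
proof -
  have "\<exists>U d. U \<in> unitary_mats n \<and> A = U * mat_diag n (\<lambda>i. complex_of_real (d i)) * mat_adjoint U"
    using assms
  proof (induction n arbitrary: A)
    case 0
    have "1\<^sub>m 0 \<in> unitary_mats 0" by (auto simp: unitary_mats_def)
    moreover have "A = 1\<^sub>m 0 * mat_diag 0 (\<lambda>i. complex_of_real 0) * mat_adjoint (1\<^sub>m 0)"
      using 0 by (intro eq_matI) auto
    ultimately show ?case by (intro exI[of _ "1\<^sub>m 0"] exI[of _ "\<lambda>_. 0"]) simp
  next
    case (Suc n A)
    from spectrum_non_empty[OF Suc.prems(1)] obtain e where "eigenvalue A e"
      unfolding spectrum_def by auto
    then obtain v where ev: "v \<in> carrier_vec (Suc n)" "v \<noteq> 0\<^sub>v (Suc n)" "A *\<^sub>v v = e \<cdot>\<^sub>v v"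
      using Suc.prems(1) unfolding eigenvalue_def eigenvector_def by auto
    from unitary_extension[OF ev(1,2)] obtain W c where W: "W \<in> unitary_mats (Suc n)" "c \<noteq> 0"
      "Matrix.col W 0 = c \<cdot>\<^sub>v v" by metis
    note Wc = unitary_matsD[OF W(1)]
    define B where "B = mat_adjoint W * A * W"
    have Ac: "A \<in> carrier_mat (Suc n) (Suc n)" by fact
    have Bc: "B \<in> carrier_mat (Suc n) (Suc n)" unfolding B_def by (rule mult_carrier_mat[OF
      mult_carrier_mat[OF Wc(2) Ac] Wc(1)])
    have Bh: "mat_adjoint B = B"
      using Wc(1,2) Suc.prems unfolding B_def
      by (simp add: mat_adjoint_mult[of _ "Suc n" "Suc n" _ "Suc n"] assoc_mult_mat[of _ "Suc n"
        "Suc n" _ "Suc n" _ "Suc n"] mult_carrier_mat[of _ "Suc n" "Suc n" _ "Suc n"])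
    have AW: "(A * W) $$ (i, 0) = e * W $$ (i, 0)" if i: "i < Suc n" for i
    proof -
      have "(A * W) $$ (i, 0) = vec_index (A *\<^sub>v Matrix.col W 0) i"
        using Ac Wc(1) i by auto
      also have "A *\<^sub>v Matrix.col W 0 = c \<cdot>\<^sub>v (e \<cdot>\<^sub>v v)"
        unfolding W(3) using Ac ev by (simp add: mult_mat_vec[of _ "Suc n" "Suc n"])
      also have "\<dots> = e \<cdot>\<^sub>v Matrix.col W 0" unfolding W(3) by (simp add: smult_smult_assoc
        mult.commute)
      also have "vec_index \<dots> i = e * W $$ (i, 0)" using Wc(1) i by auto
      finally show ?thesis .
    qed
    have B0: "B $$ (i, 0) = (if i = 0 then e else 0)" if i: "i < Suc n" for i
    proof -
      have "B $$ (i, 0) = (\<Sum>l<Suc n. mat_adjoint W $$ (i, l) * (A * W) $$ (l, 0))"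
        unfolding B_def assoc_mult_mat[OF Wc(2) Ac Wc(1)]
        by (rule index_mult_mat_sum[OF Wc(2) mult_carrier_mat[OF Ac Wc(1)]]) (use i in auto)
      also have "\<dots> = e * (\<Sum>l<Suc n. mat_adjoint W $$ (i, l) * W $$ (l, 0))"
        unfolding sum_distrib_left by (intro sum.cong) (auto simp: AW simp del: index_mult_mat)
      also have "(\<Sum>l<Suc n. mat_adjoint W $$ (i, l) * W $$ (l, 0)) = (mat_adjoint W * W) $$ (i, 0)"
        by (rule index_mult_mat_sum[OF Wc(2,1), symmetric]) (use i in auto)
      finally show ?thesis using i Wc(3) by simp
    qed
    \<comment> \<open>Hermitian symmetry makes the corner entry real and turns the zeros below it in
      column 0 into zeros beside it in row 0, so \<open>B\<close> splits as a direct sum.\<close>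
    have Bsym: "B $$ (i, j) = cnj (B $$ (j, i))" if "i < Suc n" "j < Suc n" for i j
      using Bc that by (subst Bh[symmetric]) (auto simp del: Bh)
    have e: "e = of_real (Re e)"
      using arg_cong[OF Bsym[of 0 0], of Im] B0[of 0] by (simp add: complex_eq_iff)
    define C where "C = Matrix.mat n n (\<lambda>(i, j). B $$ (Suc i, Suc j))"
    have C: "C \<in> carrier_mat n n" by (simp add: C_def)
    have Ch: "mat_adjoint C = C"
      by (rule eq_matI) (auto simp: C_def intro!: Bsym[symmetric])
    have B0': "B $$ (0, Suc j) = 0" if "j < n" for j
      using Bsym[of 0 "Suc j"] B0[of "Suc j"] that by simp
    have BC: "B = direct_sum1 (of_real (Re e)) C"
    proof (rule eq_matI)
      fix i j assume "i < dim_row (direct_sum1 (of_real (Re e)) C)"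
        "j < dim_col (direct_sum1 (of_real (Re e)) C)"
      hence ij: "i < Suc n" "j < Suc n" by (auto simp: direct_sum1_def C_def)
      show "B $$ (i, j) = direct_sum1 (of_real (Re e)) C $$ (i, j)"
        using ij e B0[of i] B0'
        by (cases i; cases j) (auto simp: direct_sum1_def C_def)
    qed (use Bc C in \<open>auto simp: direct_sum1_def\<close>)
    from Suc.IH[OF C Ch] obtain V d where V: "V \<in> unitary_mats n"
      and Cd: "C = V * mat_diag n (\<lambda>i. complex_of_real (d i)) * mat_adjoint V" by blast
    note Vc = unitary_matsD[OF V]
    define X where "X = direct_sum1 1 V"
    define D where "D = mat_diag (Suc n) (\<lambda>i. complex_of_real (case i of 0 \<Rightarrow> Re e | Suc i \<Rightarrow> d i))"
    have X: "X \<in> unitary_mats (Suc n)"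
      unfolding X_def using Vc
      by (intro unitary_matsI) (auto simp: mat_adjoint_direct_sum1[of _ n] direct_sum1_mult[of _ n]
        direct_sum1_one)
    note Xc = unitary_matsD[OF X]
    have D': "D = direct_sum1 (of_real (Re e)) (mat_diag n (\<lambda>i. complex_of_real (d i)))"
      unfolding D_def by (subst direct_sum1_diag[symmetric]) simp
    have Dc: "D \<in> carrier_mat (Suc n) (Suc n)" by (simp add: D_def)
    have BX: "B = X * D * mat_adjoint X"
      unfolding BC Cd X_def D' using Vc
      by (simp add: mat_adjoint_direct_sum1[of _ n] direct_sum1_mult[of _ n])
    have "W * B * mat_adjoint W = (W * mat_adjoint W) * A * (W * mat_adjoint W)"
      unfolding B_def using Wc(1,2) Ac by (simp add: assoc_mult_mat[of _ "Suc n" "Suc n" _ "Suc n"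
        _ "Suc n"] mult_carrier_mat[of _ "Suc n" "Suc n" _ "Suc n"])
    also have "\<dots> = A" using Wc Ac by simp
    finally have "A = (W * X) * D * mat_adjoint (W * X)"
      unfolding BX using Wc(1,2) Xc(1,2) Dc
      by (simp add: mat_adjoint_mult[of _ "Suc n" "Suc n" _ "Suc n"] assoc_mult_mat[of _ "Suc n"
        "Suc n" _ "Suc n" _ "Suc n"] mult_carrier_mat[of _ "Suc n" "Suc n" _ "Suc n"])
    with unitary_mats_mult[OF W(1) X] show ?case unfolding D_def by blast
  qed
  thus ?thesis using that by blast
qed

text \<open>The uniqueness behind \<open>THE\<close>. For two diagonalizations the matrix
  \<open>K\<close> satisfies K_ij d_j = e_i K_ij. Hence \<open>d j = e i\<close> wherever the entry
  is nonzero, so the same relation holds with \<open>f\<close> applied to both sides, for an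
  arbitrary function \<open>f\<close>.\<close>

lemma mat_fun_eq:
  assumes U: "U \<in> unitary_mats n" and A: "A = U * mat_diag n (\<lambda>i. complex_of_real (d i)) *
      mat_adjoint U"
  shows "mat_fun f A = U * mat_diag n (\<lambda>i. complex_of_real (f (d i))) * mat_adjoint U"
proof -
  note Uc = unitary_matsD[OF U]
  have dim: "dim_row A = n" using A Uc by auto
  show ?thesis unfolding mat_fun_def Let_def dim
  proof (rule the_equality)
    show "\<exists>U'\<in>unitary_mats n. \<exists>d'. A = U' * mat_diag n (\<lambda>i. complex_of_real (d' i)) * mat_adjoint
        U' \<and>
      U * mat_diag n (\<lambda>i. complex_of_real (f (d i))) * mat_adjoint U
        = U' * mat_diag n (\<lambda>i. complex_of_real (f (d' i))) * mat_adjoint U'"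
      using U A by blast
  next
    fix B assume "\<exists>V\<in>unitary_mats n. \<exists>d'. A = V * mat_diag n (\<lambda>i. complex_of_real (d' i)) *
        mat_adjoint V \<and>
      B = V * mat_diag n (\<lambda>i. complex_of_real (f (d' i))) * mat_adjoint V"
    then obtain V e where V: "V \<in> unitary_mats n"
      and AV: "A = V * mat_diag n (\<lambda>i. complex_of_real (e i)) * mat_adjoint V"
      and B: "B = V * mat_diag n (\<lambda>i. complex_of_real (f (e i))) * mat_adjoint V" by blast
    note Vc = unitary_matsD[OF V]
    let ?D = "\<lambda>d. mat_diag n (\<lambda>i. complex_of_real (d i))"
    define K where "K = mat_adjoint V * U"
    have K: "K \<in> carrier_mat n n" unfolding K_def by (rule mult_carrier_mat[OF Vc(2) Uc(1)])
    have "mat_adjoint V * (U * ?D d * mat_adjoint U) * U = mat_adjoint V * (V * ?D e * mat_adjoint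
        V) * U"
      using A AV by simp
    moreover have "mat_adjoint V * (U * ?D d * mat_adjoint U) * U = K * ?D d * (mat_adjoint U * U)"
      unfolding K_def using Uc(1,2) Vc(1,2) by (simp add: assoc_mult_mat[of _ n n _ n _ n]
        mult_carrier_mat[of _ n n _ n])
    moreover have "mat_adjoint V * (V * ?D e * mat_adjoint V) * U = (mat_adjoint V * V) * ?D e * K"
      unfolding K_def using Uc(1,2) Vc(1,2) by (simp add: assoc_mult_mat[of _ n n _ n _ n]
        mult_carrier_mat[of _ n n _ n])
    ultimately have KD: "K * ?D d = ?D e * K"
      using Uc Vc K left_mult_one_mat[of "mat_diag n (\<lambda>i. complex_of_real (e i))" n n]
        right_mult_one_mat[of "K * mat_diag n (\<lambda>i. complex_of_real (d i))" n n]
        mult_carrier_mat[OF K, of "mat_diag n (\<lambda>i. complex_of_real (d i))" n] by simp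
    have KDf: "K * ?D (f \<circ> d) = ?D (f \<circ> e) * K"
    proof (rule eq_matI)
      fix i j assume "i < dim_row (?D (f \<circ> e) * K)" "j < dim_col (?D (f \<circ> e) * K)"
      hence ij: "i < n" "j < n" using K by (auto simp: mat_diag_def)
      have "(K * ?D d) $$ (i, j) = (?D e * K) $$ (i, j)" by (simp only: KD)
      hence "K $$ (i, j) * of_real (d j) = of_real (e i) * K $$ (i, j)"
        using ij by (simp add: mat_diag_mult_left[OF K] mat_diag_mult_right[OF K])
      hence "K $$ (i, j) * of_real (f (d j)) = of_real (f (e i)) * K $$ (i, j)"
        by (cases "K $$ (i, j) = 0") (auto simp: mult.commute)
      thus "(K * ?D (f \<circ> d)) $$ (i, j) = (?D (f \<circ> e) * K) $$ (i, j)"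
        using ij by (simp add: mat_diag_mult_left[OF K] mat_diag_mult_right[OF K])
    qed (use K in \<open>auto simp: mat_diag_def\<close>)
    have "V * K = (V * mat_adjoint V) * U" unfolding K_def
      using Uc(1,2) Vc(1,2) by (simp add: assoc_mult_mat[of _ n n _ n _ n] mult_carrier_mat[of _ n
        n _ n])
    hence VK: "V * K = U" using Uc Vc by simp
    have "K * mat_adjoint U = mat_adjoint V * (U * mat_adjoint U)" unfolding K_def
      using Uc(1,2) Vc(1,2) by (simp add: assoc_mult_mat[of _ n n _ n _ n] mult_carrier_mat[of _ n
        n _ n])
    hence KU: "K * mat_adjoint U = mat_adjoint V" using Uc Vc by simp
    have "V * ?D (f \<circ> e) * mat_adjoint V = V * (?D (f \<circ> e) * K) * mat_adjoint U"
      using Uc(1,2) Vc(1,2) K by (simp add: KU[symmetric] assoc_mult_mat[of _ n n _ n _ n]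
        mult_carrier_mat[of _ n n _ n])
    also have "\<dots> = V * K * ?D (f \<circ> d) * mat_adjoint U"
      unfolding KDf[symmetric] using Uc(1,2) Vc(1,2) K by (simp add: assoc_mult_mat[of _ n n _ n _
        n] mult_carrier_mat[of _ n n _ n])
    finally show "B = U * ?D (\<lambda>i. f (d i)) * mat_adjoint U"
      unfolding B VK by (simp add: comp_def)
  qed
qed

text \<open>The factor \<open>U\<close> is left arbitrary: unitary matrices give spectral
  decompositions, invertible ones give the congruences that diagonalize two positive forms at
  once.\<close>

definition cong_diag :: "nat \<Rightarrow> complex mat \<Rightarrow> (nat \<Rightarrow> real) \<Rightarrow> complex mat" where
  "cong_diag n U d = U * mat_diag n (\<lambda>i. complex_of_real (d i)) * mat_adjoint U"

lemma cong_diag_carrier [simp]: "U \<in> carrier_mat n n \<Longrightarrow> cong_diag n U d \<in> carrier_mat n n"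
  by (auto simp: cong_diag_def)

lemma dim_cong_diag [simp]:
  "dim_row (cong_diag n U d) = dim_row U" "dim_col (cong_diag n U d) = dim_row U"
  by (auto simp: cong_diag_def)

lemma cong_diag_cong: "(\<And>i. i < n \<Longrightarrow> d i = e i) \<Longrightarrow> cong_diag n U d = cong_diag n U e"
proof -
  assume "\<And>i. i < n \<Longrightarrow> d i = e i"
  hence "mat_diag n (\<lambda>i. complex_of_real (d i)) = mat_diag n (\<lambda>i. complex_of_real (e i))"
    by (intro eq_matI) (auto simp: mat_diag_def)
  thus ?thesis by (simp add: cong_diag_def)
qed

lemma cong_diag_one: "U \<in> unitary_mats n \<Longrightarrow> cong_diag n U (\<lambda>_. 1) = 1\<^sub>m n"
  using unitary_matsD[of U n] right_mult_one_mat[of U n n] by (simp add: cong_diag_def)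

lemma cong_diag_mult_left:
  assumes "R \<in> carrier_mat n n" "V \<in> carrier_mat n n"
  shows "R * cong_diag n V w * mat_adjoint R = cong_diag n (R * V) w"
  using assms by (simp add: cong_diag_def mat_adjoint_mult[of _ n n _ n]
    assoc_mult_mat[of _ n n _ n _ n] mult_carrier_mat[of _ n n _ n])

lemma cong_diag_mult_cong_diag:
  assumes U: "U \<in> unitary_mats n"
  shows "cong_diag n U d * cong_diag n U e = cong_diag n U (\<lambda>i. d i * e i)"
proof -
  note Uc = unitary_matsD(1,2)[OF U]
  have "cong_diag n U d * cong_diag n U e =
     U * (mat_diag n (\<lambda>i. complex_of_real (d i)) * (mat_adjoint U * U) * mat_diag n (\<lambda>i.
       complex_of_real (e i))) * mat_adjoint U"
    using Uc by (simp add: cong_diag_def assoc_mult_mat[of _ n n _ n _ n] mult_carrier_mat[of _ n n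
      _ n])
  also have "\<dots> = cong_diag n U (\<lambda>i. d i * e i)"
    unfolding unitary_matsD(3)[OF U]
    using right_mult_one_mat[of "mat_diag n (\<lambda>i. complex_of_real (d i))" n n]
    by (simp add: cong_diag_def)
  finally show ?thesis .
qed

lemma mat_adjoint_cong_diag:
  assumes "U \<in> carrier_mat n n"
  shows "mat_adjoint (cong_diag n U d) = cong_diag n U d"
  using assms by (simp add: cong_diag_def mat_adjoint_mult[of _ n n _ n] mat_adjoint_diag_real
    assoc_mult_mat[of _ n n _ n _ n] mult_carrier_mat[of _ n n _ n])

lemma index_cong_diag:
  assumes U: "U \<in> carrier_mat n n" and ij: "i < n" "j < n"
  shows "cong_diag n U d $$ (i, j) = (\<Sum>k<n. of_real (d k) * (U $$ (i, k) * cnj (U $$ (j, k))))"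
proof -
  have "U * mat_diag n (\<lambda>i. complex_of_real (d i)) \<in> carrier_mat n n"
    by (rule mult_carrier_mat[OF U]) simp
  hence "cong_diag n U d $$ (i, j) = (\<Sum>k<n. (U * mat_diag n (\<lambda>i. complex_of_real (d i))) $$ (i, k)
      * mat_adjoint U $$ (k, j))"
    unfolding cong_diag_def by (rule index_mult_mat_sum[of _ n n _ n]) (use U ij in auto)
  also have "\<dots> = (\<Sum>k<n. of_real (d k) * (U $$ (i, k) * cnj (U $$ (j, k))))"
    using U ij by (intro sum.cong) (auto simp: mat_diag_mult_right[OF U])
  finally show ?thesis .
qed

lemma mat_fun_cong_diag:
  "U \<in> unitary_mats n \<Longrightarrow> mat_fun f (cong_diag n U d) = cong_diag n U (\<lambda>i. f (d i))"
  unfolding cong_diag_def by (rule mat_fun_eq) auto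

lemma mat_powr_cong_diag:
  "U \<in> unitary_mats n \<Longrightarrow> r \<ge> 0 \<Longrightarrow> mat_powr (cong_diag n U d) r = cong_diag n U (\<lambda>i. d i powr r)"
  by (simp add: mat_powr_def mat_fun_cong_diag)

lemma mat_powr_minus_cong_diag:
  "U \<in> unitary_mats n \<Longrightarrow> r < 0 \<Longrightarrow>
     mat_powr (cong_diag n U d) r = cong_diag n U (\<lambda>i. inverse (d i) powr (- r))"
  by (simp add: mat_powr_def gen_inv_def mat_fun_cong_diag)

section \<open>Quadratic forms and trace functionals\<close>

text \<open>Vectors are functions of which only the values below \<open>n\<close> count; this avoids
  carrier conditions when vectors are assembled from coordinates.\<close>

definition sform :: "nat \<Rightarrow> complex mat \<Rightarrow> (nat \<Rightarrow> complex) \<Rightarrow> complex" where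
  "sform n A v = (\<Sum>i<n. \<Sum>j<n. cnj (v i) * A $$ (i, j) * v j)"

lemma sform_eq_scalar_prod:
  assumes "A \<in> carrier_mat n n" "v \<in> carrier_vec n"
  shows "(A *\<^sub>v v) \<bullet>c v = sform n A (vec_index v)"
  using assms unfolding sform_def
  by (auto simp: scalar_prod_def atLeast0LessThan sum_distrib_left mult_ac intro!: sum.cong)

lemma psd_mats_iff:
  "A \<in> psd_mats n \<longleftrightarrow> A \<in> carrier_mat n n \<and> (\<forall>v. 0 \<le> sform n A v)"
proof -
  have "(\<forall>v \<in> carrier_vec n. 0 \<le> (A *\<^sub>v v) \<bullet>c v) \<longleftrightarrow> (\<forall>v. 0 \<le> sform n A v)" if "A \<in> carrier_mat n n"
  proof (intro iffI ballI allI)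
    fix v assume *: "\<forall>v \<in> carrier_vec n. 0 \<le> (A *\<^sub>v v) \<bullet>c v"
    have "sform n A v = sform n A (vec_index (Matrix.vec n v))" by (simp add: sform_def)
    thus "0 \<le> sform n A v" using bspec[OF *, of "Matrix.vec n v"] sform_eq_scalar_prod[OF that, of
      "Matrix.vec n v"]
      by (simp del: index_vec)
  qed (use that in \<open>simp add: sform_eq_scalar_prod\<close>)
  thus ?thesis unfolding psd_mats_def by auto
qed

lemma psd_matsD:
  assumes "A \<in> psd_mats n"
  shows "A \<in> carrier_mat n n" "0 \<le> sform n A v"
  using assms by (auto simp: psd_mats_iff)

definition pair_vec :: "nat \<Rightarrow> nat \<Rightarrow> complex \<Rightarrow> nat \<Rightarrow> complex" where
  "pair_vec i j c k = (if k = i then 1 else 0) + c * (if k = j then 1 else 0)"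

lemma sform_pair_vec:
  assumes "i < n" "j < n"
  shows "sform n A (pair_vec i j c) = A $$ (i, i) + c * A $$ (i, j) + cnj c * A $$ (j, i) + cnj c *
      c * A $$ (j, j)"
proof -
  have "sform n A (pair_vec i j c) = (\<Sum>k<n. \<Sum>l<n. (if k = i then if l = i then A $$ (i, i) else 0
      else 0)
     + (if k = i then if l = j then c * A $$ (i, j) else 0 else 0)
     + (if k = j then if l = i then cnj c * A $$ (j, i) else 0 else 0)
     + (if k = j then if l = j then cnj c * c * A $$ (j, j) else 0 else 0))"
    unfolding sform_def by (intro sum.cong refl) (auto simp: pair_vec_def algebra_simps)
  also have "\<dots> = A $$ (i, i) + c * A $$ (i, j) + cnj c * A $$ (j, i) + cnj c * c * A $$ (j, j)"
  proof -
    have s: "(\<Sum>k<n. \<Sum>l<n. if k = a then if l = b then X else 0 else 0) = X" if "a < n" "b < n" for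
      a b and X :: complex
      using that by (subst sum.swap) (simp add: sum.delta)
    show ?thesis unfolding sum.distrib using assms by (simp add: s)
  qed
  finally show ?thesis .
qed

text \<open>The values at e_i + c e_j for c = 1 and c = \<i>, corrected by the diagonal entries (c =
  0), isolate a single entry. This later transfers convergence of quadratic forms to convergence of
  matrix entries.\<close>

lemma polarization:
  assumes "i < n" "j < n"
  shows "A $$ (i, j) = (sform n A (pair_vec i j 1) - sform n A (pair_vec i j 0) - sform n A
      (pair_vec j i 0)
     - \<i> * (sform n A (pair_vec i j \<i>) - sform n A (pair_vec i j 0) - sform n A (pair_vec j i 0)))
       / 2"
  unfolding sform_pair_vec[OF assms] sform_pair_vec[OF assms(2,1)]
  by (simp add: algebra_simps)

lemma psd_mats_hermitian:
  assumes "A \<in> psd_mats n"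
  shows "mat_adjoint A = A"
proof (rule eq_matI)
  have Ac: "A \<in> carrier_mat n n" using assms psd_matsD by auto
  fix i j assume "i < dim_row A" "j < dim_col A"
  hence ij: "i < n" "j < n" using Ac by auto
  have cnj_s: "cnj (sform n A v) = sform n A v" for v
    using psd_matsD(2)[OF assms, of v] by (simp add: complex_eq_iff less_eq_complex_def)
  have "cnj (A $$ (j, i)) = A $$ (i, j)"
    using cnj_s[of "pair_vec i j 1"] cnj_s[of "pair_vec i j \<i>"] cnj_s[of "pair_vec i j 0"] cnj_s[of
      "pair_vec j i 0"]
    unfolding sform_pair_vec[OF ij] sform_pair_vec[OF ij(2,1)]
    by (auto simp: complex_eq_iff)
  thus "mat_adjoint A $$ (i, j) = A $$ (i, j)" using Ac ij by simp
qed (use psd_matsD(1)[OF assms] in auto)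

lemma sform_cong_diag:
  assumes U: "U \<in> carrier_mat n n"
  shows "sform n (cong_diag n U d) v = of_real (\<Sum>k<n. d k * (cmod (\<Sum>i<n. cnj (U $$ (i, k)) * v
      i))\<^sup>2)"
proof -
  have "sform n (cong_diag n U d) v = (\<Sum>i<n. \<Sum>j<n. \<Sum>k<n. of_real (d k) * ((U $$ (i, k) * cnj (v i))
      * (cnj (U $$ (j, k)) * v j)))"
    unfolding sform_def
    by (intro sum.cong refl) (simp add: index_cong_diag[OF U] sum_distrib_left sum_distrib_right
      mult_ac)
  also have "\<dots> = (\<Sum>i<n. \<Sum>k<n. \<Sum>j<n. of_real (d k) * ((U $$ (i, k) * cnj (v i)) * (cnj (U $$ (j, k))
      * v j)))"
    by (intro sum.cong refl sum.swap)
  also have "\<dots> = (\<Sum>k<n. \<Sum>i<n. \<Sum>j<n. of_real (d k) * ((U $$ (i, k) * cnj (v i)) * (cnj (U $$ (j, k))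
      * v j)))"
    by (rule sum.swap)
  also have "\<dots> = (\<Sum>k<n. of_real (d k) * ((\<Sum>i<n. U $$ (i, k) * cnj (v i)) * (\<Sum>j<n. cnj (U $$ (j, k))
      * v j)))"
    unfolding sum_product by (simp only: sum_distrib_left)
  also have "\<dots> = (\<Sum>k<n. of_real (d k) * of_real ((cmod (\<Sum>i<n. cnj (U $$ (i, k)) * v i))\<^sup>2))"
  proof (intro sum.cong refl, goal_cases)
    case (1 k)
    have "(\<Sum>i<n. U $$ (i, k) * cnj (v i)) = cnj (\<Sum>i<n. cnj (U $$ (i, k)) * v i)" by simp
    thus ?case by (simp only: complex_norm_square mult.commute)
  qed
  finally show ?thesis by simp
qed

lemma psd_cong_diag:
  assumes "U \<in> carrier_mat n n" "\<And>i. i < n \<Longrightarrow> d i \<ge> 0"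
  shows "cong_diag n U d \<in> psd_mats n"
  unfolding psd_mats_iff sform_cong_diag[OF assms(1)] using assms
  by (auto simp: less_eq_complex_def intro!: sum_nonneg)

lemma psd_spectral:
  assumes A: "A \<in> psd_mats n"
  obtains U d where "U \<in> unitary_mats n" "A = cong_diag n U d" "\<And>i. d i \<ge> 0"
proof -
  from hermitian_spectral[OF psd_matsD(1)[OF A] psd_mats_hermitian[OF A]]
  obtain U d where U: "U \<in> unitary_mats n" and Ad: "A = cong_diag n U d" unfolding cong_diag_def by
    metis
  note Uc = unitary_matsD[OF U]
  \<comment> \<open>Evaluating the form at column \<open>k\<close> of \<open>U\<close> isolates the
    eigenvalue \<open>d k\<close>.\<close>
  have "d k \<ge> 0" if k: "k < n" for k
  proof -
    have *: "(\<Sum>i<n. cnj (U $$ (i, l)) * U $$ (i, k)) = (if l = k then 1 else 0)" if "l < n" for l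
    proof -
      have "(mat_adjoint U * U) $$ (l, k) = (\<Sum>i<n. mat_adjoint U $$ (l, i) * U $$ (i, k))"
        by (rule index_mult_mat_sum[OF Uc(2,1)]) (use that k in auto)
      also have "\<dots> = (\<Sum>i<n. cnj (U $$ (i, l)) * U $$ (i, k))" using that Uc(1) by (intro sum.cong)
        auto
      finally show ?thesis unfolding Uc(3) using that k by simp
    qed
    have "(\<Sum>l<n. d l * (cmod (\<Sum>i<n. cnj (U $$ (i, l)) * U $$ (i, k)))\<^sup>2) = (\<Sum>l<n. if l = k then d k
        else 0)"
      by (intro sum.cong) (auto simp: *)
    also have "\<dots> = d k" using k by simp
    finally have "sform n A (\<lambda>i. U $$ (i, k)) = of_real (d k)"
      unfolding Ad sform_cong_diag[OF Uc(1)] by simp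
    thus ?thesis using psd_matsD(2)[OF A, of "\<lambda>i. U $$ (i, k)"] by (simp add: less_eq_complex_def)
  qed
  \<comment> \<open>Values of \<open>d\<close> beyond the dimension do not affect the matrix;
    absolute values make nonnegativity hold at every index.\<close>
  hence "A = cong_diag n U (\<lambda>i. \<bar>d i\<bar>)" unfolding Ad by (intro cong_diag_cong) auto
  with U show ?thesis using that by (metis abs_ge_zero)
qed

lemma psd_mats_lin:
  assumes "A \<in> psd_mats n" "B \<in> psd_mats n" "s \<ge> 0" "t \<ge> 0"
  shows "complex_of_real s \<cdot>\<^sub>m A + complex_of_real t \<cdot>\<^sub>m B \<in> psd_mats n"
proof -
  note c = psd_matsD(1)[OF assms(1)] psd_matsD(1)[OF assms(2)]
  have "sform n (complex_of_real s \<cdot>\<^sub>m A + complex_of_real t \<cdot>\<^sub>m B) v = of_real s * sform n A v +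
      of_real t * sform n B v" for v
  proof -
    have "sform n (complex_of_real s \<cdot>\<^sub>m A + complex_of_real t \<cdot>\<^sub>m B) v
        = (\<Sum>i<n. \<Sum>j<n. of_real s * (cnj (v i) * A $$ (i, j) * v j) + of_real t * (cnj (v i) * B $$
          (i, j) * v j))"
      unfolding sform_def using c by (intro sum.cong refl) (simp add: algebra_simps)
    thus ?thesis by (simp only: sform_def sum.distrib sum_distrib_left)
  qed
  thus ?thesis using c psd_matsD(2)[OF assms(1)] psd_matsD(2)[OF assms(2)] assms(3,4)
    unfolding psd_mats_iff by (auto simp: less_eq_complex_def)
qed

section \<open>Trace forms and their diagonalization\<close>

definition tform :: "complex mat \<Rightarrow> complex mat \<Rightarrow> complex mat \<Rightarrow> real" where
  "tform A Z Y = Re (mat_trace (mat_adjoint Z * A * Z * Y))"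

text \<open>Left multiplication by the first matrix commutes with right multiplication by the
  second, so one change of coordinates diagonalizes both, with products of the two diagonals as
  weights. Cyclicity of the trace moves \<open>mat_adjoint V\<close> to the front, which works for
  congruences as well as for unitary matrices.\<close>

lemma tform_cong_diag:
  assumes c: "U \<in> carrier_mat n n" "V \<in> carrier_mat n n" "Z \<in> carrier_mat n n"
  shows "tform (cong_diag n U d) Z (cong_diag n V e)
    = (\<Sum>i<n. \<Sum>j<n. d i * e j * (cmod ((mat_adjoint U * Z * V) $$ (i, j)))\<^sup>2)"
proof -
  define K where "K = mat_adjoint U * Z * V"
  let ?D = "\<lambda>d. mat_diag n (\<lambda>i. complex_of_real (d i))"
  have K: "K \<in> carrier_mat n n"
    unfolding K_def using c by (simp add: mult_carrier_mat[of _ n n _ n])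
  have a: "mat_adjoint Z * cong_diag n U d * Z * cong_diag n V e = (mat_adjoint Z * U * ?D d *
      mat_adjoint U * Z * V * ?D e) * mat_adjoint V"
    using c by (simp add: cong_diag_def assoc_mult_mat[of _ n n _ n _ n] mult_carrier_mat[of _ n n
      _ n])
  have "mat_trace (mat_adjoint Z * cong_diag n U d * Z * cong_diag n V e)
      = mat_trace (mat_adjoint V * (mat_adjoint Z * U * ?D d * mat_adjoint U * Z * V * ?D e))"
    unfolding a by (rule mat_trace_mult_comm[of _ n n]) (use c in
      \<open>simp_all add: mult_carrier_mat[of _ n n _ n]\<close>)
  also have "mat_adjoint V * (mat_adjoint Z * U * ?D d * mat_adjoint U * Z * V * ?D e) =
      mat_adjoint K * (?D d * K * ?D e)"
    unfolding K_def using c by (simp add: mat_adjoint_mult[of _ n n _ n] assoc_mult_mat[of _ n n _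
      n _ n] mult_carrier_mat[of _ n n _ n])
  also have "mat_trace \<dots> = (\<Sum>j<n. \<Sum>i<n. mat_adjoint K $$ (j, i) * (?D d * K * ?D e) $$ (i, j))"
    unfolding mat_trace_def using K
    by (intro sum.cong refl index_mult_mat_sum[of _ n n _ n]) (simp_all add: mult_carrier_mat[of _
      n n _ n])
  also have "\<dots> = (\<Sum>j<n. \<Sum>i<n. of_real (d i * e j * (cmod (K $$ (i, j)))\<^sup>2))"
  proof (intro sum.cong refl, goal_cases)
    case (1 j i)
    have "(?D d * K * ?D e) $$ (i, j) = of_real (d i) * K $$ (i, j) * of_real (e j)"
      using 1 K by (simp add: mat_diag_mult_left[OF K] mat_diag_mult_right[of _ n n])
    thus ?case using 1 K by (simp only: of_real_mult complex_norm_square) simp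
  qed
  finally show ?thesis unfolding tform_def K_def[symmetric] by (subst sum.swap) simp
qed

lemma tform_lin_left:
  assumes "A \<in> carrier_mat n n" "B \<in> carrier_mat n n" "Z \<in> carrier_mat n n" "Y \<in> carrier_mat n n"
  shows "tform (complex_of_real s \<cdot>\<^sub>m A + complex_of_real t \<cdot>\<^sub>m B) Z Y = s * tform A Z Y + t *
      tform B Z Y"
proof -
  let ?f = "\<lambda>X. mat_adjoint Z * X * Z * Y"
  have "?f (complex_of_real s \<cdot>\<^sub>m A + complex_of_real t \<cdot>\<^sub>m B) = complex_of_real s \<cdot>\<^sub>m ?f A +
      complex_of_real t \<cdot>\<^sub>m ?f B"
    using assms by (simp add: mult_add_distrib_mat[of _ n n _ n] add_mult_distrib_mat[of _ n n _ _
      n]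
      mult_smult_distrib[of _ n n _ n] mult_smult_assoc_mat[of _ n n _ n] mult_carrier_mat[of _ n n
        _ n])
  thus ?thesis using assms
    by (simp add: tform_def mat_trace_add[of _ n] mat_trace_smult[of _ n] mult_carrier_mat[of _ n n
      _ n])
qed

lemma tform_lin_right:
  assumes "A \<in> carrier_mat n n" "X \<in> carrier_mat n n" "Z \<in> carrier_mat n n" "Y \<in> carrier_mat n n"
  shows "tform A Z (complex_of_real s \<cdot>\<^sub>m X + complex_of_real t \<cdot>\<^sub>m Y) = s * tform A Z X + t *
      tform A Z Y"
proof -
  let ?f = "\<lambda>X. mat_adjoint Z * A * Z * X"
  have "?f (complex_of_real s \<cdot>\<^sub>m X + complex_of_real t \<cdot>\<^sub>m Y) = complex_of_real s \<cdot>\<^sub>m ?f X +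
      complex_of_real t \<cdot>\<^sub>m ?f Y"
    using assms by (simp add: mult_add_distrib_mat[of _ n n _ n]
      mult_smult_distrib[of _ n n _ n] mult_carrier_mat[of _ n n _ n])
  thus ?thesis using assms
    by (simp add: tform_def mat_trace_add[of _ n] mat_trace_smult[of _ n] mult_carrier_mat[of _ n n
      _ n])
qed

text \<open>Placing a vector in column 0 embeds ordinary quadratic forms among the trace forms, so
  that inequalities for \<open>tform\<close> specialize to \<open>sform\<close>.\<close>

definition single_col :: "nat \<Rightarrow> (nat \<Rightarrow> complex) \<Rightarrow> complex mat" where
  "single_col n v = Matrix.mat n n (\<lambda>(i, j). if j = 0 then v i else 0)"

lemma single_col_carrier [simp]: "single_col n v \<in> carrier_mat n n"
  by (simp add: single_col_def)

lemma tform_single_col: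
  assumes A: "A \<in> carrier_mat n n" and n: "n > 0"
  shows "tform A (single_col n v) (1\<^sub>m n) = Re (sform n A v)"
proof -
  let ?Z = "single_col n v"
  have AZ: "A * ?Z \<in> carrier_mat n n" using A by (simp add: mult_carrier_mat[of _ n n _ n])
  have "mat_trace (mat_adjoint ?Z * A * ?Z * 1\<^sub>m n) = mat_trace (mat_adjoint ?Z * (A * ?Z))"
    using A right_mult_one_mat[of ?Z n n] by (simp add: assoc_mult_mat[of _ n n _ n _ n]
      mult_carrier_mat[of _ n n _ n])
  also have "\<dots> = (\<Sum>k<n. \<Sum>i<n. mat_adjoint ?Z $$ (k, i) * (A * ?Z) $$ (i, k))"
    unfolding mat_trace_def using AZ
    by (intro sum.cong refl index_mult_mat_sum[of _ n n _ n]) (simp_all add: single_col_def)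
  also have "\<dots> = (\<Sum>k<n. \<Sum>i<n. mat_adjoint ?Z $$ (k, i) * (\<Sum>j<n. A $$ (i, j) * ?Z $$ (j, k)))"
    using A by (intro sum.cong refl arg_cong2[of _ _ _ _ "(*)"] index_mult_mat_sum[of _ n n _ n])
      auto
  also have "\<dots> = (\<Sum>k<n. if k = 0 then sform n A v else 0)"
    by (intro sum.cong refl) (auto simp: single_col_def sform_def sum_distrib_left mult_ac intro!:
      sum.cong sum.neutral)
  also have "\<dots> = sform n A v" using n by simp
  finally show ?thesis unfolding tform_def by simp
qed

lemma tform_one:
  assumes "A \<in> carrier_mat n n"
  shows "tform A (1\<^sub>m n) (1\<^sub>m n) = Re (mat_trace A)"
  using assms by (simp add: tform_def mult_carrier_mat[of _ n n _ n])

text \<open>Let \<open>R\<close> be the square root of \<open>P\<close>, with inverse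
  \<open>R'\<close>, and let \<open>V\<close> diagonalize \<open>R' * Q * R'\<close>. In the
  coordinates given by \<open>T = R * V\<close> the form \<open>P\<close> is the identity,
  \<open>Q\<close> is diagonal, and the mean acts by \<open>powr\<close> on that diagonal. Since
  \<open>T\<close> is not unitary in general, its inverse \<open>S\<close> is provided too.\<close>

lemma geo_mean_supp_cong_diag:
  assumes U: "U \<in> unitary_mats n" and P: "P = cong_diag n U a" and a: "\<And>i. i < n \<Longrightarrow> a i > 0"
    and Q: "Q \<in> psd_mats n" and \<alpha>: "\<alpha> > 0"
  obtains T S w where "T \<in> carrier_mat n n" "S \<in> carrier_mat n n" "T * S = 1\<^sub>m n" "S * T = 1\<^sub>m n"
    "\<And>i. w i \<ge> 0" "P = cong_diag n T (\<lambda>_. 1)" "Q = cong_diag n T w"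
    "geo_mean_supp \<alpha> P Q = cong_diag n T (\<lambda>i. w i powr \<alpha>)"
proof -
  define R where "R = cong_diag n U (\<lambda>i. a i powr (1/2))"
  define R' where "R' = cong_diag n U (\<lambda>i. inverse (a i) powr (1/2))"
  note Uc = unitary_matsD[OF U] and Qc = psd_matsD(1)[OF Q]
  have Rc: "R \<in> carrier_mat n n" "R' \<in> carrier_mat n n" using Uc by (auto simp: R_def R'_def)
  have Radj: "mat_adjoint R = R" "mat_adjoint R' = R'"
    using Uc by (auto simp: R_def R'_def mat_adjoint_cong_diag)
  have "cong_diag n U (\<lambda>i. a i powr (1/2) * inverse (a i) powr (1/2)) = cong_diag n U (\<lambda>_. 1)"
    by (intro cong_diag_cong) (use a in \<open>fastforce simp flip: powr_mult\<close>)
  hence RR': "R * R' = 1\<^sub>m n"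
    unfolding R_def R'_def cong_diag_mult_cong_diag[OF U] using cong_diag_one[OF U] by simp
  hence R'R: "R' * R = 1\<^sub>m n" using mat_mult_left_right_inverse[OF Rc] by simp
  define W where "W = R' * Q * R'"
  from psd_spectral[OF Q] obtain Uq q where Uq: "Uq \<in> unitary_mats n" "Q = cong_diag n Uq q"
    "\<And>i. q i \<ge> 0" by metis
  have "W = cong_diag n (R' * Uq) q"
    unfolding W_def Uq(2) using cong_diag_mult_left[OF Rc(2) unitary_matsD(1)[OF Uq(1)], of q] Radj
      by simp
  hence "W \<in> psd_mats n"
    using psd_cong_diag[of "R' * Uq" n q] Uq Rc unitary_matsD(1)[OF Uq(1)] by (simp add:
      mult_carrier_mat[of _ n n _ n])
  then obtain V w where V: "V \<in> unitary_mats n" "W = cong_diag n V w" "\<And>i. w i \<ge> 0"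
    using psd_spectral by metis
  note Vc = unitary_matsD[OF V(1)]
  define T where "T = R * V"
  define S where "S = mat_adjoint V * R'"
  have T: "R * cong_diag n V d * R = cong_diag n T d" for d
    unfolding T_def using cong_diag_mult_left[OF Rc(1) Vc(1), of d] Radj by simp
  have Tc: "T \<in> carrier_mat n n" "S \<in> carrier_mat n n"
    unfolding T_def S_def using Rc Vc by (auto simp: mult_carrier_mat[of _ n n _ n])
  have "S * T = mat_adjoint V * (R' * R) * V" unfolding S_def T_def using Rc Vc(1,2)
    by (simp add: assoc_mult_mat[of _ n n _ n _ n] mult_carrier_mat[of _ n n _ n])
  hence ST: "S * T = 1\<^sub>m n" using R'R Vc right_mult_one_mat[OF Vc(2)] by simp
  hence TS: "T * S = 1\<^sub>m n" using mat_mult_left_right_inverse[OF Tc(2,1)] by simp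
  have "P = R * R"
    unfolding P R_def cong_diag_mult_cong_diag[OF U]
    by (intro cong_diag_cong) (use a in \<open>fastforce simp flip: powr_add\<close>)
  also have "\<dots> = R * cong_diag n V (\<lambda>_. 1) * R" unfolding cong_diag_one[OF V(1)] using Rc by simp
  finally have P1: "P = cong_diag n T (\<lambda>_. 1)" unfolding T .
  have "cong_diag n T w = (R * R') * Q * (R' * R)"
    unfolding T[symmetric] V(2)[symmetric] W_def using Rc Qc
    by (simp add: assoc_mult_mat[of _ n n _ n _ n] mult_carrier_mat[of _ n n _ n])
  hence Q1: "Q = cong_diag n T w" unfolding RR' R'R using Qc by simp
  have "geo_mean_supp \<alpha> P Q = R * mat_powr W \<alpha> * R"
    using U a unfolding geo_mean_supp_def P W_def R_def R'_def
    by (simp add: mat_powr_cong_diag mat_powr_minus_cong_diag)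
  also have "\<dots> = cong_diag n T (\<lambda>i. w i powr \<alpha>)"
    unfolding V(2) using \<alpha> by (simp add: mat_powr_cong_diag[OF V(1)] T)
  finally show ?thesis using that Tc TS ST V(3) P1 Q1 by blast
qed

lemma psd_plus_eps:
  assumes P: "P \<in> psd_mats n" and \<epsilon>: "\<epsilon> > 0"
  obtains U a where "U \<in> unitary_mats n" "P + complex_of_real \<epsilon> \<cdot>\<^sub>m 1\<^sub>m n = cong_diag n U a"
    "\<And>i. a i > 0"
proof -
  from psd_spectral[OF P] obtain U d where U: "U \<in> unitary_mats n" "P = cong_diag n U d"
    "\<And>i. d i \<ge> 0" by metis
  note Uc = unitary_matsD[OF U(1)]
  have "P + complex_of_real \<epsilon> \<cdot>\<^sub>m 1\<^sub>m n = cong_diag n U (\<lambda>i. d i + \<epsilon>)"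
    unfolding U(2) cong_diag_one[OF U(1), symmetric]
    by (rule eq_matI) (use Uc in \<open>auto simp: index_cong_diag sum_distrib_left sum.distrib
      algebra_simps\<close>)
  with U that \<epsilon> show ?thesis by (metis add_nonneg_pos)
qed

section \<open>Interpolation of quadratic forms\<close>

text \<open>The integrand of the geometric-mean representation at a = b = 1. In the logarithmic
  variable a change of the ratio b / a is a translation, so every pair of positive numbers reduces
  to this one.\<close>

definition interp_kernel :: "real \<Rightarrow> real \<Rightarrow> real" where
  "interp_kernel \<theta> x = exp (\<theta> * x) / (1 + exp x)"

lemma integrable_exp_half_line:
  assumes c: "c > (0::real)"
  shows "integrable lborel (\<lambda>x. exp (- c * x) * indicator {0..} x)"
proof (rule integrableI_nonneg)
  have "(\<integral>\<^sup>+x. ennreal (exp (- c * x)) * indicator {0..} x \<partial>lborel) = ennreal (0 - (- (1 / c) * exp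
      (- c * 0)))"
  proof (rule nn_integral_FTC_atLeast)
    fix x :: real
    show "DERIV (\<lambda>x. - (1 / c) * exp (- c * x)) x :> exp (- c * x)"
      using c by (auto intro!: derivative_eq_intros)
    show "((\<lambda>x. - (1 / c) * exp (- c * x)) \<longlongrightarrow> 0) at_top"
      using c by real_asymp
  qed auto
  thus "(\<integral>\<^sup>+x. ennreal (exp (- c * x) * indicator {0..} x) \<partial>lborel) < \<infinity>"
    by (simp add: ennreal_mult' ennreal_indicator)
qed auto

text \<open>The right tail is bounded by exp (- (1 - \<theta>) * x) and the left tail by exp
  (\<theta> * x); each bound on \<theta> makes one tail integrable.\<close>

lemma integrable_interp_kernel:
  assumes \<theta>: "0 < \<theta>" "\<theta> < 1"
  shows "integrable lborel (interp_kernel \<theta>)"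
proof (rule Bochner_Integration.integrable_bound)
  let ?g = "\<lambda>c x. exp (- c * x) * indicator {0..} (x :: real) :: real"
  have "integrable lborel (\<lambda>x. ?g \<theta> (0 + (-1) * x))"
    using integrable_exp_half_line[OF \<theta>(1)] by (subst lborel_integrable_real_affine_iff) simp_all
  hence "integrable lborel (\<lambda>x. ?g \<theta> (- x))" by simp
  thus "integrable lborel (\<lambda>x. ?g (1 - \<theta>) x + ?g \<theta> (- x))"
    using \<theta> by (intro Bochner_Integration.integrable_add integrable_exp_half_line) auto
  show "interp_kernel \<theta> \<in> borel_measurable lborel"
    unfolding interp_kernel_def by measurable
  show "AE x in lborel. norm (interp_kernel \<theta> x) \<le> norm (?g (1 - \<theta>) x + ?g \<theta> (- x))"
  proof (intro AE_I2)
    fix x :: real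
    have *: "1 + exp x > 0" by (simp add: add_pos_pos)
    show "norm (interp_kernel \<theta> x) \<le> norm (?g (1 - \<theta>) x + ?g \<theta> (- x))"
    proof (cases "x \<ge> 0")
      case True
      have "interp_kernel \<theta> x \<le> exp (\<theta> * x) / exp x"
        unfolding interp_kernel_def by (intro divide_left_mono) (auto simp: *)
      also have "\<dots> = exp (- (1 - \<theta>) * x)"
        by (simp add: exp_diff[symmetric] algebra_simps)
      also have "\<dots> \<le> ?g (1 - \<theta>) x + ?g \<theta> (- x)" using True by (simp add: indicator_def)
      finally show ?thesis using * by (simp add: interp_kernel_def)
    next
      case False
      have "interp_kernel \<theta> x \<le> exp (\<theta> * x) / 1"
        unfolding interp_kernel_def by (intro divide_left_mono) (auto simp: *)
      also have "\<dots> \<le> ?g (1 - \<theta>) x + ?g \<theta> (- x)" using False by (simp add: indicator_def)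
      finally show ?thesis using * by (simp add: interp_kernel_def)
    qed
  qed
qed

text \<open>The value is pi / sin (pi * \<theta>); its positivity allows it to be cancelled from
  integrated inequalities.\<close>

definition interp_const :: "real \<Rightarrow> real" where
  "interp_const \<theta> = (\<integral>x. interp_kernel \<theta> x \<partial>lborel)"

lemma interp_const_pos:
  assumes \<theta>: "0 < \<theta>" "\<theta> < 1"
  shows "interp_const \<theta> > 0"
proof -
  have pos: "interp_kernel \<theta> x > 0" for x by (simp add: interp_kernel_def add_pos_pos)
  have nn: "interp_const \<theta> \<ge> 0"
    unfolding interp_const_def by (intro integral_nonneg_AE AE_I2) (simp add: less_imp_le pos)
  have "interp_const \<theta> \<noteq> 0"
  proof
    assume "interp_const \<theta> = 0"
    hence "AE x in lborel. interp_kernel \<theta> x = 0"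
      using integral_nonneg_eq_0_iff_AE[OF integrable_interp_kernel[OF \<theta>]]
      by (simp add: interp_const_def pos less_imp_le)
    moreover have "(interp_kernel \<theta> x = 0) = False" for x using pos[of x] by simp
    ultimately have "AE x in (lborel :: real measure). False" by simp
    thus False by (auto simp: ae_filter_eq_bot_iff eventually_False)
  qed
  with nn show ?thesis by simp
qed

text \<open>The least value of a |x|^2 + b |w|^2 subject to x + w = 1. Division by zero gives 0 at a
  = b = 0, which is the correct minimum there.\<close>

definition par_sum :: "real \<Rightarrow> real \<Rightarrow> real" where
  "par_sum a b = a * b / (a + b)"

lemma has_bochner_integral_par_sum:
  assumes \<theta>: "0 < \<theta>" "\<theta> < 1" and ab: "a \<ge> 0" "b \<ge> 0"
  shows "has_bochner_integral lborel (\<lambda>x. exp ((\<theta> - 1) * x) * par_sum a (exp x * b))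
    (interp_const \<theta> * (a powr \<theta> * b powr (1 - \<theta>)))"
proof (cases "a = 0 \<or> b = 0")
  case True
  thus ?thesis by (auto simp: par_sum_def)
next
  case False
  hence ab: "a > 0" "b > 0" using ab by auto
  \<comment> \<open>Translation by this amount carries the kernel to the integrand for
    \<open>a\<close> and \<open>b\<close>, up to the factor a^\<theta> b^(1-\<theta>).\<close>
  define c where "c = ln (b / a)"
  have ec: "exp c = b / a" using ab by (simp add: c_def)
  have h: "has_bochner_integral lborel (interp_kernel \<theta>) (interp_const \<theta>)"
    unfolding interp_const_def by (rule has_bochner_integral_integrable[OF
      integrable_interp_kernel[OF \<theta>]])
  have "has_bochner_integral lborel (\<lambda>x. interp_kernel \<theta> (c + 1 * x)) (interp_const \<theta> /\<^sub>R \<bar>1\<bar>)"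
    using h by (subst (asm) lborel_has_bochner_integral_real_affine_iff[of 1 _ _ c]) auto
  hence "has_bochner_integral lborel (\<lambda>x. (a powr \<theta> * b powr (1 - \<theta>)) * interp_kernel \<theta> (c + x))
      ((a powr \<theta> * b powr (1 - \<theta>)) * interp_const \<theta>)"
    by (intro has_bochner_integral_mult_right) auto
  moreover have "(a powr \<theta> * b powr (1 - \<theta>)) * interp_kernel \<theta> (c + x) = exp ((\<theta> - 1) * x) *
      par_sum a (exp x * b)" for x
  proof -
    have "(a powr \<theta> * b powr (1 - \<theta>)) * exp (\<theta> * c) = b"
    proof -
      have "exp (\<theta> * c) = (b / a) powr \<theta>" using ab by (simp add: powr_def c_def)
      also have "\<dots> = b powr \<theta> / a powr \<theta>" using ab by (simp add: powr_divide)
      finally have "(a powr \<theta> * b powr (1 - \<theta>)) * exp (\<theta> * c) = b powr (1 - \<theta>) * b powr \<theta>" using ab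
        by simp
      thus ?thesis using ab by (simp flip: powr_add)
    qed
    moreover have "exp (\<theta> * (c + x)) = exp (\<theta> * c) * exp (\<theta> * x)" by (simp add: exp_add
      distrib_left)
    ultimately have "(a powr \<theta> * b powr (1 - \<theta>)) * interp_kernel \<theta> (c + x) = b * exp (\<theta> * x) / (1 +
        b / a * exp x)"
      unfolding interp_kernel_def exp_add ec by (simp add: mult_ac)
    also have "\<dots> = exp (\<theta> * x) * (a * b / (a + exp x * b))"
    proof -
      have "1 + b / a * exp x = (a + exp x * b) / a" using ab by (simp add: field_simps)
      thus ?thesis by (simp only: divide_divide_eq_right mult_ac times_divide_eq_right
        times_divide_eq_left)
    qed
    also have "exp (\<theta> * x) = exp ((\<theta> - 1) * x) * exp x" by (simp add: algebra_simps flip: exp_add)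
    finally show ?thesis by (simp add: par_sum_def)
  qed
  ultimately show ?thesis by (simp add: mult.commute)
qed

lemma par_sum_le:
  fixes x w :: complex
  assumes "a \<ge> 0" "b \<ge> 0"
  shows "par_sum a b * (cmod (x + w))\<^sup>2 \<le> a * (cmod x)\<^sup>2 + b * (cmod w)\<^sup>2"
proof (cases "a + b = 0")
  case True
  thus ?thesis using assms by (simp add: par_sum_def)
next
  case False
  hence ab: "a + b > 0" using assms by simp
  have "a * b * (cmod (x + w))\<^sup>2 \<le> a * b * (cmod x + cmod w)\<^sup>2"
    using assms by (intro mult_left_mono power_mono norm_triangle_ineq) auto
  \<comment> \<open>After the triangle inequality the remaining gap, multiplied by a + b, is exactly
    this square.\<close>
  also have "\<dots> \<le> a * b * (cmod x + cmod w)\<^sup>2 + (a * cmod x - b * cmod w)\<^sup>2" by simp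
  also have "\<dots> = (a * (cmod x)\<^sup>2 + b * (cmod w)\<^sup>2) * (a + b)"
    by (simp add: power2_eq_square algebra_simps)
  finally show ?thesis using ab by (simp add: par_sum_def pos_divide_le_eq)
qed

text \<open>The share of z given to the first summand by the minimizing splitting z = x + w,
  characterized by a x = b w.\<close>

definition par_split :: "real \<Rightarrow> real \<Rightarrow> real" where
  "par_split a b = (if a + b = 0 then 0 else b / (a + b))"

lemma par_split_eq:
  fixes z :: complex
  assumes "a \<ge> 0" "b \<ge> 0"
  shows "a * (cmod (of_real (par_split a b) * z))\<^sup>2 + b * (cmod (of_real (1 - par_split a b) *
      z))\<^sup>2 = par_sum a b * (cmod z)\<^sup>2"
proof (cases "a + b = 0")
  case True
  hence "a = 0" "b = 0" using assms by auto
  thus ?thesis by (simp add: par_sum_def)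
next
  case False
  have 1: "1 - par_split a b = a / (a + b)" using False by (simp add: par_split_def field_simps)
  have "a * (cmod (of_real (par_split a b) * z))\<^sup>2 + b * (cmod (of_real (1 - par_split a b) * z))\<^sup>2
      = (a * (par_split a b)\<^sup>2 + b * (1 - par_split a b)\<^sup>2) * (cmod z)\<^sup>2"
    by (simp only: norm_mult norm_of_real power_mult_distrib power2_abs) (simp add: algebra_simps)
  also have "a * (par_split a b)\<^sup>2 + b * (1 - par_split a b)\<^sup>2 = a * b * (a + b) / (a + b)\<^sup>2"
    unfolding 1 using False by (simp add: par_split_def power_divide add_divide_distrib[symmetric])
      (simp add: power2_eq_square algebra_simps)
  also have "\<dots> = par_sum a b" using False by (simp add: par_sum_def power2_eq_square)
  finally show ?thesis .
qed

section \<open>Infimal convolution and interpolation of weighted forms on matrices\<close>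

lemma has_bochner_integral_le:
  fixes f g :: "'a \<Rightarrow> real"
  assumes "has_bochner_integral M f x" "has_bochner_integral M g y" "\<And>z. f z \<le> g z"
  shows "x \<le> y"
  using assms integral_mono[of M f g] by (auto simp: has_bochner_integral_iff)

text \<open>Weights depending on both indices are allowed because the parallel sum of two product
  weights d_i e_j is in general not a product.\<close>

definition wform :: "nat \<Rightarrow> complex mat \<Rightarrow> complex mat \<Rightarrow> (nat \<Rightarrow> nat \<Rightarrow> real) \<Rightarrow> complex mat \<Rightarrow> real"
  where
  "wform n U V a Z = (\<Sum>i<n. \<Sum>j<n. a i j * (cmod ((mat_adjoint U * Z * V) $$ (i, j)))\<^sup>2)"

lemma wform_tform:
  assumes "U \<in> carrier_mat n n" "V \<in> carrier_mat n n" "Z \<in> carrier_mat n n"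
  shows "tform (cong_diag n U d) Z (cong_diag n V e) = wform n U V (\<lambda>i j. d i * e j) Z"
  using tform_cong_diag[OF assms] by (simp add: wform_def)

lemma wform_par_sum_le:
  assumes c: "U \<in> carrier_mat n n" "V \<in> carrier_mat n n" "X \<in> carrier_mat n n" "W \<in> carrier_mat n n"
    and a: "\<And>i j. a i j \<ge> 0" and b: "\<And>i j. b i j \<ge> 0" and t: "t \<ge> 0"
  shows "wform n U V (\<lambda>i j. par_sum (a i j) (t * b i j)) (X + W) \<le> wform n U V a X + t * wform n U
      V b W"
proof -
  have "mat_adjoint U * (X + W) * V = mat_adjoint U * X * V + mat_adjoint U * W * V"
    using c by (simp add: mult_add_distrib_mat[of _ n n _ n] add_mult_distrib_mat[of _ n n _ _ n]
      mult_carrier_mat[of _ n n _ n])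
  hence "(mat_adjoint U * (X + W) * V) $$ (i, j) = (mat_adjoint U * X * V) $$ (i, j) + (mat_adjoint
      U * W * V) $$ (i, j)"
    if "i < n" "j < n" for i j using that c by simp
  hence "wform n U V (\<lambda>i j. par_sum (a i j) (t * b i j)) (X + W)
     \<le> (\<Sum>i<n. \<Sum>j<n. a i j * (cmod ((mat_adjoint U * X * V) $$ (i, j)))\<^sup>2 + t * b i j * (cmod
       ((mat_adjoint U * W * V) $$ (i, j)))\<^sup>2)"
    unfolding wform_def using a b t by (intro sum_mono) (simp add: par_sum_le)
  thus ?thesis by (simp add: wform_def sum.distrib sum_distrib_left mult.assoc)
qed

text \<open>The coordinatewise minimizers must come from actual matrices: the inverses
  \<open>S\<close> and \<open>R\<close> pull \<open>KX\<close> and \<open>KW\<close> back to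
  \<open>X\<close> and \<open>W\<close>. Hence the upper bound on parallel sums is attained by some
  splitting of \<open>Z\<close>.\<close>

lemma wform_par_split:
  assumes c: "U \<in> carrier_mat n n" "V \<in> carrier_mat n n" "Z \<in> carrier_mat n n"
    and inv: "S \<in> carrier_mat n n" "R \<in> carrier_mat n n" "S * U = 1\<^sub>m n" "U * S = 1\<^sub>m n"
      "R * V = 1\<^sub>m n" "V * R = 1\<^sub>m n"
    and a: "\<And>i j. a i j \<ge> 0" and b: "\<And>i j. b i j \<ge> 0" and t: "t \<ge> 0"
  obtains X W where "X \<in> carrier_mat n n" "W \<in> carrier_mat n n" "Z = X + W"
    "wform n U V a X + t * wform n U V b W = wform n U V (\<lambda>i j. par_sum (a i j) (t * b i j)) Z"
proof -
  define K where "K = mat_adjoint U * Z * V"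
  define KX where "KX = Matrix.mat n n (\<lambda>(i, j). of_real (par_split (a i j) (t * b i j)) * K $$ (i,
      j))"
  define KW where "KW = Matrix.mat n n (\<lambda>(i, j). of_real (1 - par_split (a i j) (t * b i j)) * K $$
      (i, j))"
  define X where "X = mat_adjoint S * KX * R"
  define W where "W = mat_adjoint S * KW * R"
  have Kc: "K \<in> carrier_mat n n" "KX \<in> carrier_mat n n" "KW \<in> carrier_mat n n"
    unfolding K_def KX_def KW_def using c by (auto simp: mult_carrier_mat[of _ n n _ n])
  have SU: "mat_adjoint U * mat_adjoint S = 1\<^sub>m n" "mat_adjoint S * mat_adjoint U = 1\<^sub>m n"
    using mat_adjoint_mult[OF inv(1) c(1), symmetric] mat_adjoint_mult[OF c(1) inv(1), symmetric]
    by (simp_all only: inv(3,4) mat_adjoint_one)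
  have KK: "mat_adjoint U * (mat_adjoint S * L * R) * V = L" if "L \<in> carrier_mat n n" for L
  proof -
    have "mat_adjoint U * (mat_adjoint S * L * R) * V = (mat_adjoint U * mat_adjoint S) * L * (R *
        V)"
      using c inv(1,2) that by (simp add: assoc_mult_mat[of _ n n _ n _ n] mult_carrier_mat[of _ n
        n _ n])
    thus ?thesis using SU inv that by simp
  qed
  have Xc: "X \<in> carrier_mat n n" "W \<in> carrier_mat n n"
    unfolding X_def W_def using inv Kc by (auto simp: mult_carrier_mat[of _ n n _ n])
  have "X + W = mat_adjoint S * (KX + KW) * R"
    unfolding X_def W_def using inv Kc
    by (simp add: mult_add_distrib_mat[of _ n n _ n] add_mult_distrib_mat[of _ n n _ _ n]
      mult_carrier_mat[of _ n n _ n])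
  also have "KX + KW = K"
    by (rule eq_matI) (use Kc in \<open>auto simp: KX_def KW_def algebra_simps\<close>)
  also have "mat_adjoint S * K * R = (mat_adjoint S * mat_adjoint U) * Z * (V * R)"
    unfolding K_def using c inv(1,2)
    by (simp add: assoc_mult_mat[of _ n n _ n _ n] mult_carrier_mat[of _ n n _ n])
  also have "\<dots> = Z" using SU inv c by simp
  finally have Z: "Z = X + W" by simp
  have "wform n U V a X + t * wform n U V b W
     = (\<Sum>i<n. \<Sum>j<n. a i j * (cmod (KX $$ (i, j)))\<^sup>2 + (t * b i j) * (cmod (KW $$ (i, j)))\<^sup>2)"
    unfolding wform_def X_def W_def KK[OF Kc(2)] KK[OF Kc(3)]
    by (simp add: sum.distrib sum_distrib_left mult.assoc)
  also have "\<dots> = (\<Sum>i<n. \<Sum>j<n. par_sum (a i j) (t * b i j) * (cmod (K $$ (i, j)))\<^sup>2)"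
  proof (intro sum.cong refl, goal_cases)
    case (1 i j)
    show ?case using 1 par_split_eq[OF a[of i j] mult_nonneg_nonneg[OF t b[of i j]], of
      "K $$ (i, j)"]
      by (simp add: KX_def KW_def)
  qed
  finally show ?thesis using that Xc Z unfolding wform_def K_def by blast
qed

text \<open>Index 0 is the mixture, 1 and 2 are the endpoints, and their coordinates are unrelated.
  For fixed \<open>x\<close> an optimal splitting of \<open>Z\<close> at index 0 turns the parallel
  sum there into a sum of two forms. The hypotheses compare these with the endpoints, where every
  splitting bounds the parallel sum from above. Integrating over \<open>x\<close> against exp
  ((\<theta> - 1) * x) replaces parallel sums by geometric means of the weights.\<close>

theorem wform_interpolation:
  fixes U V :: "nat \<Rightarrow> complex mat" and a b :: "nat \<Rightarrow> nat \<Rightarrow> nat \<Rightarrow> real"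
  assumes \<theta>: "0 < \<theta>" "\<theta> < 1" and st: "s \<ge> 0" "t \<ge> 0"
    and c: "\<And>k. U k \<in> carrier_mat n n" "\<And>k. V k \<in> carrier_mat n n"
    and Z: "Z \<in> carrier_mat n n"
    and inv: "S \<in> carrier_mat n n" "R \<in> carrier_mat n n" "S * U 0 = 1\<^sub>m n" "U 0 * S = 1\<^sub>m n"
      "R * V 0 = 1\<^sub>m n" "V 0 * R = 1\<^sub>m n"
    and a: "\<And>k i j. a k i j \<ge> 0" and b: "\<And>k i j. b k i j \<ge> 0"
    and dom_a: "\<And>X. X \<in> carrier_mat n n \<Longrightarrow>
      s * wform n (U 1) (V 1) (a 1) X + t * wform n (U 2) (V 2) (a 2) X \<le> wform n (U 0) (V 0) (a
        (0::nat)) X"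
    and dom_b: "\<And>X. X \<in> carrier_mat n n \<Longrightarrow>
      s * wform n (U 1) (V 1) (b 1) X + t * wform n (U 2) (V 2) (b 2) X \<le> wform n (U 0) (V 0) (b
        (0::nat)) X"
  defines "m \<equiv> \<lambda>k i j. a k i j powr \<theta> * b k i j powr (1 - \<theta>)"
  shows "s * wform n (U 1) (V 1) (m 1) Z + t * wform n (U 2) (V 2) (m 2) Z \<le> wform n (U 0) (V 0) (m
      0) Z"
proof -
  let ?par = "\<lambda>k x. wform n (U k) (V k) (\<lambda>i j. par_sum (a k i j) (exp x * b k i j)) Z"
  have int: "has_bochner_integral lborel (\<lambda>x. exp ((\<theta> - 1) * x) * ?par k x)
     (interp_const \<theta> * wform n (U k) (V k) (m k) Z)" for k
  proof -
    have "has_bochner_integral lborel (\<lambda>x. \<Sum>i<n. \<Sum>j<n. (exp ((\<theta> - 1) * x) * par_sum (a k i j) (exp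
        x * b k i j)) *
         (cmod ((mat_adjoint (U k) * Z * V k) $$ (i, j)))\<^sup>2)
      (\<Sum>i<n. \<Sum>j<n. (interp_const \<theta> * m k i j) * (cmod ((mat_adjoint (U k) * Z * V k) $$ (i, j)))\<^sup>2)"
      unfolding m_def
      by (intro has_bochner_integral_sum has_bochner_integral_mult_left
        has_bochner_integral_par_sum \<theta> a b)
    thus ?thesis by (simp only: wform_def sum_distrib_left mult.assoc)
  qed
  have "s * ?par 1 x + t * ?par 2 x \<le> ?par 0 x" for x
  proof -
    obtain X W where XW: "X \<in> carrier_mat n n" "W \<in> carrier_mat n n" "Z = X + W"
      "wform n (U 0) (V 0) (a 0) X + exp x * wform n (U 0) (V 0) (b 0) W = ?par 0 x"
      by (rule wform_par_split[OF c(1)[of 0] c(2)[of 0] Z inv a[of 0] b[of 0] exp_ge_zero[of x]])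
    have le: "?par k x \<le> wform n (U k) (V k) (a k) X + exp x * wform n (U k) (V k) (b k) W" for k
      unfolding XW(3) by (rule wform_par_sum_le) (use c XW a b in auto)
    have "s * ?par 1 x + t * ?par 2 x
       \<le> s * (wform n (U 1) (V 1) (a 1) X + exp x * wform n (U 1) (V 1) (b 1) W)
         + t * (wform n (U 2) (V 2) (a 2) X + exp x * wform n (U 2) (V 2) (b 2) W)"
      using st by (intro add_mono mult_left_mono le)
    also have "\<dots> = (s * wform n (U 1) (V 1) (a 1) X + t * wform n (U 2) (V 2) (a 2) X)
         + exp x * (s * wform n (U 1) (V 1) (b 1) W + t * wform n (U 2) (V 2) (b 2) W)"
      by (simp add: algebra_simps)
    also have "\<dots> \<le> ?par 0 x"
      unfolding XW(4)[symmetric] by (intro add_mono mult_left_mono dom_a dom_b XW) auto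
    finally show ?thesis .
  qed
  hence le: "exp ((\<theta> - 1) * x) * (s * ?par 1 x + t * ?par 2 x) \<le> exp ((\<theta> - 1) * x) * ?par 0 x" for x
    by (intro mult_left_mono) auto
  have "has_bochner_integral lborel (\<lambda>x. exp ((\<theta> - 1) * x) * (s * ?par 1 x + t * ?par 2 x))
     (interp_const \<theta> * (s * wform n (U 1) (V 1) (m 1) Z + t * wform n (U 2) (V 2) (m 2) Z))"
    using has_bochner_integral_add[OF has_bochner_integral_mult_right[OF int[of 1], of s]
      has_bochner_integral_mult_right[OF int[of 2], of t]]
    by (simp add: algebra_simps)
  hence "interp_const \<theta> * (s * wform n (U 1) (V 1) (m 1) Z + t * wform n (U 2) (V 2) (m 2) Z)
      \<le> interp_const \<theta> * wform n (U 0) (V 0) (m 0) Z"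
    by (rule has_bochner_integral_le[OF _ int[of 0] le])
  thus ?thesis using interp_const_pos[OF \<theta>] by simp
qed

section \<open>Lieb's concavity and geometric means of trace forms\<close>

definition pd_mats :: "nat \<Rightarrow> complex mat set" where
  "pd_mats n = {A. \<exists>U \<in> unitary_mats n. \<exists>a. A = cong_diag n U a \<and> (\<forall>i. a i > 0)}"

text \<open>The two weights are the eigenvalues of A (left multiplication) and of Y (right
  multiplication). Both forms are linear in the matrices, so the domination hypotheses hold with
  equality, while the interpolated weights d_i^\<theta> e_j^(1-\<theta>) belong to the powers of A
  and Y.\<close>

theorem lieb_concavity:
  assumes \<theta>: "0 < \<theta>" "\<theta> < 1" and st: "s \<ge> 0" "t \<ge> 0"
    and A: "A\<^sub>1 \<in> psd_mats n" "A\<^sub>2 \<in> psd_mats n" and Y: "Y\<^sub>1 \<in> psd_mats n" "Y\<^sub>2 \<in> psd_mats n"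
    and Z: "Z \<in> carrier_mat n n"
  shows "s * tform (mat_powr A\<^sub>1 \<theta>) Z (mat_powr Y\<^sub>1 (1 - \<theta>)) + t * tform (mat_powr A\<^sub>2 \<theta>) Z
      (mat_powr Y\<^sub>2 (1 - \<theta>))
    \<le> tform (mat_powr (complex_of_real s \<cdot>\<^sub>m A\<^sub>1 + complex_of_real t \<cdot>\<^sub>m A\<^sub>2) \<theta>) Z
        (mat_powr (complex_of_real s \<cdot>\<^sub>m Y\<^sub>1 + complex_of_real t \<cdot>\<^sub>m Y\<^sub>2) (1 - \<theta>))"
proof -
  define A where "A k = (if k = 0 then complex_of_real s \<cdot>\<^sub>m A\<^sub>1 + complex_of_real t \<cdot>\<^sub>m A\<^sub>2 else
      if k = 1 then A\<^sub>1 else A\<^sub>2)" for k :: nat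
  define Y where "Y k = (if k = 0 then complex_of_real s \<cdot>\<^sub>m Y\<^sub>1 + complex_of_real t \<cdot>\<^sub>m Y\<^sub>2 else
      if k = 1 then Y\<^sub>1 else Y\<^sub>2)" for k :: nat
  have "A k \<in> psd_mats n" "Y k \<in> psd_mats n" for k
    using assms psd_mats_lin unfolding A_def Y_def by auto
  hence "\<forall>k. \<exists>U d. U \<in> unitary_mats n \<and> A k = cong_diag n U d \<and> (\<forall>i. d i \<ge> 0)"
    "\<forall>k. \<exists>U d. U \<in> unitary_mats n \<and> Y k = cong_diag n U d \<and> (\<forall>i. d i \<ge> 0)"
    using psd_spectral by metis+
  then obtain U d V e where U: "\<And>k. U k \<in> unitary_mats n" "\<And>k. A k = cong_diag n (U k) (d k)"
    "\<And>k i. d k i \<ge> 0"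
    and V: "\<And>k. V k \<in> unitary_mats n" "\<And>k. Y k = cong_diag n (V k) (e k)" "\<And>k i. e k i \<ge> 0"
    by metis
  note Uc = unitary_matsD[OF U(1)] and Vc = unitary_matsD[OF V(1)]
  have AX: "wform n (U k) (V k) (\<lambda>i j. d k i) X = tform (A k) X (1\<^sub>m n)" if "X \<in> carrier_mat n n"
    for X k
    using wform_tform[OF Uc(1)[of k] Vc(1)[of k] that, of "d k" "\<lambda>_. 1"] U(2)[of k]
      cong_diag_one[OF V(1)[of k]] by simp
  have YX: "wform n (U k) (V k) (\<lambda>i j. e k j) X = tform (1\<^sub>m n) X (Y k)" if "X \<in> carrier_mat n n"
    for X k
    using wform_tform[OF Uc(1)[of k] Vc(1)[of k] that, of "\<lambda>_. 1" "e k"] V(2)[of k]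
      cong_diag_one[OF U(1)[of k]] by simp
  have R: "wform n (U k) (V k) (\<lambda>i j. d k i powr \<theta> * e k j powr (1 - \<theta>)) Z = tform (mat_powr (A k)
      \<theta>) Z (mat_powr (Y k) (1 - \<theta>))" for k
    unfolding U(2)[of k] V(2)[of k] using \<theta>
    by (simp add: mat_powr_cong_diag[OF U(1)] mat_powr_cong_diag[OF V(1)] wform_tform[OF Uc(1)
      Vc(1) Z])
  note Ac = psd_matsD(1)[OF assms(5)] psd_matsD(1)[OF assms(6)] psd_matsD(1)[OF assms(7)]
    psd_matsD(1)[OF assms(8)]
  have "s * wform n (U 1) (V 1) (\<lambda>i j. d 1 i powr \<theta> * e 1 j powr (1 - \<theta>)) Z + t * wform n (U 2) (V
      2) (\<lambda>i j. d 2 i powr \<theta> * e 2 j powr (1 - \<theta>)) Z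
      \<le> wform n (U 0) (V 0) (\<lambda>i j. d 0 i powr \<theta> * e 0 j powr (1 - \<theta>)) Z"
  proof (rule wform_interpolation[where U = U and V = V and n = n and a = "\<lambda>k i j. d k i" and b =
    "\<lambda>k i j. e k j", OF \<theta> st Uc(1) Vc(1) Z Uc(2)[of 0] Vc(2)[of 0] Uc(3)[of 0] Uc(4)[of 0] Vc(3)[of
    0] Vc(4)[of 0]])
    fix X :: "complex mat" assume X: "X \<in> carrier_mat n n"
    show "s * wform n (U 1) (V 1) (\<lambda>i j. d 1 i) X + t * wform n (U 2) (V 2) (\<lambda>i j. d 2 i) X \<le> wform
        n (U 0) (V 0) (\<lambda>i j. d 0 i) X"
      unfolding AX[OF X] A_def using tform_lin_left[OF Ac(1,2) X, of "1\<^sub>m n" s t] by simp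
    show "s * wform n (U 1) (V 1) (\<lambda>i j. e 1 j) X + t * wform n (U 2) (V 2) (\<lambda>i j. e 2 j) X \<le> wform
        n (U 0) (V 0) (\<lambda>i j. e 0 j) X"
      unfolding YX[OF X] Y_def using tform_lin_right[of "1\<^sub>m n" n, OF _ Ac(3) X Ac(4), of s t] by
        simp
  qed (use U V in auto)
  thus ?thesis unfolding R by (simp add: A_def Y_def)
qed

text \<open>In the coordinates \<open>T\<close>, \<open>V\<close> the forms of \<open>P\<close> and
  \<open>Q\<close> have weights e_j and w_i e_j. Their mean w_i^\<alpha> e_j is the form of the
  geometric mean with the same \<open>N\<close>. The hypotheses are themselves concavity
  inequalities, so \<open>N\<close> may vary together with \<open>P\<close> and \<open>Q\<close>;
  for \<open>p < 1\<close> they will come from Lieb's theorem.\<close>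

theorem tform_geo_mean_interpolation:
  fixes P Q N :: "nat \<Rightarrow> complex mat"
  assumes \<alpha>: "0 < \<alpha>" "\<alpha> < 1" and st: "s \<ge> 0" "t \<ge> 0"
    and P: "\<And>k. P k \<in> pd_mats n" and Q: "\<And>k. Q k \<in> psd_mats n" and N: "\<And>k. N k \<in> psd_mats n"
    and Z: "Z \<in> carrier_mat n n"
    and domP: "\<And>X. X \<in> carrier_mat n n \<Longrightarrow> s * tform (P 1) X (N 1) + t * tform (P 2) X (N 2) \<le> tform
        (P 0) X (N 0)"
    and domQ: "\<And>X. X \<in> carrier_mat n n \<Longrightarrow> s * tform (Q 1) X (N 1) + t * tform (Q 2) X (N 2) \<le> tform
        (Q 0) X (N 0)"
  shows "s * tform (geo_mean_supp \<alpha> (P 1) (Q 1)) Z (N 1) + t * tform (geo_mean_supp \<alpha> (P 2) (Q 2))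
      Z (N 2)
    \<le> tform (geo_mean_supp \<alpha> (P 0) (Q 0)) Z (N 0)"
proof -
  have "\<exists>T S w. T \<in> carrier_mat n n \<and> S \<in> carrier_mat n n \<and> T * S = 1\<^sub>m n \<and> S * T = 1\<^sub>m n \<and>
    (\<forall>i. w i \<ge> 0) \<and> P k = cong_diag n T (\<lambda>_. 1) \<and> Q k = cong_diag n T w \<and>
    geo_mean_supp \<alpha> (P k) (Q k) = cong_diag n T (\<lambda>i. w i powr \<alpha>)" for k
  proof -
    obtain U a where "U \<in> unitary_mats n" "P k = cong_diag n U a" "\<And>i. a i > 0"
      using P[of k] unfolding pd_mats_def by auto
    from geo_mean_supp_cong_diag[OF this Q \<alpha>(1)] show ?thesis by metis
  qed
  then obtain T S w where T: "\<And>k. T k \<in> carrier_mat n n" and S: "\<And>k. S k \<in> carrier_mat n n"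
    and TS: "\<And>k. T k * S k = 1\<^sub>m n" "\<And>k. S k * T k = 1\<^sub>m n" and w: "\<And>k i. w k i \<ge> 0"
    and PT: "\<And>k. P k = cong_diag n (T k) (\<lambda>_. 1)" and QT: "\<And>k. Q k = cong_diag n (T k) (w k)"
    and GT: "\<And>k. geo_mean_supp \<alpha> (P k) (Q k) = cong_diag n (T k) (\<lambda>i. w k i powr \<alpha>)"
    by metis
  have "\<forall>k. \<exists>U d. U \<in> unitary_mats n \<and> N k = cong_diag n U d \<and> (\<forall>i. d i \<ge> 0)"
    using psd_spectral N by metis
  then obtain V e where V: "\<And>k. V k \<in> unitary_mats n" "\<And>k. N k = cong_diag n (V k) (e k)"
    "\<And>k i. e k i \<ge> 0"
    by metis
  note Vc = unitary_matsD[OF V(1)]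
  have PX: "wform n (T k) (V k) (\<lambda>i j. e k j) X = tform (P k) X (N k)" if "X \<in> carrier_mat n n" for
    X k
    using wform_tform[OF T Vc(1) that, of k "\<lambda>_. 1" k "e k"] unfolding PT[of k] V(2)[of k] by simp
  have QX: "wform n (T k) (V k) (\<lambda>i j. w k i * e k j) X = tform (Q k) X (N k)" if
    "X \<in> carrier_mat n n" for X k
    using wform_tform[OF T Vc(1) that, of k "w k" k "e k"] unfolding QT[of k] V(2)[of k] by simp
  \<comment> \<open>Since \<open>0 powr r = 0\<close>, the exponents add up at zero eigenvalues as
    well.\<close>
  have ee: "e k j powr \<alpha> * e k j powr (1 - \<alpha>) = e k j" for k j
    using V(3)[of k j] by (simp flip: powr_add)
  have GX: "wform n (T k) (V k) (\<lambda>i j. (w k i * e k j) powr \<alpha> * e k j powr (1 - \<alpha>)) Z = tform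
      (geo_mean_supp \<alpha> (P k) (Q k)) Z (N k)" for k
    using wform_tform[OF T Vc(1) Z, of k "\<lambda>i. w k i powr \<alpha>" k "e k"] w V(3)
    unfolding GT[of k] V(2)[of k] by (simp add: powr_mult mult.assoc ee)
  have "s * wform n (T 1) (V 1) (\<lambda>i j. (w 1 i * e 1 j) powr \<alpha> * e 1 j powr (1 - \<alpha>)) Z
      + t * wform n (T 2) (V 2) (\<lambda>i j. (w 2 i * e 2 j) powr \<alpha> * e 2 j powr (1 - \<alpha>)) Z
      \<le> wform n (T 0) (V 0) (\<lambda>i j. (w 0 i * e 0 j) powr \<alpha> * e 0 j powr (1 - \<alpha>)) Z"
  proof (rule wform_interpolation[where U = T and V = V and n = n and a = "\<lambda>k i j. w k i * e k j"
    and b = "\<lambda>k i j. e k j", OF \<alpha> st T Vc(1) Z S[of 0] Vc(2)[of 0] TS(2)[of 0] TS(1)[of 0] Vc(3)[of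
    0] Vc(4)[of 0]])
    fix X :: "complex mat" assume X: "X \<in> carrier_mat n n"
    show "s * wform n (T 1) (V 1) (\<lambda>i j. w 1 i * e 1 j) X + t * wform n (T 2) (V 2) (\<lambda>i j. w 2 i *
        e 2 j) X
      \<le> wform n (T 0) (V 0) (\<lambda>i j. w 0 i * e 0 j) X"
      unfolding QX[OF X] by (rule domQ[OF X])
    show "s * wform n (T 1) (V 1) (\<lambda>i j. e 1 j) X + t * wform n (T 2) (V 2) (\<lambda>i j. e 2 j) X
      \<le> wform n (T 0) (V 0) (\<lambda>i j. e 0 j) X"
      unfolding PX[OF X] by (rule domP[OF X])
  qed (use w V in auto)
  thus ?thesis unfolding GX .
qed

section \<open>Joint concavity for \<open>\<alpha> < 1\<close> and \<open>p \<le> 1\<close>\<close>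

lemma tendsto_at_right_mono_bounded:
  fixes f :: "real \<Rightarrow> real"
  assumes mono: "\<And>x y. 0 < x \<Longrightarrow> x \<le> y \<Longrightarrow> f x \<le> f y" and bd: "\<And>x. 0 < x \<Longrightarrow> L \<le> f x"
  obtains l where "(f \<longlongrightarrow> l) (at_right 0)"
proof
  have bdd: "bdd_below (f ` {0<..})" using bd by (auto intro!: bdd_belowI[of _ L])
  show "(f \<longlongrightarrow> Inf (f ` {0<..})) (at_right 0)"
  proof (rule order_tendstoI)
    fix a assume a: "a < Inf (f ` {0<..})"
    have "a < f x" if "x > 0" for x
      using cINF_lower[OF bdd, of x] that a by auto
    thus "\<forall>\<^sub>F x in at_right 0. a < f x"
      by (auto simp: eventually_at_filter)
  next
    fix a assume "Inf (f ` {0<..}) < a"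
    then obtain x0 where x0: "x0 > 0" "f x0 < a"
      using cInf_less_iff[OF _ bdd, of a] by auto
    have "\<forall>\<^sub>F x in at_right 0. x \<in> {0<..<x0}" using x0(1) by (rule eventually_at_right_real)
    thus "\<forall>\<^sub>F x in at_right 0. f x < a"
    proof eventually_elim
      case (elim x)
      thus ?case using mono[of x x0] x0(2) by auto
    qed
  qed
qed

lemma one_eq_cong_diag: "1\<^sub>m n = cong_diag n (1\<^sub>m n) (\<lambda>_. 1)"
  by (rule cong_diag_one[symmetric]) (auto simp: unitary_mats_def)

lemma one_unitary: "1\<^sub>m n \<in> unitary_mats n"
  by (auto simp: unitary_mats_def)

lemma one_psd: "1\<^sub>m n \<in> psd_mats n"
  by (subst one_eq_cong_diag) (rule psd_cong_diag; simp)

lemma tform_nonneg: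
  assumes "A \<in> psd_mats n" "Y \<in> psd_mats n" "Z \<in> carrier_mat n n"
  shows "tform A Z Y \<ge> 0"
proof -
  from psd_spectral[OF assms(1)] obtain U d where U: "U \<in> unitary_mats n" "A = cong_diag n U d"
    "\<And>i. d i \<ge> 0" by metis
  from psd_spectral[OF assms(2)] obtain V e where V: "V \<in> unitary_mats n" "Y = cong_diag n V e"
    "\<And>i. e i \<ge> 0" by metis
  show ?thesis unfolding U(2) V(2) tform_cong_diag[OF unitary_matsD(1)[OF U(1)] unitary_matsD(1)[OF
    V(1)] assms(3)]
    using U(3) V(3) by (intro sum_nonneg mult_nonneg_nonneg) auto
qed

lemma smult_one_mat: "(1 :: complex) \<cdot>\<^sub>m A = A"
  by (rule eq_matI) auto

lemma tform_plus_eps: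
  assumes "A \<in> carrier_mat n n" "Z \<in> carrier_mat n n" "Y \<in> carrier_mat n n"
  shows "tform (A + complex_of_real \<epsilon> \<cdot>\<^sub>m 1\<^sub>m n) Z Y = tform A Z Y + \<epsilon> * tform (1\<^sub>m n) Z Y"
  using tform_lin_left[OF assms(1) one_carrier_mat assms(2,3), of 1 \<epsilon>] by (simp add: smult_one_mat)

lemma pd_plus_eps:
  "P \<in> psd_mats n \<Longrightarrow> \<epsilon> > 0 \<Longrightarrow> P + complex_of_real \<epsilon> \<cdot>\<^sub>m 1\<^sub>m n \<in> pd_mats n"
  using psd_plus_eps[of P n \<epsilon>] unfolding pd_mats_def by blast

lemma pd_mats_imp_psd: "P \<in> pd_mats n \<Longrightarrow> P \<in> psd_mats n"
  unfolding pd_mats_def by (auto intro!: psd_cong_diag dest: unitary_matsD(1) simp: less_imp_le)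

lemma psd_plus_eps_psd:
  "P \<in> psd_mats n \<Longrightarrow> \<epsilon> > 0 \<Longrightarrow> P + complex_of_real \<epsilon> \<cdot>\<^sub>m 1\<^sub>m n \<in> psd_mats n"
  by (rule pd_mats_imp_psd[OF pd_plus_eps])

lemma geo_mean_supp_psd:
  assumes "P \<in> pd_mats n" "Q \<in> psd_mats n" "\<alpha> > 0"
  shows "geo_mean_supp \<alpha> P Q \<in> psd_mats n"
proof -
  obtain U a where U: "U \<in> unitary_mats n" "P = cong_diag n U a" "\<And>i. a i > 0"
    using assms(1) unfolding pd_mats_def by auto
  from geo_mean_supp_cong_diag[OF U assms(2,3)] obtain T w where
    "T \<in> carrier_mat n n" "geo_mean_supp \<alpha> P Q = cong_diag n T (\<lambda>i. w i powr \<alpha>)" by metis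
  thus ?thesis by (simp add: psd_cong_diag)
qed

definition geo_mean_eps :: "real \<Rightarrow> nat \<Rightarrow> complex mat \<Rightarrow> complex mat \<Rightarrow> real \<Rightarrow> complex mat" where
  "geo_mean_eps \<alpha> n P Q \<epsilon> =
     geo_mean_supp \<alpha> (P + complex_of_real \<epsilon> \<cdot>\<^sub>m 1\<^sub>m n) (Q + complex_of_real \<epsilon> \<cdot>\<^sub>m 1\<^sub>m n)"

lemma geo_mean_eps_psd:
  "P \<in> psd_mats n \<Longrightarrow> Q \<in> psd_mats n \<Longrightarrow> \<alpha> > 0 \<Longrightarrow> \<epsilon> > 0 \<Longrightarrow> geo_mean_eps \<alpha> n P Q \<epsilon> \<in> psd_mats n"
  unfolding geo_mean_eps_def by (intro geo_mean_supp_psd pd_plus_eps psd_plus_eps_psd)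

text \<open>A degenerate use of interpolation: with coefficients 1 and 0 it becomes monotonicity of
  the mean in its arguments. Index 0 carries the larger shift \<delta>, the other indices carry
  \<epsilon>.\<close>

lemma geo_mean_eps_mono:
  assumes \<alpha>: "0 < \<alpha>" "\<alpha> < 1" and n: "n > 0" and PQ: "P \<in> psd_mats n" "Q \<in> psd_mats n"
    and \<epsilon>: "0 < \<epsilon>" "\<epsilon> \<le> \<delta>"
  shows "Re (sform n (geo_mean_eps \<alpha> n P Q \<epsilon>) v) \<le> Re (sform n (geo_mean_eps \<alpha> n P Q \<delta>) v)"
proof -
  define f where "f k = (if k = 0 then \<delta> else \<epsilon>)" for k :: nat
  have f: "f k > 0" for k using \<epsilon> by (simp add: f_def)
  have dom: "1 * tform (A + complex_of_real (f 1) \<cdot>\<^sub>m 1\<^sub>m n) X (1\<^sub>m n) + 0 * tform (A +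
      complex_of_real (f 2) \<cdot>\<^sub>m 1\<^sub>m n) X (1\<^sub>m n)
      \<le> tform (A + complex_of_real (f 0) \<cdot>\<^sub>m 1\<^sub>m n) X (1\<^sub>m n)" if "A \<in> psd_mats n" "X \<in> carrier_mat
        n n" for A X
    using psd_matsD(1)[OF that(1)] that(2) \<epsilon> mult_right_mono[OF \<epsilon>(2) tform_nonneg[OF one_psd
      one_psd that(2)]]
    by (simp add: tform_plus_eps f_def)
  have "1 * tform (geo_mean_eps \<alpha> n P Q (f 1)) (single_col n v) (1\<^sub>m n) + 0 * tform (geo_mean_eps \<alpha>
      n P Q (f 2)) (single_col n v) (1\<^sub>m n)
     \<le> tform (geo_mean_eps \<alpha> n P Q (f 0)) (single_col n v) (1\<^sub>m n)"
    unfolding geo_mean_eps_def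
    by (rule tform_geo_mean_interpolation[OF \<alpha>])
       (use dom[OF PQ(1)] dom[OF PQ(2)] PQ f in \<open>auto intro: pd_plus_eps one_psd psd_plus_eps_psd\<close>)
  moreover have c: "geo_mean_eps \<alpha> n P Q (f k) \<in> carrier_mat n n" for k
    using geo_mean_eps_psd[OF PQ \<alpha>(1) f] psd_matsD(1) by blast
  ultimately show ?thesis by (simp only: tform_single_col[OF c n]) (simp add: f_def)
qed

text \<open>Each quadratic form decreases with \<epsilon> and is nonnegative, hence converges, and
  polarization passes this on to the entries. Thus the value selected by \<open>Lim\<close> in the
  definition is a genuine limit.\<close>

lemma geo_mean_tendsto:
  assumes \<alpha>: "0 < \<alpha>" "\<alpha> < 1" and n: "n > 0" and PQ: "P \<in> psd_mats n" "Q \<in> psd_mats n"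
  shows "i < n \<Longrightarrow> j < n \<Longrightarrow>
      ((\<lambda>\<epsilon>. geo_mean_eps \<alpha> n P Q \<epsilon> $$ (i, j)) \<longlongrightarrow> geo_mean \<alpha> P Q $$ (i, j)) (at_right 0)"
    and "geo_mean \<alpha> P Q \<in> psd_mats n"
proof -
  let ?M = "geo_mean_eps \<alpha> n P Q"
  have nn: "0 \<le> sform n (?M \<epsilon>) v" if "\<epsilon> > 0" for \<epsilon> v
    using psd_matsD(2)[OF geo_mean_eps_psd[OF PQ \<alpha>(1) that]] .
  have ev: "\<forall>\<^sub>F \<epsilon> in at_right 0. 0 \<le> sform n (?M \<epsilon>) v" for v
    using nn by (auto simp: eventually_at_filter)
  have "\<exists>l. ((\<lambda>\<epsilon>. sform n (?M \<epsilon>) v) \<longlongrightarrow> l) (at_right 0)" for v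
  proof -
    obtain l where "((\<lambda>\<epsilon>. Re (sform n (?M \<epsilon>) v)) \<longlongrightarrow> l) (at_right 0)"
      by (rule tendsto_at_right_mono_bounded[of "\<lambda>\<epsilon>. Re (sform n (?M \<epsilon>) v)" 0])
         (use geo_mean_eps_mono[OF \<alpha> n PQ] nn in \<open>auto simp: less_eq_complex_def\<close>)
    hence "((\<lambda>\<epsilon>. complex_of_real (Re (sform n (?M \<epsilon>) v))) \<longlongrightarrow> of_real l) (at_right 0)"
      by (rule tendsto_of_real)
    moreover have "\<forall>\<^sub>F \<epsilon> in at_right 0. complex_of_real (Re (sform n (?M \<epsilon>) v)) = sform n (?M \<epsilon>) v"
      using ev[of v] by eventually_elim (auto simp: less_eq_complex_def complex_eq_iff)
    ultimately have "((\<lambda>\<epsilon>. sform n (?M \<epsilon>) v) \<longlongrightarrow> of_real l) (at_right 0)"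
      by (rule Lim_transform_eventually)
    thus ?thesis by blast
  qed
  then obtain l where l: "((\<lambda>\<epsilon>. sform n (?M \<epsilon>) v) \<longlongrightarrow> l v) (at_right 0)" for v by metis
  have lim: "((\<lambda>\<epsilon>. ?M \<epsilon> $$ (i, j)) \<longlongrightarrow> geo_mean \<alpha> P Q $$ (i, j)) (at_right 0)" if "i < n" "j < n" for
    i j
  proof -
    have "\<exists>m. ((\<lambda>\<epsilon>. ?M \<epsilon> $$ (i, j)) \<longlongrightarrow> m) (at_right 0)"
    proof
      show "((\<lambda>\<epsilon>. ?M \<epsilon> $$ (i, j)) \<longlongrightarrow> (l (pair_vec i j 1) - l (pair_vec i j 0) - l (pair_vec j i 0)
          - \<i> * (l (pair_vec i j \<i>) - l (pair_vec i j 0) - l (pair_vec j i 0))) / 2) (at_right 0)"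
        unfolding polarization[OF that] by (intro tendsto_intros l) simp
    qed
    then obtain m where m: "((\<lambda>\<epsilon>. ?M \<epsilon> $$ (i, j)) \<longlongrightarrow> m) (at_right 0)" by blast
    have "geo_mean \<alpha> P Q $$ (i, j) = Lim (at_right 0) (\<lambda>\<epsilon>. ?M \<epsilon> $$ (i, j))"
      using \<alpha> psd_matsD(1)[OF PQ(1)] that
      by (simp add: geo_mean_def mat_lim_def geo_mean_eps_def Let_def)
    also have "\<dots> = m" by (rule tendsto_Lim[OF _ m]) simp
    finally show ?thesis using m by simp
  qed
  thus "i < n \<Longrightarrow> j < n \<Longrightarrow> ((\<lambda>\<epsilon>. ?M \<epsilon> $$ (i, j)) \<longlongrightarrow> geo_mean \<alpha> P Q $$ (i, j)) (at_right 0)" .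
  have slim: "((\<lambda>\<epsilon>. sform n (?M \<epsilon>) v) \<longlongrightarrow> sform n (geo_mean \<alpha> P Q) v) (at_right 0)" for v
    unfolding sform_def by (intro tendsto_intros lim) auto
  have "0 \<le> sform n (geo_mean \<alpha> P Q) v" for v
  proof -
    have "0 \<le> Re (sform n (geo_mean \<alpha> P Q) v)"
      by (rule tendsto_lowerbound[OF tendsto_Re[OF slim]])
         (use ev[of v] in \<open>auto simp: less_eq_complex_def elim: eventually_mono\<close>)
    moreover have "Im (sform n (geo_mean \<alpha> P Q) v) = 0"
    proof (rule tendsto_unique[OF _ tendsto_Im[OF slim[of v]]])
      show "((\<lambda>\<epsilon>. Im (sform n (?M \<epsilon>) v)) \<longlongrightarrow> 0) (at_right 0)"
        by (rule tendsto_eventually) (use ev[of v] in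
          \<open>auto simp: less_eq_complex_def elim: eventually_mono\<close>)
    qed simp
    ultimately show ?thesis by (simp add: less_eq_complex_def)
  qed
  moreover have "geo_mean \<alpha> P Q \<in> carrier_mat n n"
    using \<alpha> psd_matsD(1)[OF PQ(1)] by (simp add: geo_mean_def mat_lim_def Let_def)
  ultimately show "geo_mean \<alpha> P Q \<in> psd_mats n" by (simp add: psd_mats_iff)
qed

lemma tform_id:
  assumes "A \<in> carrier_mat n n" "N \<in> carrier_mat n n"
  shows "tform A (1\<^sub>m n) N = Re (\<Sum>i<n. \<Sum>j<n. A $$ (i, j) * N $$ (j, i))"
proof -
  have "tform A (1\<^sub>m n) N = Re (mat_trace (A * N))" using assms by (simp add: tform_def)
  also have "mat_trace (A * N) = (\<Sum>i<n. \<Sum>j<n. A $$ (i, j) * N $$ (j, i))"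
    unfolding mat_trace_def using assms by (intro sum.cong refl index_mult_mat_sum[of _ n n _ n])
      auto
  finally show ?thesis .
qed

text \<open>The hypothesis \<open>domN\<close> accounts for the regularization: shifting
  \<open>P\<close> and \<open>Q\<close> by \<epsilon> adds \<epsilon> times the form of the
  identity, so that form must satisfy the same inequality before \<epsilon> tends to 0.\<close>

lemma tform_geo_mean_concave:
  fixes P Q N :: "nat \<Rightarrow> complex mat"
  assumes \<alpha>: "0 < \<alpha>" "\<alpha> < 1" and st: "s \<ge> 0" "t \<ge> 0" and n: "n > 0"
    and P: "\<And>k. P k \<in> psd_mats n" and Q: "\<And>k. Q k \<in> psd_mats n" and N: "\<And>k. N k \<in> psd_mats n"
    and domP: "\<And>X. X \<in> carrier_mat n n \<Longrightarrow> s * tform (P 1) X (N 1) + t * tform (P 2) X (N 2) \<le> tform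
        (P 0) X (N 0)"
    and domQ: "\<And>X. X \<in> carrier_mat n n \<Longrightarrow> s * tform (Q 1) X (N 1) + t * tform (Q 2) X (N 2) \<le> tform
        (Q 0) X (N 0)"
    and domN: "\<And>X. X \<in> carrier_mat n n \<Longrightarrow> s * tform (1\<^sub>m n) X (N 1) + t * tform (1\<^sub>m n) X (N 2) \<le>
        tform (1\<^sub>m n) X (N 0)"
  shows "s * tform (geo_mean \<alpha> (P 1) (Q 1)) (1\<^sub>m n) (N 1) + t * tform (geo_mean \<alpha> (P 2) (Q 2)) (1\<^sub>m
      n) (N 2)
    \<le> tform (geo_mean \<alpha> (P 0) (Q 0)) (1\<^sub>m n) (N 0)"
proof -
  let ?M = "\<lambda>k. geo_mean_eps \<alpha> n (P k) (Q k)"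
  note Pc = psd_matsD(1)[OF P] and Qc = psd_matsD(1)[OF Q] and Nc = psd_matsD(1)[OF N]
  have lim: "((\<lambda>\<epsilon>. tform (?M k \<epsilon>) (1\<^sub>m n) (N k)) \<longlongrightarrow> tform (geo_mean \<alpha> (P k) (Q k)) (1\<^sub>m n) (N k))
      (at_right 0)" for k
  proof (rule Lim_transform_eventually)
    show "((\<lambda>\<epsilon>. Re (\<Sum>i<n. \<Sum>j<n. ?M k \<epsilon> $$ (i, j) * N k $$ (j, i))) \<longlongrightarrow> tform (geo_mean \<alpha> (P k) (Q k))
        (1\<^sub>m n) (N k)) (at_right 0)"
      unfolding tform_id[OF psd_matsD(1)[OF geo_mean_tendsto(2)[OF \<alpha> n P Q]] Nc]
      by (intro tendsto_intros geo_mean_tendsto(1)[OF \<alpha> n P Q]) auto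
    have "Re (\<Sum>i<n. \<Sum>j<n. ?M k \<epsilon> $$ (i, j) * N k $$ (j, i)) = tform (?M k \<epsilon>) (1\<^sub>m n) (N k)" if
      "\<epsilon> > 0" for \<epsilon>
      by (rule tform_id[OF psd_matsD(1)[OF geo_mean_eps_psd[OF P Q \<alpha>(1) that]] Nc, symmetric])
    thus "\<forall>\<^sub>F \<epsilon> in at_right 0. Re (\<Sum>i<n. \<Sum>j<n. ?M k \<epsilon> $$ (i, j) * N k $$ (j, i)) = tform (?M k \<epsilon>)
        (1\<^sub>m n) (N k)"
      by (auto simp: eventually_at_filter)
  qed
  have "s * tform (?M 1 \<epsilon>) (1\<^sub>m n) (N 1) + t * tform (?M 2 \<epsilon>) (1\<^sub>m n) (N 2) \<le> tform (?M 0 \<epsilon>) (1\<^sub>m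
      n) (N 0)" if \<epsilon>: "\<epsilon> > 0" for \<epsilon>
  proof -
    have dom: "s * tform (A 1 + complex_of_real \<epsilon> \<cdot>\<^sub>m 1\<^sub>m n) X (N 1) + t * tform (A 2 +
        complex_of_real \<epsilon> \<cdot>\<^sub>m 1\<^sub>m n) X (N 2)
        \<le> tform (A 0 + complex_of_real \<epsilon> \<cdot>\<^sub>m 1\<^sub>m n) X (N 0)"
      if "s * tform (A 1) X (N 1) + t * tform (A 2) X (N 2) \<le> tform (A 0) X (N 0)"
        "\<And>k. A k \<in> carrier_mat n n" "X \<in> carrier_mat n n" for A :: "nat \<Rightarrow> complex mat" and X
      using that(1) mult_left_mono[OF domN[OF that(3)], of \<epsilon>] \<epsilon>
      unfolding tform_plus_eps[OF that(2,3) Nc] by (simp add: algebra_simps)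
    show ?thesis unfolding geo_mean_eps_def
      by (rule tform_geo_mean_interpolation[OF \<alpha> st pd_plus_eps[OF P \<epsilon>] psd_plus_eps_psd[OF Q \<epsilon>] N
        one_carrier_mat
        dom[OF domP Pc] dom[OF domQ Qc]])
  qed
  hence "\<forall>\<^sub>F \<epsilon> in at_right 0. s * tform (?M 1 \<epsilon>) (1\<^sub>m n) (N 1) + t * tform (?M 2 \<epsilon>) (1\<^sub>m n) (N 2) \<le>
      tform (?M 0 \<epsilon>) (1\<^sub>m n) (N 0)"
    by (auto simp: eventually_at_filter)
  thus ?thesis
    by (rule tendsto_le[OF _ lim, rotated 2]) (auto intro!: tendsto_intros lim)
qed

section \<open>Young's inequality for traces\<close>

lemma unitary_row_sum:
  assumes U: "U \<in> unitary_mats n" and i: "i < n"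
  shows "(\<Sum>j<n. (cmod (U $$ (i, j)))\<^sup>2) = 1"
proof -
  note Uc = unitary_matsD[OF U]
  have "of_real (\<Sum>j<n. (cmod (U $$ (i, j)))\<^sup>2) = (\<Sum>j<n. U $$ (i, j) * mat_adjoint U $$ (j, i))"
    using Uc(1) i by (simp only: of_real_sum complex_norm_square) (intro sum.cong, auto)
  also have "\<dots> = (U * mat_adjoint U) $$ (i, i)"
    by (rule index_mult_mat_sum[OF Uc(1,2) i i, symmetric])
  also have "\<dots> = of_real 1" unfolding Uc(4) using i by simp
  finally show ?thesis by (simp only: of_real_eq_iff)
qed

lemma unitary_col_sum:
  assumes U: "U \<in> unitary_mats n" and j: "j < n"
  shows "(\<Sum>i<n. (cmod (U $$ (i, j)))\<^sup>2) = 1"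
  using unitary_row_sum[OF unitary_mats_adjoint[OF U] j] unitary_matsD(1)[OF U] j by simp

lemma tform_cong_diag_id:
  assumes "U \<in> carrier_mat n n" "V \<in> carrier_mat n n"
  shows "tform (cong_diag n U d) (1\<^sub>m n) (cong_diag n V e)
    = (\<Sum>i<n. \<Sum>j<n. d i * e j * (cmod ((mat_adjoint U * V) $$ (i, j)))\<^sup>2)"
  using tform_cong_diag[OF assms one_carrier_mat] assms
    right_mult_one_mat[OF mat_adjoint_carrier[OF assms(1)]] by simp

lemma tform_cong_diag_same:
  assumes U: "U \<in> unitary_mats n"
  shows "tform (cong_diag n U d) (1\<^sub>m n) (cong_diag n U e) = (\<Sum>i<n. d i * e i)"
proof -
  note Uc = unitary_matsD[OF U]
  have "tform (cong_diag n U d) (1\<^sub>m n) (cong_diag n U e) = (\<Sum>i<n. \<Sum>j<n. if i = j then d i * e i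
      else 0)"
    unfolding tform_cong_diag_id[OF Uc(1) Uc(1)] Uc(3) by (intro sum.cong refl) auto
  thus ?thesis by simp
qed

lemma mat_trace_cong_diag:
  assumes U: "U \<in> unitary_mats n"
  shows "Re (mat_trace (cong_diag n U d)) = (\<Sum>i<n. d i)"
  using tform_cong_diag_same[OF U, of d "\<lambda>_. 1"] tform_one[OF cong_diag_carrier[OF
    unitary_matsD(1)[OF U]], of d]
    cong_diag_one[OF U] by simp

lemma mat_powr_psd: "A \<in> psd_mats n \<Longrightarrow> r \<ge> 0 \<Longrightarrow> mat_powr A r \<in> psd_mats n"
  using psd_spectral[of A n] by (metis mat_powr_cong_diag powr_ge_zero psd_cong_diag
    unitary_matsD(1))

lemma mat_powr_one_psd: "A \<in> psd_mats n \<Longrightarrow> mat_powr A 1 = A"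
proof -
  assume "A \<in> psd_mats n"
  then obtain U d where U: "U \<in> unitary_mats n" "A = cong_diag n U d" "\<And>i. d i \<ge> 0" using
    psd_spectral by metis
  thus ?thesis by (simp add: mat_powr_cong_diag)
qed

lemma mat_powr_of_one: "r \<ge> 0 \<Longrightarrow> mat_powr (1\<^sub>m n) r = 1\<^sub>m n"
  by (subst one_eq_cong_diag, subst mat_powr_cong_diag[OF one_unitary]) (simp_all flip:
    one_eq_cong_diag)

text \<open>
  With \<open>Y = M\<^bsup>1/p\<^esup>\<close> there is equality, so \<open>Tr M\<^bsup>1/p\<^esup>\<close> is a supremum of expressions that are
  linear in \<open>M\<close>.
\<close>

lemma trace_young:
  assumes M: "M \<in> psd_mats n" and Y: "Y \<in> psd_mats n" and p: "0 < p" "p < 1"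
  shows "tform M (1\<^sub>m n) (mat_powr Y (1 - p)) \<le> p * Re (mat_trace (mat_powr M (1 / p))) + (1 - p) *
      Re (mat_trace Y)"
proof -
  from psd_spectral[OF M] obtain U d where U: "U \<in> unitary_mats n" "M = cong_diag n U d"
    "\<And>i. d i \<ge> 0" by metis
  from psd_spectral[OF Y] obtain V e where V: "V \<in> unitary_mats n" "Y = cong_diag n V e"
    "\<And>i. e i \<ge> 0" by metis
  \<comment> \<open>The squared moduli of the entries of a unitary matrix form a doubly stochastic
    matrix, so the scalar Young inequality can be averaged with them.\<close>
  define K where "K = mat_adjoint U * V"
  have K: "K \<in> unitary_mats n" unfolding K_def by (intro unitary_mats_mult unitary_mats_adjoint U V)
  have young: "d i * e j powr (1 - p) \<le> p * d i powr (1 / p) + (1 - p) * e j" for i j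
  proof (cases "d i = 0 \<or> e j = 0")
    case True
    thus ?thesis using U(3) V(3) p by auto
  next
    case False
    hence "d i > 0" "e j > 0" using U(3)[of i] V(3)[of j] by auto
    thus ?thesis using Youngs_inequality_0[of p "1 - p" "d i powr (1 / p)" "e j"] p by (simp add:
      powr_powr)
  qed
  have "tform M (1\<^sub>m n) (mat_powr Y (1 - p)) = (\<Sum>i<n. \<Sum>j<n. d i * e j powr (1 - p) * (cmod (K $$
      (i, j)))\<^sup>2)"
    unfolding U(2) V(2) K_def using p
    by (simp add: mat_powr_cong_diag[OF V(1)] tform_cong_diag_id unitary_matsD(1)[OF U(1)]
      unitary_matsD(1)[OF V(1)])
  also have "\<dots> \<le> (\<Sum>i<n. \<Sum>j<n. (p * d i powr (1 / p) + (1 - p) * e j) * (cmod (K $$ (i, j)))\<^sup>2)"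
    by (intro sum_mono mult_right_mono young) auto
  also have "\<dots> = (\<Sum>i<n. \<Sum>j<n. p * d i powr (1 / p) * (cmod (K $$ (i, j)))\<^sup>2) + (\<Sum>i<n. \<Sum>j<n. (1 - p)
      * e j * (cmod (K $$ (i, j)))\<^sup>2)"
    by (simp only: distrib_right sum.distrib)
  also have "(\<Sum>i<n. \<Sum>j<n. p * d i powr (1 / p) * (cmod (K $$ (i, j)))\<^sup>2) = p * (\<Sum>i<n. d i powr (1 /
      p))"
    unfolding sum_distrib_left
    by (intro sum.cong refl) (simp add: unitary_row_sum[OF K] flip: sum_distrib_left)
  also have "(\<Sum>i<n. \<Sum>j<n. (1 - p) * e j * (cmod (K $$ (i, j)))\<^sup>2) = (1 - p) * (\<Sum>j<n. e j)"
    unfolding sum_distrib_left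
    by (subst sum.swap, intro sum.cong refl) (simp add: unitary_col_sum[OF K] flip:
      sum_distrib_left)
  finally show ?thesis
    unfolding U(2) V(2) using p
    by (simp add: mat_powr_cong_diag[OF U(1)] mat_trace_cong_diag[OF U(1)] mat_trace_cong_diag[OF
      V(1)])
qed

lemma trace_young_eq:
  assumes M: "M \<in> psd_mats n" and p: "0 < p" "p < 1"
  shows "tform M (1\<^sub>m n) (mat_powr (mat_powr M (1 / p)) (1 - p)) = Re (mat_trace (mat_powr M (1 /
      p)))"
proof -
  from psd_spectral[OF M] obtain U d where U: "U \<in> unitary_mats n" "M = cong_diag n U d"
    "\<And>i. d i \<ge> 0" by metis
  have "d i * d i powr ((1 - p) / p) = d i powr (1 / p)" for i
  proof (cases "d i = 0")
    case False
    hence "d i > 0" using U(3)[of i] by simp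
    hence "d i * d i powr ((1 - p) / p) = d i powr (1 + (1 - p) / p)" by (simp add: powr_add)
    also have "1 + (1 - p) / p = 1 / p" using p by (simp add: field_simps)
    finally show ?thesis .
  qed simp
  thus ?thesis unfolding U(2) using p
    by (simp add: mat_powr_cong_diag[OF U(1)] tform_cong_diag_same[OF U(1)] mat_trace_cong_diag[OF
      U(1)] powr_powr)
qed

theorem Tr_G_concave:
  assumes \<alpha>: "0 < \<alpha>" "\<alpha> < 1" and p: "0 < p" "p \<le> 1"
  shows "Tr_G_jointly_concave \<alpha> p"
  unfolding Tr_G_jointly_concave_def jointly_concave_on_def
proof (intro allI impI ballI, clarify)
  fix n :: nat and A1 B1 A2 B2 :: "complex mat" and t :: real
  assume "n \<ge> 1" and D: "(A1, B1) \<in> G_dom \<alpha> n" "(A2, B2) \<in> G_dom \<alpha> n" and t: "t \<in> {0..1}"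
  hence n: "n > 0" and A: "A1 \<in> psd_mats n" "A2 \<in> psd_mats n" and B: "B1 \<in> psd_mats n"
    "B2 \<in> psd_mats n"
    using \<alpha> by (auto simp: G_dom_def)
  have st: "1 - t \<ge> 0" "t \<ge> 0" using t by auto
  define mix where "mix X Y = complex_of_real (1 - t) \<cdot>\<^sub>m X + complex_of_real t \<cdot>\<^sub>m Y" for X Y ::
    "complex mat"
  define P where "P k = (if k = 0 then mat_powr (mix A1 A2) p else if k = 1 then mat_powr A1 p else
      mat_powr A2 p)" for k :: nat
  define Q where "Q k = (if k = 0 then mat_powr (mix B1 B2) p else if k = 1 then mat_powr B1 p else
      mat_powr B2 p)" for k :: nat
  have mix: "mix X Y \<in> psd_mats n" if "X \<in> psd_mats n" "Y \<in> psd_mats n" for X Y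
    unfolding mix_def by (rule psd_mats_lin[OF that st])
  have P: "P k \<in> psd_mats n" and Q: "Q k \<in> psd_mats n" for k
    using A B p by (auto simp: P_def Q_def intro!: mix mat_powr_psd)
  define M where "M k = geo_mean \<alpha> (P k) (Q k)" for k
  have M: "M k \<in> psd_mats n" for k
    unfolding M_def by (rule geo_mean_tendsto(2)[OF \<alpha> n P Q])
  have "(1 - t) * Re (mat_trace (mat_powr (M 1) (1 / p))) + t * Re (mat_trace (mat_powr (M 2) (1 /
      p)))
     \<le> Re (mat_trace (mat_powr (M 0) (1 / p)))"
  proof (cases "p = 1")
    \<comment> \<open>Here Y^(1-p) would be a support projection, because
      \<open>0 powr 0 = 0\<close>. The identity serves as the weight instead, and the domination
      hypotheses become linear identities.\<close>
    case True
    have mat: "tform (mat_powr (mix X Y) 1) Z (1\<^sub>m n) = (1 - t) * tform (mat_powr X 1) Z (1\<^sub>m n) +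
        t * tform (mat_powr Y 1) Z (1\<^sub>m n)"
      if "X \<in> psd_mats n" "Y \<in> psd_mats n" "Z \<in> carrier_mat n n" for X Y Z
      using tform_lin_left[of X n Y Z "1\<^sub>m n" "1 - t" t] that psd_matsD(1)[OF that(1)]
        psd_matsD(1)[OF that(2)]
      unfolding mat_powr_one_psd[OF mix[OF that(1,2)]] mat_powr_one_psd[OF that(1)]
        mat_powr_one_psd[OF that(2)]
      unfolding mix_def by simp
    have "(1 - t) * tform (M 1) (1\<^sub>m n) (1\<^sub>m n) + t * tform (M 2) (1\<^sub>m n) (1\<^sub>m n) \<le> tform (M 0)
        (1\<^sub>m n) (1\<^sub>m n)"
      unfolding M_def
      by (rule tform_geo_mean_concave[OF \<alpha> st n P Q one_psd])
         (use A B mat in \<open>auto simp: P_def Q_def True simp flip: distrib_right\<close>)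
    thus ?thesis using True M psd_matsD(1)[OF M] by (simp add: mat_powr_one_psd[OF M] tform_one)
  next
    case False
    hence p1: "p < 1" using p by simp
    \<comment> \<open>The endpoints use their own optimizers, for which Young's inequality is an
      equality; the mixture uses the mixture of these, for which the inequality suffices. The trace
      of \<open>Y 0\<close> is then the mixture of the endpoint traces, and moving the term with 1 -
      p to the left leaves a factor p on both sides.\<close>
    define Y where "Y k = (if k = 0 then mix (mat_powr (M 1) (1 / p)) (mat_powr (M 2) (1 / p)) else
        mat_powr (M k) (1 / p))" for k
    have Y: "Y k \<in> psd_mats n" for k
      using M p by (auto simp: Y_def intro!: mix mat_powr_psd)
    define N where "N k = mat_powr (Y k) (1 - p)" for k
    have N: "N k \<in> psd_mats n" for k
      using Y p by (auto simp: N_def intro!: mat_powr_psd)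
    have lieb: "(1 - t) * tform (mat_powr X1 p) Z (N 1) + t * tform (mat_powr X2 p) Z (N 2) \<le> tform
        (mat_powr (mix X1 X2) p) Z (N 0)"
      if "X1 \<in> psd_mats n" "X2 \<in> psd_mats n" "Z \<in> carrier_mat n n" for X1 X2 Z
      using lieb_concavity[OF p(1) p1 st that(1,2) Y[of 1] Y[of 2] that(3)]
      by (simp add: N_def Y_def mix_def)
    \<comment> \<open>Lieb's theorem with the identity as first matrix at all three points yields
      the inequality needed for the regularizing term.\<close>
    have "mix (1\<^sub>m n) (1\<^sub>m n) = 1\<^sub>m n"
      unfolding mix_def by (rule eq_matI) (auto simp flip: of_real_add)
    hence lieb1: "(1 - t) * tform (1\<^sub>m n) Z (N 1) + t * tform (1\<^sub>m n) Z (N 2) \<le> tform (1\<^sub>m n) Z (N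
        0)"
      if "Z \<in> carrier_mat n n" for Z
      using lieb[OF one_psd one_psd that] p by (simp add: mat_powr_of_one)
    have "(1 - t) * tform (M 1) (1\<^sub>m n) (N 1) + t * tform (M 2) (1\<^sub>m n) (N 2) \<le> tform (M 0) (1\<^sub>m n)
        (N 0)"
      unfolding M_def
      by (rule tform_geo_mean_concave[OF \<alpha> st n P Q N])
         (use A B lieb lieb1 in \<open>auto simp: P_def Q_def\<close>)
    also have "\<dots> \<le> p * Re (mat_trace (mat_powr (M 0) (1 / p))) + (1 - p) * Re (mat_trace (Y 0))"
      unfolding N_def by (rule trace_young[OF M Y p(1) p1])
    also have "tform (M 1) (1\<^sub>m n) (N 1) = Re (mat_trace (Y 1))"
      using trace_young_eq[OF M p(1) p1, of 1] by (simp add: N_def Y_def)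
    also have "tform (M 2) (1\<^sub>m n) (N 2) = Re (mat_trace (Y 2))"
      using trace_young_eq[OF M p(1) p1, of 2] by (simp add: N_def Y_def)
    also have "Re (mat_trace (Y 0)) = (1 - t) * Re (mat_trace (Y 1)) + t * Re (mat_trace (Y 2))"
      using psd_matsD(1)[OF Y[of 1]] psd_matsD(1)[OF Y[of 2]]
      by (simp add: Y_def mix_def mat_trace_add[of _ n] mat_trace_smult[of _ n])
    finally have "p * ((1 - t) * Re (mat_trace (Y 1)) + t * Re (mat_trace (Y 2))) \<le> p * Re
        (mat_trace (mat_powr (M 0) (1 / p)))"
      by (simp add: algebra_simps)
    thus ?thesis using p by (simp add: Y_def)
  qed
  thus "(1 - t) * Re (mat_trace (G_mean \<alpha> p A1 B1)) + t * Re (mat_trace (G_mean \<alpha> p A2 B2))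
    \<le> Re (mat_trace (G_mean \<alpha> p (complex_of_real (1 - t) \<cdot>\<^sub>m A1 + complex_of_real t \<cdot>\<^sub>m A2)
        (complex_of_real (1 - t) \<cdot>\<^sub>m B1 + complex_of_real t \<cdot>\<^sub>m B2)))"
    by (simp add: G_mean_def M_def P_def Q_def mix_def)
qed

section \<open>Failure of concavity\<close>

lemma cong_diag_lin:
  assumes "U \<in> carrier_mat n n"
  shows "complex_of_real s \<cdot>\<^sub>m cong_diag n U d + complex_of_real t \<cdot>\<^sub>m cong_diag n U e = cong_diag
      n U (\<lambda>i. s * d i + t * e i)"
  by (rule eq_matI) (use assms in \<open>auto simp: index_cong_diag sum_distrib_left sum.distrib
    algebra_simps\<close>)

lemma geo_mean_supp_one:
  assumes "\<alpha> > 0"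
  shows "geo_mean_supp \<alpha> (1\<^sub>m n) (cong_diag n (1\<^sub>m n) d) = cong_diag n (1\<^sub>m n) (\<lambda>i. d i powr \<alpha>)"
proof -
  have "mat_powr (1\<^sub>m n) r = 1\<^sub>m n" for r
  proof (cases "r < 0")
    case True
    thus ?thesis using mat_powr_minus_cong_diag[OF one_unitary True, of n "\<lambda>_. 1"] by (simp flip:
      one_eq_cong_diag)
  qed (simp add: mat_powr_of_one)
  thus ?thesis using assms left_mult_one_mat[OF cong_diag_carrier[OF one_carrier_mat]]
      right_mult_one_mat[OF cong_diag_carrier[OF one_carrier_mat]]
    by (simp add: geo_mean_supp_def mat_powr_cong_diag[OF one_unitary])
qed

text \<open>In dimension one with A = 1 the function is b^\<alpha>, strictly convex for \<alpha> >
  1. The points 0 and 2 with midpoint 1 give 2^\<alpha> \<le> 2; the point 0 is admissible because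
  the zero support is dominated by every support.\<close>

lemma not_concave_alpha_gt_1:
  assumes \<alpha>: "\<alpha> > 1" and p: "p > 0"
  shows "\<not> Tr_G_jointly_concave \<alpha> p"
proof
  assume conc: "Tr_G_jointly_concave \<alpha> p"
  define B where "B b = cong_diag 1 (1\<^sub>m 1) (\<lambda>_. b)" for b
  have tr: "Re (mat_trace (G_mean \<alpha> p (1\<^sub>m 1) (B b))) = b powr \<alpha>" if "b \<ge> 0" for b
  proof -
    have "G_mean \<alpha> p (1\<^sub>m 1) (B b) = cong_diag 1 (1\<^sub>m 1) (\<lambda>_. ((b powr p) powr \<alpha>) powr (1 / p))"
      using \<alpha> p unfolding G_mean_def B_def
      by (simp add: mat_powr_of_one mat_powr_cong_diag[OF one_unitary] geo_mean_def
        geo_mean_supp_one)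
    thus ?thesis using p by (simp add: mat_trace_cong_diag[OF one_unitary] powr_powr)
  qed
  have dom: "(1\<^sub>m 1, B b) \<in> G_dom \<alpha> 1" if b: "b \<ge> 0" for b
  proof -
    have s1: "supp_proj (1\<^sub>m 1) = cong_diag 1 (1\<^sub>m 1) (\<lambda>_. 1)"
      by (subst one_eq_cong_diag, unfold supp_proj_def, subst mat_fun_cong_diag[OF one_unitary])
        simp
    have s2: "supp_proj (B b) = cong_diag 1 (1\<^sub>m 1) (\<lambda>_. if b = 0 then 0 else 1)"
      unfolding supp_proj_def B_def mat_fun_cong_diag[OF one_unitary] by simp
    have "supp_proj (1\<^sub>m 1) - supp_proj (B b) = complex_of_real 1 \<cdot>\<^sub>m supp_proj (1\<^sub>m 1) +
        complex_of_real (- 1) \<cdot>\<^sub>m supp_proj (B b)"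
      unfolding s1 s2 by (rule eq_matI) auto
    also have "\<dots> \<in> psd_mats 1"
      unfolding s1 s2 cong_diag_lin[OF one_carrier_mat] by (rule psd_cong_diag) auto
    finally have "supp_proj (1\<^sub>m 1) - supp_proj (B b) \<in> psd_mats 1" .
    hence "loewner_le (supp_proj (B b)) (supp_proj (1\<^sub>m 1))" by (simp add: loewner_le_def s2)
    moreover have "B b \<in> psd_mats 1" unfolding B_def by (rule psd_cong_diag) (use b in auto)
    ultimately show ?thesis using \<alpha> one_psd by (simp add: G_dom_def)
  qed
  have "complex_of_real (1 - 1/2) \<cdot>\<^sub>m B 0 + complex_of_real (1/2) \<cdot>\<^sub>m B 2 = B 1"
    unfolding B_def cong_diag_lin[OF one_carrier_mat] by simp
  moreover have "complex_of_real (1 - 1/2) \<cdot>\<^sub>m 1\<^sub>m 1 + complex_of_real (1/2) \<cdot>\<^sub>m 1\<^sub>m 1 = (1\<^sub>m 1 ::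
      complex mat)"
    by (rule eq_matI) auto
  moreover have "(1 - 1/2) * Re (mat_trace (G_mean \<alpha> p (1\<^sub>m 1) (B 0))) + (1/2) * Re (mat_trace
      (G_mean \<alpha> p (1\<^sub>m 1) (B 2)))
    \<le> Re (mat_trace (G_mean \<alpha> p (complex_of_real (1 - 1/2) \<cdot>\<^sub>m 1\<^sub>m 1 + complex_of_real (1/2) \<cdot>\<^sub>m
      1\<^sub>m 1)
        (complex_of_real (1 - 1/2) \<cdot>\<^sub>m B 0 + complex_of_real (1/2) \<cdot>\<^sub>m B 2)))"
    using conc[unfolded Tr_G_jointly_concave_def jointly_concave_on_def, rule_format, of 1
      "(1\<^sub>m 1, B 0)"]
      bspec[of "G_dom \<alpha> 1" _ "(1\<^sub>m 1, B 2)"] dom[of 0] dom[of 2]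
    by (auto dest!: bspec[of "{0..1::real}" _ "1/2"])
  ultimately have "(2 :: real) powr \<alpha> \<le> 2" using \<alpha> tr[of 0] tr[of 1] tr[of 2] by simp
  hence "(2 :: real) powr \<alpha> \<le> 2 powr 1" by simp
  thus False using \<alpha> by (subst (asm) powr_le_cancel_iff) auto
qed

section \<open>Coordinates of vectors and forms of inverse matrices\<close>

definition adj_coord :: "nat \<Rightarrow> complex mat \<Rightarrow> (nat \<Rightarrow> complex) \<Rightarrow> nat \<Rightarrow> complex" where
  "adj_coord n U v k = (\<Sum>i<n. cnj (U $$ (i, k)) * v i)"

lemma sform_cong_diag':
  "U \<in> carrier_mat n n \<Longrightarrow> Re (sform n (cong_diag n U d) v) = (\<Sum>k<n. d k * (cmod (adj_coord n U v
      k))\<^sup>2)"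
  by (simp add: sform_cong_diag adj_coord_def)

lemma adj_coord_mult:
  fixes S T :: "complex mat"
  assumes "S \<in> carrier_mat n n" "T \<in> carrier_mat n n" "S * T = 1\<^sub>m n"  "k < n"
  shows "(\<Sum>l<n. S $$ (k, l) * (\<Sum>m<n. T $$ (l, m) * c m)) = c k"
proof -
  have "(\<Sum>l<n. S $$ (k, l) * (\<Sum>m<n. T $$ (l, m) * c m)) = (\<Sum>l<n. \<Sum>m<n. S $$ (k, l) * T $$ (l, m) *
      c m)"
    by (simp only: sum_distrib_left mult.assoc)
  also have "\<dots> = (\<Sum>m<n. (\<Sum>l<n. S $$ (k, l) * T $$ (l, m)) * c m)"
    by (subst sum.swap) (simp only: sum_distrib_right)
  also have "\<dots> = (\<Sum>m<n. (S * T) $$ (k, m) * c m)"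
    using assms by (intro sum.cong refl arg_cong2[of _ _ _ _ "(*)"] index_mult_mat_sum[of _ n n _
      n, symmetric]) auto
  also have "\<dots> = (\<Sum>m<n. if m = k then c k else 0)"
    unfolding assms(3) using assms(4) by (intro sum.cong refl) (simp add: one_mat_def)
  finally show ?thesis using assms(4) by simp
qed

lemma adj_coord_unitary:
  assumes U: "U \<in> unitary_mats n" and k: "k < n"
  shows "adj_coord n U (\<lambda>i. \<Sum>l<n. U $$ (i, l) * c l) k = c k"
proof -
  note Uc = unitary_matsD[OF U]
  have "adj_coord n U (\<lambda>i. \<Sum>l<n. U $$ (i, l) * c l) k = (\<Sum>i<n. mat_adjoint U $$ (k, i) * (\<Sum>l<n. U
      $$ (i, l) * c l))"
    unfolding adj_coord_def using Uc(1) k by (intro sum.cong) auto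
  also have "\<dots> = c k" by (rule adj_coord_mult[OF Uc(2,1,3) k])
  finally show ?thesis .
qed

lemma adj_coord_col:
  assumes U: "U \<in> unitary_mats n" and "k < n" "j < n"
  shows "adj_coord n U (\<lambda>i. U $$ (i, j)) k = (if k = j then 1 else 0)"
  using adj_coord_unitary[OF U assms(2), of "\<lambda>l. if l = j then 1 else 0"] assms(3)
  by (simp add: if_distrib[of "\<lambda>x. _ * x"] cong: if_cong)

lemma sum_cnj_eq_adj_coord:
  assumes "\<And>i. i < n \<Longrightarrow> v i = (\<Sum>k<n. T $$ (i, k) * \<zeta> k)"
  shows "(\<Sum>i<n. cnj (y i) * v i) = (\<Sum>k<n. cnj (adj_coord n T y k) * \<zeta> k)"
proof -
  have "(\<Sum>i<n. cnj (y i) * v i) = (\<Sum>i<n. \<Sum>k<n. cnj (y i) * T $$ (i, k) * \<zeta> k)"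
    by (intro sum.cong refl) (simp add: assms sum_distrib_left mult.assoc)
  also have "\<dots> = (\<Sum>k<n. (\<Sum>i<n. cnj (y i) * T $$ (i, k)) * \<zeta> k)"
    by (subst sum.swap) (simp only: sum_distrib_right)
  also have "\<dots> = (\<Sum>k<n. cnj (adj_coord n T y k) * \<zeta> k)"
    by (simp add: adj_coord_def mult.commute)
  finally show ?thesis .
qed

lemma unitary_expand:
  assumes U: "U \<in> unitary_mats n" and i: "i < n"
  shows "v i = (\<Sum>k<n. U $$ (i, k) * adj_coord n U v k)"
proof -
  note Uc = unitary_matsD[OF U]
  have "(\<Sum>k<n. U $$ (i, k) * adj_coord n U v k) = (\<Sum>k<n. U $$ (i, k) * (\<Sum>m<n. mat_adjoint U $$ (k,
      m) * v m))"
    unfolding adj_coord_def using Uc(1) by (intro sum.cong refl arg_cong2[of _ _ _ _ "(*)"]) auto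
  also have "\<dots> = v i" by (rule adj_coord_mult[OF Uc(1,2,4) i])
  finally show ?thesis ..
qed

lemma cong_diag_apply:
  assumes U: "U \<in> carrier_mat n n" and i: "i < n"
  shows "(\<Sum>j<n. cong_diag n U d $$ (i, j) * y j) = (\<Sum>k<n. U $$ (i, k) * (of_real (d k) * adj_coord
      n U y k))"
proof -
  have "(\<Sum>j<n. cong_diag n U d $$ (i, j) * y j) = (\<Sum>j<n. \<Sum>k<n. (U $$ (i, k) * of_real (d k)) * (cnj
      (U $$ (j, k)) * y j))"
    by (intro sum.cong refl) (simp add: index_cong_diag[OF U i] sum_distrib_left mult_ac)
  also have "\<dots> = (\<Sum>k<n. U $$ (i, k) * (of_real (d k) * adj_coord n U y k))"
    by (subst sum.swap) (simp only: adj_coord_def sum_distrib_left mult.assoc)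
  finally show ?thesis .
qed

text \<open>The value \<open>\<langle>v, R\<^sup>-\<^sup>1 v\<rangle>\<close> computed from two diagonalizations of \<open>R\<close>; here \<open>\<zeta> = T\<^sup>-\<^sup>1 v\<close>.\<close>

lemma inverse_form_eq:
  fixes v :: "nat \<Rightarrow> complex"
  assumes R: "cong_diag n T r = cong_diag n W d" and T: "T \<in> carrier_mat n n" "S \<in> carrier_mat n n"
    "T * S = 1\<^sub>m n" "S * T = 1\<^sub>m n"
    and W: "W \<in> unitary_mats n" and d: "\<And>k. d k > 0" and r: "\<And>k. k < n \<Longrightarrow> r k > 0"
  defines "\<zeta> \<equiv> \<lambda>k. \<Sum>l<n. S $$ (k, l) * v l"
  shows "(\<Sum>k<n. (cmod (\<zeta> k))\<^sup>2 / r k) = (\<Sum>k<n. (cmod (adj_coord n W v k))\<^sup>2 / d k)"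
proof -
  note Wc = unitary_matsD[OF W]
  \<comment> \<open>This is R^(-1) v, built from the unitary diagonalization. Both sums are
    evaluated as the pairing of \<open>y\<close> with \<open>v\<close>, once in each coordinate
    system.\<close>
  define y where "y i = (\<Sum>l<n. W $$ (i, l) * (adj_coord n W v l / of_real (d l)))" for i
  have yW: "adj_coord n W y k = adj_coord n W v k / of_real (d k)" if "k < n" for k
    unfolding y_def by (rule adj_coord_unitary[OF W that])
  have v: "v i = (\<Sum>k<n. T $$ (i, k) * \<zeta> k)" if "i < n" for i
    unfolding \<zeta>_def by (rule adj_coord_mult[OF T(1,2,3) that, symmetric])
  have Ty: "v i = (\<Sum>k<n. T $$ (i, k) * (of_real (r k) * adj_coord n T y k))" if i: "i < n" for i
  proof -
    have "(\<Sum>k<n. T $$ (i, k) * (of_real (r k) * adj_coord n T y k)) = (\<Sum>k<n. W $$ (i, k) * (of_real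
        (d k) * adj_coord n W y k))"
      unfolding cong_diag_apply[OF T(1) i, symmetric] cong_diag_apply[OF Wc(1) i, symmetric] R ..
    also have "\<dots> = (\<Sum>k<n. W $$ (i, k) * adj_coord n W v k)"
      using d by (intro sum.cong refl) (auto simp: yW less_imp_neq[symmetric])
    also have "\<dots> = v i" by (rule unitary_expand[OF W i, symmetric])
    finally show ?thesis ..
  qed
  have Tr: "adj_coord n T y k = \<zeta> k / of_real (r k)" if k: "k < n" for k
  proof -
    have "\<zeta> k = (\<Sum>l<n. S $$ (k, l) * (\<Sum>m<n. T $$ (l, m) * (of_real (r m) * adj_coord n T y m)))"
      unfolding \<zeta>_def by (intro sum.cong refl) (simp add: Ty)
    also have "\<dots> = of_real (r k) * adj_coord n T y k"
      by (rule adj_coord_mult[OF T(2,1,4) k])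
    finally show ?thesis using r[OF k] by simp
  qed
  have "complex_of_real (\<Sum>k<n. (cmod (\<zeta> k))\<^sup>2 / r k) = (\<Sum>k<n. cnj (adj_coord n T y k) * \<zeta> k)"
    unfolding of_real_sum by (intro sum.cong refl) (simp add: Tr complex_norm_square mult.commute
      del: of_real_power)
  also have "\<dots> = (\<Sum>i<n. cnj (y i) * v i)"
    by (rule sum_cnj_eq_adj_coord[OF v, symmetric])
  also have "\<dots> = (\<Sum>k<n. cnj (adj_coord n W y k) * adj_coord n W v k)"
    by (rule sum_cnj_eq_adj_coord[OF unitary_expand[OF W]])
  also have "\<dots> = complex_of_real (\<Sum>k<n. (cmod (adj_coord n W v k))\<^sup>2 / d k)"
    unfolding of_real_sum by (intro sum.cong refl) (simp add: yW complex_norm_square mult.commute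
      del: of_real_power)
  finally show ?thesis by (simp only: of_real_eq_iff)
qed

section \<open>Two-sided bounds on geometric means and the rank-one case\<close>

lemma sum_powr_hoelder:
  fixes c w :: "nat \<Rightarrow> real"
  assumes \<alpha>: "0 < \<alpha>" "\<alpha> < 1" and c: "\<And>k. c k \<ge> 0" and w: "\<And>k. w k \<ge> 0"
  shows "(\<Sum>k<n. w k powr \<alpha> * c k) \<le> (\<Sum>k<n. c k) powr (1 - \<alpha>) * (\<Sum>k<n. w k * c k) powr \<alpha>"
proof -
  define X where "X = (\<Sum>k<n. c k)"
  define Y where "Y = (\<Sum>k<n. w k * c k)"
  have XY: "X \<ge> 0" "Y \<ge> 0" unfolding X_def Y_def using c w by (auto intro!: sum_nonneg)
  show ?thesis
  proof (cases "X = 0 \<or> Y = 0")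
    case True
    have "w k * c k = 0" if k: "k < n" for k
    proof -
      from True consider "X = 0" | "Y = 0" by blast
      thus ?thesis
      proof cases
        case 1
        hence "c k = 0" using k c unfolding X_def by (simp add: sum_nonneg_eq_0_iff)
        thus ?thesis by simp
      next
        case 2
        thus ?thesis using k c w unfolding Y_def by (subst (asm) sum_nonneg_eq_0_iff) auto
      qed
    qed
    hence "w k powr \<alpha> * c k = 0" if "k < n" for k using that by fastforce
    hence "(\<Sum>k<n. w k powr \<alpha> * c k) = 0" by (intro sum.neutral) blast
    thus ?thesis by simp
  next
    case False
    hence pos: "X > 0" "Y > 0" using XY by auto
    \<comment> \<open>This is the tangent line of the concave function w^\<alpha> at the weighted
      mean Y / X; summed with the weights \<open>c k\<close>, the bracket contributes exactly
      X.\<close>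
    have y: "w k powr \<alpha> \<le> (Y / X) powr \<alpha> * (\<alpha> * (w k * X / Y) + (1 - \<alpha>))" for k
    proof (cases "w k = 0")
      case True
      thus ?thesis using \<alpha> by simp
    next
      case False
      hence wk: "w k > 0" using w[of k] by simp
      have "w k powr \<alpha> = ((Y / X) * (w k * X / Y)) powr \<alpha>" using pos by simp
      also have "\<dots> = (Y / X) powr \<alpha> * (w k * X / Y) powr \<alpha>"
        using pos wk by (subst powr_mult) auto
      also have "(w k * X / Y) powr \<alpha> \<le> \<alpha> * (w k * X / Y) + (1 - \<alpha>)"
        using Youngs_inequality_0[of \<alpha> "1 - \<alpha>" "w k * X / Y" 1] \<alpha> wk pos by simp
      finally show ?thesis by (simp add: mult_left_mono)
    qed
    have "(\<Sum>k<n. w k powr \<alpha> * c k) \<le> (\<Sum>k<n. (Y / X) powr \<alpha> * (\<alpha> * (w k * X / Y) + (1 - \<alpha>)) * c k)"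
      by (intro sum_mono mult_right_mono y c)
    also have "\<dots> = (Y / X) powr \<alpha> * (\<alpha> * X / Y * Y + (1 - \<alpha>) * X)"
    proof -
      have "(\<Sum>k<n. K * (\<alpha> * (w k * X' / Y') + (1 - \<alpha>)) * c k) = K * (\<alpha> * X' / Y' * (\<Sum>k<n. w k * c
          k) + (1 - \<alpha>) * (\<Sum>k<n. c k))" for K X' Y'
        unfolding sum_distrib_left sum.distrib[symmetric] by (intro sum.cong refl) (simp add:
          algebra_simps)
      thus ?thesis unfolding X_def[symmetric] Y_def[symmetric] .
    qed
    also have "\<dots> = (Y / X) powr \<alpha> * X" using pos by (simp add: algebra_simps)
    also have "\<dots> = X powr (1 - \<alpha>) * Y powr \<alpha>"
      using pos by (simp add: powr_divide powr_diff)
    finally show ?thesis unfolding X_def Y_def .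
  qed
qed

text \<open>In the coordinates of \<open>T\<close> this is Hoelder's inequality for the numbers
  \<open>w k powr \<alpha>\<close> with weights given by the squared coordinates of
  \<open>v\<close>.\<close>

lemma sform_geo_mean_supp_le:
  assumes \<alpha>: "0 < \<alpha>" "\<alpha> < 1" and P: "P \<in> pd_mats n" and Q: "Q \<in> psd_mats n"
  shows "Re (sform n (geo_mean_supp \<alpha> P Q) v) \<le> Re (sform n P v) powr (1 - \<alpha>) * Re (sform n Q v)
      powr \<alpha>"
proof -
  obtain U a where U: "U \<in> unitary_mats n" "P = cong_diag n U a" "\<And>i. a i > 0"
    using P unfolding pd_mats_def by auto
  from geo_mean_supp_cong_diag[OF U Q \<alpha>(1)] obtain T S w where T: "T \<in> carrier_mat n n"
    and w: "\<And>i. w i \<ge> 0" and PT: "P = cong_diag n T (\<lambda>_. 1)" and QT: "Q = cong_diag n T w"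
    and G: "geo_mean_supp \<alpha> P Q = cong_diag n T (\<lambda>i. w i powr \<alpha>)" by metis
  show ?thesis unfolding G unfolding PT QT sform_cong_diag'[OF T]
    using sum_powr_hoelder[OF \<alpha>, of "\<lambda>k. (cmod (adj_coord n T v k))\<^sup>2" w n] w by simp
qed

text \<open>Dually, \<open>\<langle>v, (P # Q)\<^sup>-\<^sup>1 v\<rangle> \<le> \<langle>v, P\<^sup>-\<^sup>1 v\<rangle>\<^bsup>1-\<alpha>\<^esup> \<langle>v, Q\<^sup>-\<^sup>1 v\<rangle>\<^bsup>\<alpha>\<^esup>\<close>, combined with the Cauchy-Schwarz inequality.\<close>

lemma sform_geo_mean_supp_ge:
  assumes \<alpha>: "0 < \<alpha>" "\<alpha> < 1"
    and U: "U \<in> unitary_mats n" "\<And>i. a i > 0" and V: "V \<in> unitary_mats n" "\<And>i. b i > 0"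
  shows "(cmod (\<Sum>i<n. cnj (x i) * v i))\<^sup>2 \<le> Re (sform n (geo_mean_supp \<alpha> (cong_diag n U a)
      (cong_diag n V b)) x) *
    ((\<Sum>k<n. (cmod (adj_coord n U v k))\<^sup>2 / a k) powr (1 - \<alpha>) * (\<Sum>k<n. (cmod (adj_coord n V v k))\<^sup>2
      / b k) powr \<alpha>)"
proof -
  define P where "P = cong_diag n U a"
  define Q where "Q = cong_diag n V b"
  note Uc = unitary_matsD[OF U(1)] and Vc = unitary_matsD[OF V(1)]
  have Q: "Q \<in> psd_mats n" unfolding Q_def using V Vc by (intro psd_cong_diag) (auto simp:
    less_imp_le)
  from geo_mean_supp_cong_diag[OF U(1) P_def U(2) Q \<alpha>(1)] obtain T S w where T:
    "T \<in> carrier_mat n n" "S \<in> carrier_mat n n"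
    and TS: "T * S = 1\<^sub>m n" "S * T = 1\<^sub>m n"
    and w: "\<And>i. w i \<ge> 0" and PT: "P = cong_diag n T (\<lambda>_. 1)" and QT: "Q = cong_diag n T w"
    and G: "geo_mean_supp \<alpha> P Q = cong_diag n T (\<lambda>i. w i powr \<alpha>)" by metis
  \<comment> \<open>A zero \<open>w k\<close> would make the form of \<open>Q\<close> vanish at the
    nonzero vector dual to column \<open>k\<close> of \<open>T\<close>, although all eigenvalues
    \<open>b\<close> are positive.\<close>
  have wpos: "w k > 0" if k: "k < n" for k
  proof (rule ccontr)
    assume "\<not> w k > 0"
    hence w0: "w k = 0" using w[of k] by simp
    define y where "y i = cnj (S $$ (k, i))" for i
    have yT: "adj_coord n T y l = (if l = k then 1 else 0)" if l: "l < n" for l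
    proof -
      have "adj_coord n T y l = cnj ((S * T) $$ (k, l))"
        unfolding index_mult_mat_sum[OF T(2,1) k l] by (simp add: adj_coord_def y_def mult.commute)
      thus ?thesis unfolding TS(2) using k l by (simp add: one_mat_def)
    qed
    have "Re (sform n Q y) = 0"
      unfolding QT sform_cong_diag'[OF T(1)] by (intro sum.neutral) (use yT w0 in auto)
    hence "(\<Sum>l<n. b l * (cmod (adj_coord n V y l))\<^sup>2) = 0"
      unfolding Q_def sform_cong_diag'[OF Vc(1)] .
    moreover have "b l \<noteq> 0" for l using V(2)[of l] by simp
    ultimately have "adj_coord n V y l = 0" if "l < n" for l
      using that by (subst (asm) sum_nonneg_eq_0_iff) (auto simp: less_imp_le[OF V(2)])
    hence "y i = 0" if "i < n" for i
      using unitary_expand[OF V(1) that, of y] by simp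
    hence "adj_coord n T y k = 0" by (simp add: adj_coord_def)
    thus False using yT[OF k] by simp
  qed
  define \<zeta> where "\<zeta> k = (\<Sum>l<n. S $$ (k, l) * v l)" for k
  have v: "v i = (\<Sum>k<n. T $$ (i, k) * \<zeta> k)" if "i < n" for i
    unfolding \<zeta>_def by (rule adj_coord_mult[OF T TS(1) that, symmetric])
  have P\<zeta>: "(\<Sum>k<n. (cmod (\<zeta> k))\<^sup>2) = (\<Sum>k<n. (cmod (adj_coord n U v k))\<^sup>2 / a k)"
    using inverse_form_eq[OF PT[unfolded P_def, symmetric] T TS U, of v] by (simp add: \<zeta>_def)
  have Q\<zeta>: "(\<Sum>k<n. (cmod (\<zeta> k))\<^sup>2 / w k) = (\<Sum>k<n. (cmod (adj_coord n V v k))\<^sup>2 / b k)"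
    using inverse_form_eq[OF QT[unfolded Q_def, symmetric] T TS V wpos, of v] by (simp add: \<zeta>_def)
  define z where "z k = cmod (adj_coord n T x k)" for k
  have "cmod (\<Sum>i<n. cnj (x i) * v i) = cmod (\<Sum>k<n. cnj (adj_coord n T x k) * \<zeta> k)"
    by (simp only: sum_cnj_eq_adj_coord[OF v])
  also have "\<dots> \<le> (\<Sum>k<n. z k * cmod (\<zeta> k))"
    by (rule order.trans[OF norm_sum]) (simp add: norm_mult z_def)
  \<comment> \<open>Inserting w^(\<alpha>/2) w^(-\<alpha>/2) makes the first Cauchy-Schwarz factor
    the form of the mean at \<open>x\<close> and the second the form of its inverse at
    \<open>v\<close>.\<close>
  also have "\<dots> = (\<Sum>k<n. (w k powr (\<alpha>/2) * z k) * (w k powr (-\<alpha>/2) * cmod (\<zeta> k)))"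
  proof (intro sum.cong refl, goal_cases)
    case (1 k)
    have "w k powr (\<alpha>/2) * w k powr (-\<alpha>/2) = 1"
      using wpos[of k] 1 by (simp flip: powr_add)
    thus ?case by (metis mult.assoc mult.commute mult.left_neutral)
  qed
  finally have "(cmod (\<Sum>i<n. cnj (x i) * v i))\<^sup>2 \<le> (\<Sum>k<n. (w k powr (\<alpha>/2) * z k) * (w k powr (-\<alpha>/2)
      * cmod (\<zeta> k)))\<^sup>2"
    by (rule power_mono) simp
  also have "\<dots> \<le> (\<Sum>k<n. (w k powr (\<alpha>/2) * z k)\<^sup>2) * (\<Sum>k<n. (w k powr (-\<alpha>/2) * cmod (\<zeta> k))\<^sup>2)"
    by (rule Cauchy_Schwarz_ineq_sum)
  also have "(\<Sum>k<n. (w k powr (\<alpha>/2) * z k)\<^sup>2) = Re (sform n (geo_mean_supp \<alpha> P Q) x)"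
    unfolding G sform_cong_diag'[OF T(1)] z_def
    by (intro sum.cong refl) (simp add: power_mult_distrib power2_eq_square[of "_ powr _"] flip:
      powr_add)
  also have "(\<Sum>k<n. (w k powr (-\<alpha>/2) * cmod (\<zeta> k))\<^sup>2) = (\<Sum>k<n. (1 / w k) powr \<alpha> * (cmod (\<zeta> k))\<^sup>2)"
  proof (intro sum.cong refl, goal_cases)
    case (1 k)
    have "(w k powr (-\<alpha>/2))\<^sup>2 = w k powr (-\<alpha>)" unfolding power2_eq_square powr_add[symmetric] by
      simp
    also have "\<dots> = (1 / w k) powr \<alpha>" using wpos[of k] 1 by (simp add: powr_minus_divide powr_divide)
    finally show ?case by (simp add: power_mult_distrib)
  qed
  also have "Re (sform n (geo_mean_supp \<alpha> P Q) x) * (\<Sum>k<n. (1 / w k) powr \<alpha> * (cmod (\<zeta> k))\<^sup>2)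
     \<le> Re (sform n (geo_mean_supp \<alpha> P Q) x) * ((\<Sum>k<n. (cmod (\<zeta> k))\<^sup>2) powr (1 - \<alpha>) * (\<Sum>k<n. (1 / w
       k) * (cmod (\<zeta> k))\<^sup>2) powr \<alpha>)"
  proof (rule mult_left_mono)
    show "(\<Sum>k<n. (1 / w k) powr \<alpha> * (cmod (\<zeta> k))\<^sup>2) \<le> (\<Sum>k<n. (cmod (\<zeta> k))\<^sup>2) powr (1 - \<alpha>) * (\<Sum>k<n.
        (1 / w k) * (cmod (\<zeta> k))\<^sup>2) powr \<alpha>"
      by (rule sum_powr_hoelder[OF \<alpha>]) (use w in auto)
    show "0 \<le> Re (sform n (geo_mean_supp \<alpha> P Q) x)"
      unfolding G sform_cong_diag'[OF T(1)] by (intro sum_nonneg) auto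
  qed
  finally show ?thesis using P\<zeta> Q\<zeta> by (simp add: P_def Q_def)
qed

lemma cong_diag_plus_eps:
  assumes U: "U \<in> unitary_mats n"
  shows "cong_diag n U d + complex_of_real \<epsilon> \<cdot>\<^sub>m 1\<^sub>m n = cong_diag n U (\<lambda>i. d i + \<epsilon>)"
  using cong_diag_lin[OF unitary_matsD(1)[OF U], of 1 d \<epsilon> "\<lambda>_. 1"] by (simp add: cong_diag_one[OF
    U] smult_one_mat)

lemma adj_coord_diff:
  "adj_coord n U (\<lambda>i. x i - s * y i) k = adj_coord n U x k - s * adj_coord n U y k"
  by (simp add: adj_coord_def algebra_simps sum_subtractf sum_distrib_left)

text \<open>The second argument may be singular, so the value is a limit, and it is found by
  squeezing. With u the first column of \<open>V\<close>, the lower bound says that M minus c times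
  the projection onto u is positive semidefinite. The upper bound makes this difference vanish on
  the complement of u and at P^(-1) u; together these span the space, so the difference is
  zero.\<close>

theorem geo_mean_rank_one:
  assumes \<alpha>: "0 < \<alpha>" "\<alpha> < 1" and n: "n > 0"
    and U: "U \<in> unitary_mats n" "\<And>i. a i > 0" and V: "V \<in> unitary_mats n"
  defines "g \<equiv> (\<Sum>k<n. (cmod (adj_coord n U (\<lambda>i. V $$ (i, 0)) k))\<^sup>2 / a k)"
  shows "g > 0"
    and "geo_mean \<alpha> (cong_diag n U a) (cong_diag n V (\<lambda>i. if i = 0 then 1 else 0))
      = cong_diag n V (\<lambda>i. if i = 0 then g powr (\<alpha> - 1) else 0)"
proof -
  define P where "P = cong_diag n U a"
  define e where "e i = (if i = 0 then 1 else 0 :: real)" for i :: nat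
  define Q where "Q = cong_diag n V e"
  define M where "M = geo_mean \<alpha> P Q"
  define u where "u i = V $$ (i, 0)" for i
  have u: "u = (\<lambda>i. V $$ (i, 0))" by (simp add: u_def fun_eq_iff)
  have g: "g = (\<Sum>k<n. (cmod (adj_coord n U u k))\<^sup>2 / a k)" by (simp add: g_def u)
  let ?M = "geo_mean_eps \<alpha> n P Q"
  note Uc = unitary_matsD[OF U(1)] and Vc = unitary_matsD[OF V(1)]
  have P: "P \<in> psd_mats n" unfolding P_def using Uc U by (intro psd_cong_diag) (auto simp:
    less_imp_le)
  have Q: "Q \<in> psd_mats n" unfolding Q_def using Vc by (intro psd_cong_diag) (auto simp: e_def)
  have M: "M \<in> psd_mats n" unfolding M_def by (rule geo_mean_tendsto(2)[OF \<alpha> n P Q])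
  have Vu: "adj_coord n V u k = (if k = 0 then 1 else 0)" if "k < n" for k
    unfolding u by (rule adj_coord_col[OF V that n])
  show gpos: "g > 0"
  proof (rule ccontr)
    assume "\<not> g > 0"
    moreover have "g \<ge> 0" unfolding g by (intro sum_nonneg) (auto simp: less_imp_le U)
    ultimately have "(\<Sum>k<n. (cmod (adj_coord n U u k))\<^sup>2 / a k) = 0" unfolding g by simp
    hence "adj_coord n U u k = 0" if "k < n" for k
      using that U(2)[of k] by (subst (asm) sum_nonneg_eq_0_iff) (auto simp: less_imp_le[OF U(2)])
    hence "u i = 0" if "i < n" for i
      using unitary_expand[OF U(1) that, of u] by simp
    hence "adj_coord n V u 0 = 0" by (simp add: adj_coord_def)
    thus False using Vu[OF n] by simp
  qed
  have slim: "((\<lambda>\<epsilon>. Re (sform n (?M \<epsilon>) x)) \<longlongrightarrow> Re (sform n M x)) (at_right 0)" for x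
    unfolding sform_def M_def by (intro tendsto_intros geo_mean_tendsto(1)[OF \<alpha> n P Q]) auto
  have Meps: "?M \<epsilon> = geo_mean_supp \<alpha> (cong_diag n U (\<lambda>i. a i + \<epsilon>)) (cong_diag n V (\<lambda>i. e i + \<epsilon>))"
    for \<epsilon>
    unfolding geo_mean_eps_def P_def Q_def cong_diag_plus_eps[OF U(1)] cong_diag_plus_eps[OF V] ..
  have lower: "(cmod (\<Sum>i<n. cnj (x i) * u i))\<^sup>2 \<le> Re (sform n M x) * g powr (1 - \<alpha>)" for x
  proof (rule tendsto_lowerbound)
    show "((\<lambda>\<epsilon>. Re (sform n (?M \<epsilon>) x) * g powr (1 - \<alpha>)) \<longlongrightarrow> Re (sform n M x) * g powr (1 - \<alpha>))
        (at_right 0)"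
      by (intro tendsto_intros slim)
    have "(cmod (\<Sum>i<n. cnj (x i) * u i))\<^sup>2 \<le> Re (sform n (?M \<epsilon>) x) * g powr (1 - \<alpha>)" if \<epsilon>: "\<epsilon> > 0"
      for \<epsilon>
    proof -
      have "(cmod (\<Sum>i<n. cnj (x i) * u i))\<^sup>2 \<le> Re (sform n (?M \<epsilon>) x) *
        ((\<Sum>k<n. (cmod (adj_coord n U u k))\<^sup>2 / (a k + \<epsilon>)) powr (1 - \<alpha>) * (\<Sum>k<n. (cmod (adj_coord n
          V u k))\<^sup>2 / (e k + \<epsilon>)) powr \<alpha>)"
        unfolding Meps by (rule sform_geo_mean_supp_ge[OF \<alpha> U(1) _ V]) (use U(2) \<epsilon> in
          \<open>auto simp: e_def add_pos_pos\<close>)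
      also have "\<dots> \<le> Re (sform n (?M \<epsilon>) x) * (g powr (1 - \<alpha>) * 1)"
      proof (intro mult_left_mono mult_mono)
        show "(\<Sum>k<n. (cmod (adj_coord n U u k))\<^sup>2 / (a k + \<epsilon>)) powr (1 - \<alpha>) \<le> g powr (1 - \<alpha>)"
          unfolding g using \<alpha> \<epsilon> U(2)
          by (intro powr_mono2 sum_mono divide_left_mono sum_nonneg) (auto simp: less_imp_le
            add_pos_pos add_nonneg_nonneg)
        \<comment> \<open>Since \<open>u\<close> is the eigenvector of \<open>Q\<close> for
          eigenvalue 1, the regularized inverse form sees only 1 + \<epsilon>; the directions with
          eigenvalue \<epsilon>, whose inverses blow up, do not occur.\<close>
        have "(\<Sum>k<n. (cmod (adj_coord n V u k))\<^sup>2 / (e k + \<epsilon>)) = (\<Sum>k<n. if k = 0 then 1 / (1 + \<epsilon>)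
            else 0)"
          by (intro sum.cong refl) (auto simp: Vu e_def)
        also have "\<dots> = 1 / (1 + \<epsilon>)" using n by simp
        finally have "(\<Sum>k<n. (cmod (adj_coord n V u k))\<^sup>2 / (e k + \<epsilon>)) = 1 / (1 + \<epsilon>)" .
        thus "(\<Sum>k<n. (cmod (adj_coord n V u k))\<^sup>2 / (e k + \<epsilon>)) powr \<alpha> \<le> 1"
          using \<epsilon> \<alpha> by (auto intro!: powr_le1)
        show "0 \<le> Re (sform n (?M \<epsilon>) x)"
          using psd_matsD(2)[OF geo_mean_eps_psd[OF P Q \<alpha>(1) \<epsilon>], of x] by (simp add:
            less_eq_complex_def)
      qed auto
      finally show ?thesis by simp
    qed
    thus "\<forall>\<^sub>F \<epsilon> in at_right 0. (cmod (\<Sum>i<n. cnj (x i) * u i))\<^sup>2 \<le> Re (sform n (?M \<epsilon>) x) * g powr (1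
        - \<alpha>)"
      by (auto simp: eventually_at_filter)
  qed simp
  have upper: "Re (sform n M x) \<le> Re (sform n P x) powr (1 - \<alpha>) * Re (sform n Q x) powr \<alpha>" for x
  proof (rule tendsto_le[OF _ _ slim])
    have nn: "Re (sform n (cong_diag n W (\<lambda>i. d i + \<epsilon>)) x) \<ge> 0" if "W \<in> unitary_mats n"
      "\<And>i. d i \<ge> 0" "\<epsilon> > 0" for W d \<epsilon>
      unfolding sform_cong_diag'[OF unitary_matsD(1)[OF that(1)]] using that by (intro sum_nonneg)
        auto
    have lim: "((\<lambda>\<epsilon>. Re (sform n (cong_diag n W (\<lambda>i. d i + \<epsilon>)) x)) \<longlongrightarrow> Re (sform n (cong_diag n W d)
        x)) (at_right 0)"
      if "W \<in> unitary_mats n" for W d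
    proof -
      have "((\<lambda>\<epsilon>. \<Sum>k<n. (d k + \<epsilon>) * (cmod (adj_coord n W x k))\<^sup>2) \<longlongrightarrow> (\<Sum>k<n. (d k + 0) * (cmod
          (adj_coord n W x k))\<^sup>2)) (at_right 0)"
        by (intro tendsto_intros)
      thus ?thesis unfolding sform_cong_diag'[OF unitary_matsD(1)[OF that]] by simp
    qed
    have ev: "\<forall>\<^sub>F \<epsilon> in at_right 0. 0 \<le> Re (sform n (cong_diag n W (\<lambda>i. d i + \<epsilon>)) x)"
      if "W \<in> unitary_mats n" "\<And>i. d i \<ge> 0" for W d
      by (rule eventually_mono[OF eventually_at_right_less]) (rule nn[OF that])
    show "((\<lambda>\<epsilon>. Re (sform n (cong_diag n U (\<lambda>i. a i + \<epsilon>)) x) powr (1 - \<alpha>) * Re (sform n (cong_diag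
        n V (\<lambda>i. e i + \<epsilon>)) x) powr \<alpha>)
       \<longlongrightarrow> Re (sform n P x) powr (1 - \<alpha>) * Re (sform n Q x) powr \<alpha>) (at_right 0)"
      unfolding P_def Q_def using \<alpha>
      by (intro tendsto_mult tendsto_powr' lim U V tendsto_const)
         (use ev[OF U(1) less_imp_le[OF U(2)]] ev[OF V, of e] in \<open>auto simp: e_def\<close>)
    have "Re (sform n (?M \<epsilon>) x) \<le> Re (sform n (cong_diag n U (\<lambda>i. a i + \<epsilon>)) x) powr (1 - \<alpha>) * Re
        (sform n (cong_diag n V (\<lambda>i. e i + \<epsilon>)) x) powr \<alpha>"
      if "\<epsilon> > 0" for \<epsilon>
      unfolding Meps
      by (rule sform_geo_mean_supp_le[OF \<alpha>])
        (use U V that Vc in \<open>auto simp: pd_mats_def e_def intro!: bexI[of _ U] exI[of _ "\<lambda>i. a i +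
            \<epsilon>"] psd_cong_diag add_pos_pos\<close>)
    thus "\<forall>\<^sub>F \<epsilon> in at_right 0. Re (sform n (?M \<epsilon>) x) \<le> Re (sform n (cong_diag n U (\<lambda>i. a i + \<epsilon>)) x)
        powr (1 - \<alpha>) * Re (sform n (cong_diag n V (\<lambda>i. e i + \<epsilon>)) x) powr \<alpha>"
      by (auto simp: eventually_at_filter)
  qed simp
  have Qx: "Re (sform n Q x) = (cmod (\<Sum>i<n. cnj (u i) * x i))\<^sup>2" for x
  proof -
    have "Re (sform n Q x) = (\<Sum>k<n. if k = 0 then (cmod (adj_coord n V x 0))\<^sup>2 else 0)"
      unfolding Q_def sform_cong_diag'[OF Vc(1)] by (intro sum.cong) (auto simp: e_def)
    thus ?thesis using n by (simp add: adj_coord_def u_def)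
  qed
  \<comment> \<open>The constant forced by the lower bound; c g^2 is also what the upper bound gives
    at P^(-1) u.\<close>
  define c where "c = g powr (\<alpha> - 1)"
  have cpos: "c > 0" "c * g powr (1 - \<alpha>) = 1" using gpos by (auto simp: c_def simp flip: powr_add)
  define R where "R = complex_of_real 1 \<cdot>\<^sub>m M + complex_of_real (- c) \<cdot>\<^sub>m Q"
  note Mc = psd_matsD(1)[OF M] and Qc = psd_matsD(1)[OF Q]
  have sR: "sform n R x = sform n M x - of_real c * sform n Q x" for x
    unfolding R_def sform_def sum_distrib_left sum_subtractf[symmetric] using Mc Qc
    by (intro sum.cong refl) (simp add: algebra_simps)
  have RM: "Re (sform n R x) = Re (sform n M x) - c * (cmod (\<Sum>i<n. cnj (u i) * x i))\<^sup>2" for x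
    unfolding sR by (simp add: Qx)
  have R: "R \<in> psd_mats n"
    unfolding psd_mats_iff
  proof (intro conjI allI)
    show "R \<in> carrier_mat n n" using Mc Qc by (simp add: R_def)
    fix x
    have "(\<Sum>i<n. cnj (x i) * u i) = cnj (\<Sum>i<n. cnj (u i) * x i)" by (simp add: mult.commute)
    hence eq: "(cmod (\<Sum>i<n. cnj (u i) * x i))\<^sup>2 = (cmod (\<Sum>i<n. cnj (x i) * u i))\<^sup>2" by (simp only:
      complex_mod_cnj)
    have "c * (cmod (\<Sum>i<n. cnj (u i) * x i))\<^sup>2 \<le> c * (Re (sform n M x) * g powr (1 - \<alpha>))"
      unfolding eq using cpos(1) lower[of x] by (intro mult_left_mono) auto
    also have "\<dots> = Re (sform n M x)" using cpos(2) by (simp add: mult.left_commute mult.commute)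
    finally have "Re (sform n R x) \<ge> 0" unfolding RM by simp
    moreover have "Im (sform n R x) = 0"
      unfolding sR using psd_matsD(2)[OF M, of x] psd_matsD(2)[OF Q, of x] by (simp add:
        less_eq_complex_def)
    ultimately show "0 \<le> sform n R x" by (simp add: less_eq_complex_def)
  qed
  from psd_spectral[OF R] obtain W d where W: "W \<in> unitary_mats n" "R = cong_diag n W d"
    "\<And>i. d i \<ge> 0" by metis
  note Wc = unitary_matsD[OF W(1)]
  have "d k = 0" if k: "k < n" for k
  proof (rule ccontr)
    assume dk: "d k \<noteq> 0"
    have zero: "adj_coord n W x k = 0" if "Re (sform n R x) \<le> 0" for x
    proof -
      have "(\<Sum>l<n. d l * (cmod (adj_coord n W x l))\<^sup>2) \<le> 0"
        using that unfolding W(2) sform_cong_diag'[OF Wc(1)] .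
      moreover have "d k * (cmod (adj_coord n W x k))\<^sup>2 \<le> (\<Sum>l<n. d l * (cmod (adj_coord n W x
          l))\<^sup>2)"
        by (rule member_le_sum) (use k W(3) in auto)
      ultimately have "d k * (cmod (adj_coord n W x k))\<^sup>2 \<le> 0" by simp
      thus ?thesis using dk W(3)[of k] by (auto simp: mult_le_0_iff)
    qed
    \<comment> \<open>This is P^(-1) u. Its form under \<open>P\<close> and its pairing with
      \<open>u\<close> both equal \<open>g\<close>, so the lower and the upper bound coincide at
      it.\<close>
    define y where "y i = (\<Sum>l<n. U $$ (i, l) * (adj_coord n U u l / of_real (a l)))" for i
    have yU: "adj_coord n U y l = adj_coord n U u l / of_real (a l)" if "l < n" for l
      unfolding y_def by (rule adj_coord_unitary[OF U(1) that])
    have "(\<Sum>i<n. cnj (u i) * y i) = (\<Sum>l<n. cnj (adj_coord n U u l) * (adj_coord n U u l / of_real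
        (a l)))"
      by (rule sum_cnj_eq_adj_coord) (simp add: y_def)
    also have "\<dots> = of_real g"
      unfolding g of_real_sum by (intro sum.cong refl) (simp add: complex_norm_square mult.commute
        del: of_real_power)
    finally have uy: "(\<Sum>i<n. cnj (u i) * y i) = of_real g" .
    have Py: "Re (sform n P y) = g"
      unfolding P_def sform_cong_diag'[OF Uc(1)] g
      using U(2) by (intro sum.cong refl) (auto simp: yU norm_divide power_divide power2_eq_square
        less_imp_neq[symmetric] abs_of_pos)
    have "Re (sform n M y) \<le> g powr (1 - \<alpha>) * (g\<^sup>2) powr \<alpha>"
      using upper[of y] unfolding Py Qx uy using gpos by simp
    also have "\<dots> = c * g\<^sup>2"
      using gpos by (simp add: c_def powr_powr add.commute flip: powr_add powr_numeral)
    finally have "Re (sform n R y) \<le> 0" unfolding RM uy using gpos by simp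
    hence y0: "adj_coord n W y k = 0" by (rule zero)
    \<comment> \<open>Subtracting this multiple of \<open>y\<close> makes column \<open>k\<close> of
      \<open>W\<close> orthogonal to \<open>u\<close> and keeps its coordinate \<open>k\<close>
      equal to 1, because that coordinate of \<open>y\<close> vanishes. The contradiction is that
      \<open>R\<close> vanishes at the result.\<close>
    define s where "s = (\<Sum>i<n. cnj (u i) * W $$ (i, k)) / of_real g"
    define x where "x i = W $$ (i, k) - s * y i" for i
    have "(\<Sum>i<n. cnj (u i) * x i) = (\<Sum>i<n. cnj (u i) * W $$ (i, k)) - s * (\<Sum>i<n. cnj (u i) * y i)"
      by (simp add: x_def algebra_simps sum_subtractf sum_distrib_left)
    also have "\<dots> = 0" unfolding uy s_def using gpos by simp
    finally have ux: "(\<Sum>i<n. cnj (u i) * x i) = 0" .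
    have "Re (sform n M x) \<le> 0" using upper[of x] unfolding Qx ux using \<alpha> by simp
    hence "Re (sform n R x) \<le> 0" unfolding RM ux by simp
    hence "adj_coord n W x k = 0" by (rule zero)
    moreover have "adj_coord n W x k = 1"
      unfolding x_def adj_coord_diff y0 adj_coord_col[OF W(1) k k] by simp
    ultimately show False by simp
  qed
  hence "R = cong_diag n W (\<lambda>_. 0)" unfolding W(2) by (intro cong_diag_cong) auto
  hence R0: "R $$ (i, j) = 0" if "i < n" "j < n" for i j
    using that by (simp add: index_cong_diag[OF Wc(1)])
  have "M = cong_diag n V (\<lambda>i. if i = 0 then c else 0)"
  proof (rule eq_matI)
    fix i j assume "i < dim_row (cong_diag n V (\<lambda>i. if i = 0 then c else 0))"
      "j < dim_col (cong_diag n V (\<lambda>i. if i = 0 then c else 0))"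
    hence ij: "i < n" "j < n" using Vc by auto
    have "M $$ (i, j) = of_real c * Q $$ (i, j)" using R0[OF ij] Mc Qc ij by (simp add: R_def)
    also have "\<dots> = cong_diag n V (\<lambda>i. if i = 0 then c else 0) $$ (i, j)"
      unfolding Q_def index_cong_diag[OF Vc(1) ij] sum_distrib_left by (intro sum.cong) (auto simp:
        e_def)
    finally show "M $$ (i, j) = cong_diag n V (\<lambda>i. if i = 0 then c else 0) $$ (i, j)" .
  qed (use Mc Vc in auto)
  thus "geo_mean \<alpha> (cong_diag n U a) (cong_diag n V (\<lambda>i. if i = 0 then 1 else 0))
      = cong_diag n V (\<lambda>i. if i = 0 then g powr (\<alpha> - 1) else 0)"
    unfolding M_def P_def Q_def c_def e_def .
qed

text \<open>The inner power leaves the projection unchanged, since its eigenvalues are 0 and 1. The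
  mean then has the single nonzero eigenvalue g^(\<alpha>-1), on which the outer power acts.\<close>

lemma Tr_G_rank_one:
  assumes \<alpha>: "0 < \<alpha>" "\<alpha> < 1" and p: "p > 0" and n: "n > 0"
    and U: "U \<in> unitary_mats n" "\<And>i. a i > 0" and V: "V \<in> unitary_mats n"
  shows "Re (mat_trace (G_mean \<alpha> p (cong_diag n U a) (cong_diag n V (\<lambda>i. if i = 0 then 1 else 0))))
    = (\<Sum>k<n. (cmod (adj_coord n U (\<lambda>i. V $$ (i, 0)) k))\<^sup>2 * a k powr (- p)) powr (- ((1 - \<alpha>) / p))"
proof -
  define g where "g = (\<Sum>k<n. (cmod (adj_coord n U (\<lambda>i. V $$ (i, 0)) k))\<^sup>2 / (a k powr p))"
  note r = geo_mean_rank_one[OF \<alpha> n U(1) _ V, of "\<lambda>i. a i powr p", folded g_def]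
  have P: "mat_powr (cong_diag n U a) p = cong_diag n U (\<lambda>i. a i powr p)"
    using p by (simp add: mat_powr_cong_diag[OF U(1)])
  have Q: "mat_powr (cong_diag n V (\<lambda>i. if i = 0 then 1 else 0)) p = cong_diag n V (\<lambda>i. if i = 0
      then 1 else 0)"
    using p by (subst mat_powr_cong_diag[OF V]) (auto intro!: cong_diag_cong)
  have ap: "a i powr p > 0" for i using U(2)[of i] by simp
  have "G_mean \<alpha> p (cong_diag n U a) (cong_diag n V (\<lambda>i. if i = 0 then 1 else 0))
      = cong_diag n V (\<lambda>i. (if i = 0 then g powr (\<alpha> - 1) else 0) powr (1 / p))"
    unfolding G_mean_def P Q r(2)[OF ap] using p by (simp add: mat_powr_cong_diag[OF V])
  hence "Re (mat_trace (G_mean \<alpha> p (cong_diag n U a) (cong_diag n V (\<lambda>i. if i = 0 then 1 else 0))))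
      = (\<Sum>i<n. if i = 0 then (g powr (\<alpha> - 1)) powr (1 / p) else 0)"
    by (simp add: mat_trace_cong_diag[OF V] if_distrib[of "\<lambda>x. x powr _"] cong: if_cong)
  also have "\<dots> = g powr ((\<alpha> - 1) / p)" using n by (simp add: powr_powr)
  also have "(\<alpha> - 1) / p = - ((1 - \<alpha>) / p)" by (simp add: minus_divide_left)
  finally show ?thesis unfolding g_def by (simp add: powr_minus divide_inverse)
qed

section \<open>Plane rotations and the explicit midpoint inequality\<close>

lemma one_plus_square_pos: "1 + r\<^sup>2 > (0 :: real)"
  by (simp add: add_pos_nonneg)

text \<open>The parameter is the tangent of the angle, so that conjugated diagonal matrices have
  entries rational in \<open>r\<close>. The first column of \<open>rot (1 / x)\<close> is
  proportional to (x, 1).\<close>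

definition rot :: "real \<Rightarrow> complex mat" where
  "rot r = Matrix.mat 2 2 (\<lambda>(i, j). complex_of_real ((if i = j then 1 else if i = 0 then - r else
      r) / sqrt (1 + r\<^sup>2)))"

lemma rot_index:
  "rot r $$ (0, 0) = of_real (1 / sqrt (1 + r\<^sup>2))"
    "rot r $$ (0, Suc 0) = of_real (- r / sqrt (1 + r\<^sup>2))"
  "rot r $$ (Suc 0, 0) = of_real (r / sqrt (1 + r\<^sup>2))"
    "rot r $$ (Suc 0, Suc 0) = of_real (1 / sqrt (1 + r\<^sup>2))"
  by (simp_all add: rot_def)

lemma rot_carrier [simp]: "rot r \<in> carrier_mat 2 2"
  by (simp add: rot_def)

lemma rot_dim [simp]: "dim_row (rot r) = 2" "dim_col (rot r) = 2"
  by (simp_all add: rot_def)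

lemma sum_lessThan_2: "(\<Sum>k<2. f k) = f 0 + f (Suc 0)"
  by (simp add: numeral_2_eq_2)

lemma rot_norm: "(1 / sqrt (1 + r\<^sup>2))\<^sup>2 = 1 / (1 + r\<^sup>2)"
  by (simp add: power_divide add_nonneg_nonneg)

lemma rot_unitary: "rot r \<in> unitary_mats 2"
proof (rule unitary_matsI)
  define q where "q = 1 / sqrt (1 + r\<^sup>2)"
  have "q * q = 1 / (1 + r\<^sup>2)" unfolding q_def using rot_norm[of r] by (simp add: power2_eq_square)
  hence q: "(1 + r * r) * (q * q) = 1" using one_plus_square_pos[of r] by (simp add:
    power2_eq_square)
  have idx: "rot r $$ (0, 0) = of_real q" "rot r $$ (0, Suc 0) = of_real (- r * q)"
    "rot r $$ (Suc 0, 0) = of_real (r * q)" "rot r $$ (Suc 0, Suc 0) = of_real q"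
    by (simp_all add: rot_index q_def)
  show "mat_adjoint (rot r) * rot r = 1\<^sub>m 2"
  proof (rule eq_matI)
    fix i j assume "i < dim_row (1\<^sub>m 2 :: complex mat)" "j < dim_col (1\<^sub>m 2 :: complex mat)"
    hence ij: "i < 2" "j < 2" by auto
    have "(mat_adjoint (rot r) * rot r) $$ (i, j) = (\<Sum>l<2. mat_adjoint (rot r) $$ (i, l) * rot r $$
        (l, j))"
      by (rule index_mult_mat_sum[of _ 2 2 _ 2]) (use ij in auto)
    also have "\<dots> = of_real (if i = j then (1 + r * r) * (q * q) else 0)"
      using ij unfolding sum_lessThan_2
      by (auto simp: less_2_cases_iff idx algebra_simps)
    also have "\<dots> = 1\<^sub>m 2 $$ (i, j)" unfolding q using ij by simp
    finally show "(mat_adjoint (rot r) * rot r) $$ (i, j) = 1\<^sub>m 2 $$ (i, j)" .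
  qed auto
qed simp

definition diag2 :: "real \<Rightarrow> real \<Rightarrow> nat \<Rightarrow> real" where
  "diag2 l m i = (if i = 0 then l else m)"

lemma rot_cong_diag_index:
  "cong_diag 2 (rot r) (diag2 l m) $$ (0, 0) = of_real ((l + r\<^sup>2 * m) / (1 + r\<^sup>2))"
  "cong_diag 2 (rot r) (diag2 l m) $$ (0, Suc 0) = of_real (r * (l - m) / (1 + r\<^sup>2))"
  "cong_diag 2 (rot r) (diag2 l m) $$ (Suc 0, 0) = of_real (r * (l - m) / (1 + r\<^sup>2))"
  "cong_diag 2 (rot r) (diag2 l m) $$ (Suc 0, Suc 0) = of_real ((r\<^sup>2 * l + m) / (1 + r\<^sup>2))"
proof -
  define q where "q = sqrt (1 + r\<^sup>2)"
  have q: "1 + r\<^sup>2 = q * q" by (simp add: q_def add_nonneg_nonneg)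
  show "cong_diag 2 (rot r) (diag2 l m) $$ (0, 0) = of_real ((l + r\<^sup>2 * m) / (1 + r\<^sup>2))"
  "cong_diag 2 (rot r) (diag2 l m) $$ (0, Suc 0) = of_real (r * (l - m) / (1 + r\<^sup>2))"
  "cong_diag 2 (rot r) (diag2 l m) $$ (Suc 0, 0) = of_real (r * (l - m) / (1 + r\<^sup>2))"
  "cong_diag 2 (rot r) (diag2 l m) $$ (Suc 0, Suc 0) = of_real ((r\<^sup>2 * l + m) / (1 + r\<^sup>2))"
    by (simp_all only: index_cong_diag[OF rot_carrier] sum_lessThan_2 rot_index q_def[symmetric],
      unfold q)
      (simp_all add: diag2_def power2_eq_square add_divide_distrib diff_divide_distrib
        algebra_simps)
qed

text \<open>The off-diagonal entries r (l - m) / (1 + r^2) have opposite signs for r and -r, so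
  equal gaps make them cancel. The midpoint is diagonal, and its eigenvalues can be read
  off.\<close>

lemma rot_midpoint:
  assumes "l1 - m1 = l2 - m2"
  shows "complex_of_real (1 - 1/2) \<cdot>\<^sub>m cong_diag 2 (rot r) (diag2 l1 m1) + complex_of_real (1/2)
      \<cdot>\<^sub>m cong_diag 2 (rot (- r)) (diag2 l2 m2)
    = cong_diag 2 (rot 0) (diag2 (((l1 + l2) / 2 + r\<^sup>2 * ((m1 + m2) / 2)) / (1 + r\<^sup>2)) (((m1 + m2)
      / 2 + r\<^sup>2 * ((l1 + l2) / 2)) / (1 + r\<^sup>2)))"
proof (rule eq_matI)
  have "l1 * r - m1 * r + (m2 * r - l2 * r) = r * ((l1 - m1) - (l2 - m2))" by (simp add:
    algebra_simps)
  hence off: "(l1 * r - m1 * r) / (2 + 2 * r\<^sup>2) + (m2 * r - l2 * r) / (2 + 2 * r\<^sup>2) = 0"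
    unfolding add_divide_distrib[symmetric] using assms by simp
  fix i j
  assume "i < dim_row (cong_diag 2 (rot 0) (diag2 (((l1 + l2) / 2 + r\<^sup>2 * ((m1 + m2) / 2)) / (1 +
      r\<^sup>2)) (((m1 + m2) / 2 + r\<^sup>2 * ((l1 + l2) / 2)) / (1 + r\<^sup>2))))"
    "j < dim_col (cong_diag 2 (rot 0) (diag2 (((l1 + l2) / 2 + r\<^sup>2 * ((m1 + m2) / 2)) / (1 + r\<^sup>2))
        (((m1 + m2) / 2 + r\<^sup>2 * ((l1 + l2) / 2)) / (1 + r\<^sup>2))))"
  hence ij: "i < 2" "j < 2" by auto
  have "Re ((complex_of_real (1 - 1/2) \<cdot>\<^sub>m cong_diag 2 (rot r) (diag2 l1 m1) + complex_of_real
      (1/2) \<cdot>\<^sub>m cong_diag 2 (rot (- r)) (diag2 l2 m2)) $$ (i, j))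
    = Re (cong_diag 2 (rot 0) (diag2 (((l1 + l2) / 2 + r\<^sup>2 * ((m1 + m2) / 2)) / (1 + r\<^sup>2)) (((m1 +
      m2) / 2 + r\<^sup>2 * ((l1 + l2) / 2)) / (1 + r\<^sup>2))) $$ (i, j))"
    using ij assms by (auto simp: less_2_cases_iff rot_cong_diag_index add_divide_distrib
      algebra_simps) (simp_all add: off)
  moreover have "Im ((complex_of_real (1 - 1/2) \<cdot>\<^sub>m cong_diag 2 (rot r) (diag2 l1 m1) +
      complex_of_real (1/2) \<cdot>\<^sub>m cong_diag 2 (rot (- r)) (diag2 l2 m2)) $$ (i, j))
    = Im (cong_diag 2 (rot 0) (diag2 (((l1 + l2) / 2 + r\<^sup>2 * ((m1 + m2) / 2)) / (1 + r\<^sup>2)) (((m1 +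
      m2) / 2 + r\<^sup>2 * ((l1 + l2) / 2)) / (1 + r\<^sup>2))) $$ (i, j))"
    using ij by (auto simp: less_2_cases_iff rot_cong_diag_index)
  ultimately show "(complex_of_real (1 - 1/2) \<cdot>\<^sub>m cong_diag 2 (rot r) (diag2 l1 m1) +
      complex_of_real (1/2) \<cdot>\<^sub>m cong_diag 2 (rot (- r)) (diag2 l2 m2)) $$ (i, j)
    = cong_diag 2 (rot 0) (diag2 (((l1 + l2) / 2 + r\<^sup>2 * ((m1 + m2) / 2)) / (1 + r\<^sup>2)) (((m1 + m2)
      / 2 + r\<^sup>2 * ((l1 + l2) / 2)) / (1 + r\<^sup>2))) $$ (i, j)"
    by (rule complex_eqI)
qed auto

lemma rot_overlap:
  assumes x: "x > 0"
  shows "(cmod (adj_coord 2 (rot r) (\<lambda>i. rot (1 / x) $$ (i, 0)) 0))\<^sup>2 = (x + r)\<^sup>2 / (1 + r\<^sup>2) / (1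
      + x\<^sup>2)"
    and "(cmod (adj_coord 2 (rot r) (\<lambda>i. rot (1 / x) $$ (i, 0)) (Suc 0)))\<^sup>2 = (1 - r * x)\<^sup>2 / (1 +
        r\<^sup>2) / (1 + x\<^sup>2)"
proof -
  define q where "q = 1 / sqrt (1 + r\<^sup>2)"
  define s where "s = 1 / sqrt (1 + (1 / x)\<^sup>2)"
  have q2: "q\<^sup>2 = 1 / (1 + r\<^sup>2)" unfolding q_def by (rule rot_norm)
  have "s\<^sup>2 = 1 / (1 + (1 / x)\<^sup>2)" unfolding s_def by (rule rot_norm)
  also have "\<dots> = x\<^sup>2 / (1 + x\<^sup>2)" using x by (simp add: field_simps power2_eq_square)
  finally have s2: "s\<^sup>2 = x\<^sup>2 / (1 + x\<^sup>2)" .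
  have "adj_coord 2 (rot r) (\<lambda>i. rot (1 / x) $$ (i, 0)) 0 = of_real (q * s * (1 + r / x))"
    unfolding adj_coord_def sum_lessThan_2 rot_index q_def s_def complex_cnj_complex_of_real
      of_real_mult[symmetric] of_real_add[symmetric]
    by (intro arg_cong[of _ _ of_real]) (simp add: divide_inverse algebra_simps)
  hence "(cmod (adj_coord 2 (rot r) (\<lambda>i. rot (1 / x) $$ (i, 0)) 0))\<^sup>2 = q\<^sup>2 * s\<^sup>2 * (1 + r / x)\<^sup>2"
    by (simp only: norm_of_real power2_abs power_mult_distrib)
  also have "\<dots> = 1 / (1 + r\<^sup>2) * ((x * (1 + r / x))\<^sup>2 / (1 + x\<^sup>2))"
    unfolding q2 s2 by (simp add: power_mult_distrib)
  also have "x * (1 + r / x) = x + r" using x by (simp add: field_simps)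
  finally show "(cmod (adj_coord 2 (rot r) (\<lambda>i. rot (1 / x) $$ (i, 0)) 0))\<^sup>2 = (x + r)\<^sup>2 / (1 +
      r\<^sup>2) / (1 + x\<^sup>2)" by simp
  have "adj_coord 2 (rot r) (\<lambda>i. rot (1 / x) $$ (i, 0)) (Suc 0) = of_real (q * s * (- r + 1 / x))"
    unfolding adj_coord_def sum_lessThan_2 rot_index q_def s_def complex_cnj_complex_of_real
      of_real_mult[symmetric] of_real_add[symmetric]
    by (intro arg_cong[of _ _ of_real]) (simp add: divide_inverse algebra_simps)
  hence "(cmod (adj_coord 2 (rot r) (\<lambda>i. rot (1 / x) $$ (i, 0)) (Suc 0)))\<^sup>2 = q\<^sup>2 * s\<^sup>2 * (- r + 1
      / x)\<^sup>2"
    by (simp only: norm_of_real power2_abs power_mult_distrib)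
  also have "\<dots> = 1 / (1 + r\<^sup>2) * ((x * (- r + 1 / x))\<^sup>2 / (1 + x\<^sup>2))"
    unfolding q2 s2 by (simp add: power_mult_distrib)
  also have "x * (- r + 1 / x) = 1 - r * x" using x by (simp add: field_simps)
  finally show "(cmod (adj_coord 2 (rot r) (\<lambda>i. rot (1 / x) $$ (i, 0)) (Suc 0)))\<^sup>2 = (1 - r * x)\<^sup>2
      / (1 + r\<^sup>2) / (1 + x\<^sup>2)" by simp
qed

text \<open>The factor from the normalization 1 + x^2 of the vector (x, 1) is split off because it
  is common to all three points of the midpoint inequality and cancels there.\<close>

lemma Tr_G_rot:
  assumes \<alpha>: "0 < \<alpha>" "\<alpha> < 1" and p: "p > 0" and x: "x > 0" and lm: "l > 0" "m > 0"
  shows "Re (mat_trace (G_mean \<alpha> p (cong_diag 2 (rot r) (diag2 l m)) (cong_diag 2 (rot (1 / x))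
      (\<lambda>i. if i = 0 then 1 else 0))))
    = (1 / (1 + x\<^sup>2)) powr (- ((1 - \<alpha>) / p)) *
      (((x + r)\<^sup>2 * l powr (- p) + (1 - r * x)\<^sup>2 * m powr (- p)) / (1 + r\<^sup>2)) powr (- ((1 - \<alpha>) /
        p))"
proof -
  have "Re (mat_trace (G_mean \<alpha> p (cong_diag 2 (rot r) (diag2 l m)) (cong_diag 2 (rot (1 / x)) (\<lambda>i.
      if i = 0 then 1 else 0))))
    = ((x + r)\<^sup>2 / (1 + r\<^sup>2) / (1 + x\<^sup>2) * l powr (- p) + (1 - r * x)\<^sup>2 / (1 + r\<^sup>2) / (1 + x\<^sup>2) * m
      powr (- p)) powr (- ((1 - \<alpha>) / p))"
    using Tr_G_rank_one[where n = 2 and a = "diag2 l m", OF \<alpha> p _ rot_unitary[of r] _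
      rot_unitary[of "1 / x"]] lm
    by (simp add: sum_lessThan_2 rot_overlap[OF x] diag2_def)
  also have "(x + r)\<^sup>2 / (1 + r\<^sup>2) / (1 + x\<^sup>2) * l powr (- p) + (1 - r * x)\<^sup>2 / (1 + r\<^sup>2) / (1 +
      x\<^sup>2) * m powr (- p)
     = (1 / (1 + x\<^sup>2)) * (((x + r)\<^sup>2 * l powr (- p) + (1 - r * x)\<^sup>2 * m powr (- p)) / (1 + r\<^sup>2))"
    by (simp add: add_divide_distrib mult.commute)
  also have "\<dots> powr (- ((1 - \<alpha>) / p)) = (1 / (1 + x\<^sup>2)) powr (- ((1 - \<alpha>) / p)) *
      (((x + r)\<^sup>2 * l powr (- p) + (1 - r * x)\<^sup>2 * m powr (- p)) / (1 + r\<^sup>2)) powr (- ((1 - \<alpha>) /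
        p))"
    by (rule powr_mult)
  finally show ?thesis .
qed

lemma concave_rot_ineq:
  assumes conc: "Tr_G_jointly_concave \<alpha> p"
    and \<alpha>: "0 < \<alpha>" "\<alpha> < 1" and p: "p > 0" and x: "x > 0"
    and lm: "l1 > 0" "m1 > 0" "l2 > 0" "m2 > 0" "l1 - m1 = l2 - m2"
  shows "(((x + r)\<^sup>2 * l1 powr (- p) + (1 - r * x)\<^sup>2 * m1 powr (- p)) / (1 + r\<^sup>2)) powr (- ((1 - \<alpha>)
      / p))
    + (((x - r)\<^sup>2 * l2 powr (- p) + (1 + r * x)\<^sup>2 * m2 powr (- p)) / (1 + r\<^sup>2)) powr (- ((1 - \<alpha>) /
      p))
    \<le> 2 * (x\<^sup>2 * (((l1 + l2) / 2 + r\<^sup>2 * ((m1 + m2) / 2)) / (1 + r\<^sup>2)) powr (- p)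
        + (((m1 + m2) / 2 + r\<^sup>2 * ((l1 + l2) / 2)) / (1 + r\<^sup>2)) powr (- p)) powr (- ((1 - \<alpha>) / p))"
proof -
  let ?A1 = "cong_diag 2 (rot r) (diag2 l1 m1)" and ?A2 = "cong_diag 2 (rot (- r)) (diag2 l2 m2)"
  let ?B = "cong_diag 2 (rot (1 / x)) (\<lambda>i. if i = 0 then 1 else 0)"
  let ?L = "((l1 + l2) / 2 + r\<^sup>2 * ((m1 + m2) / 2)) / (1 + r\<^sup>2)" and ?M =
    "((m1 + m2) / 2 + r\<^sup>2 * ((l1 + l2) / 2)) / (1 + r\<^sup>2)"
  have den: "1 + r\<^sup>2 > 0" by (simp add: add_pos_nonneg)
  have LM: "?L > 0" "?M > 0"
    using lm den by (auto intro!: divide_pos_pos add_pos_nonneg mult_nonneg_nonneg)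
  have psd: "?A1 \<in> psd_mats 2" "?A2 \<in> psd_mats 2" "?B \<in> psd_mats 2"
    using lm by (auto intro!: psd_cong_diag simp: diag2_def)
  have B: "complex_of_real (1 - 1/2) \<cdot>\<^sub>m ?B + complex_of_real (1/2) \<cdot>\<^sub>m ?B = ?B"
    unfolding cong_diag_lin[OF rot_carrier] by (rule cong_diag_cong) auto
  have "jointly_concave_on (G_dom \<alpha> 2) (\<lambda>A B. Re (mat_trace (G_mean \<alpha> p A B)))"
    using conc by (simp add: Tr_G_jointly_concave_def)
  moreover have "(?A1, ?B) \<in> G_dom \<alpha> 2" "(?A2, ?B) \<in> G_dom \<alpha> 2" "1/2 \<in> {0..1::real}"
    using psd \<alpha> by (auto simp: G_dom_def)
  ultimately have "(1 - 1/2) * Re (mat_trace (G_mean \<alpha> p ?A1 ?B)) + (1/2) * Re (mat_trace (G_mean \<alpha>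
      p ?A2 ?B))
    \<le> Re (mat_trace (G_mean \<alpha> p (complex_of_real (1 - 1/2) \<cdot>\<^sub>m ?A1 + complex_of_real (1/2) \<cdot>\<^sub>m ?A2)
       (complex_of_real (1 - 1/2) \<cdot>\<^sub>m ?B + complex_of_real (1/2) \<cdot>\<^sub>m ?B)))"
    unfolding jointly_concave_on_def by blast
  hence "Re (mat_trace (G_mean \<alpha> p ?A1 ?B)) + Re (mat_trace (G_mean \<alpha> p ?A2 ?B))
    \<le> 2 * Re (mat_trace (G_mean \<alpha> p (cong_diag 2 (rot 0) (diag2 ?L ?M)) ?B))"
    unfolding B rot_midpoint[OF lm(5)] by simp
  moreover define N where "N = (1 / (1 + x\<^sup>2)) powr (- ((1 - \<alpha>) / p))"
  have "N > 0" unfolding N_def using one_plus_square_pos[of x] by simp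
  moreover note Tr_G_rot[OF \<alpha> p x lm(1,2), of r, folded N_def] Tr_G_rot[OF \<alpha> p x lm(3,4), of "- r",
    folded N_def]
    Tr_G_rot[OF \<alpha> p x LM, of 0, folded N_def]
  ultimately have "N * ((((x + r)\<^sup>2 * l1 powr (- p) + (1 - r * x)\<^sup>2 * m1 powr (- p)) / (1 + r\<^sup>2))
      powr (- ((1 - \<alpha>) / p))
    + (((x - r)\<^sup>2 * l2 powr (- p) + (1 + r * x)\<^sup>2 * m2 powr (- p)) / (1 + r\<^sup>2)) powr (- ((1 - \<alpha>) /
      p)))
    \<le> N * (2 * (x\<^sup>2 * ?L powr (- p) + ?M powr (- p)) powr (- ((1 - \<alpha>) / p)))"
    by (simp add: distrib_left mult.left_commute)
  thus ?thesis using \<open>N > 0\<close> by simp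
qed

section \<open>First-order expansion refuting concavity for \<open>p > 1\<close>\<close>

lemma powr_midpoint_strict:
  fixes p :: real
  assumes p: "p > 1"
  shows "2 * 2 powr p < 1 + 3 powr p"
proof -
  \<comment> \<open>Mean value points in (1, 2) and (2, 3), compared through the strictly increasing
    derivative, give strict midpoint convexity.\<close>
  have "\<exists>z. z > 1 \<and> z < 2 \<and> (2 :: real) powr p - 1 powr p = (2 - 1) * (p * z powr (p - 1))"
    by (rule MVT2) (auto intro!: derivative_eq_intros)
  then obtain z where z: "z > 1" "z < 2" "(2 :: real) powr p - 1 powr p = p * z powr (p - 1)" by
    auto
  have "\<exists>w. w > 2 \<and> w < 3 \<and> (3 :: real) powr p - 2 powr p = (3 - 2) * (p * w powr (p - 1))"
    by (rule MVT2) (auto intro!: derivative_eq_intros)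
  then obtain w where w: "w > 2" "w < 3" "(3 :: real) powr p - 2 powr p = p * w powr (p - 1)" by
    auto
  have "p * z powr (p - 1) < p * w powr (p - 1)"
    using z w p by (intro mult_strict_left_mono powr_less_mono2) auto
  thus ?thesis using z w by simp
qed

text \<open>The chain rule for one-sided derivatives at 0, where \<open>K\<close> tends to 1;
  \<open>K'\<close> supplies the value 1 at 0 itself.\<close>

lemma tendsto_diff_quotient_powr:
  fixes K :: "real \<Rightarrow> real"
  assumes K: "((\<lambda>z. (K z - 1) / z) \<longlongrightarrow> a) (at_right 0)"
  shows "((\<lambda>z. (K z powr (- c) - 1) / z) \<longlongrightarrow> - c * a) (at_right 0)"
proof -
  define K' where "K' z = (if z = 0 then 1 else K z)" for z
  have "(K' has_field_derivative a) (at_right 0)"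
    unfolding has_field_derivative_iff using K
    by (rule Lim_transform_eventually) (auto simp: K'_def eventually_at_filter)
  moreover have D: "DERIV (\<lambda>y. y powr (- c)) (K' 0) :> - c"
    by (auto intro!: derivative_eq_intros simp: K'_def)
  ultimately have "((\<lambda>z. K' z powr (- c)) has_field_derivative (- c * a)) (at_right 0)"
    using DERIV_chain'[of K' a 0 "{0<..}" "\<lambda>y. y powr (- c)" "- c"] D by simp
  hence "((\<lambda>z. (K' z powr (- c) - K' 0 powr (- c)) / (z - 0)) \<longlongrightarrow> - c * a) (at_right 0)"
    unfolding has_field_derivative_iff .
  thus ?thesis
    by (rule Lim_transform_eventually) (auto simp: K'_def eventually_at_filter)
qed

theorem not_concave_p_gt_1:
  assumes \<alpha>: "0 < \<alpha>" "\<alpha> < 1" and p: "p > 1"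
  shows "\<not> Tr_G_jointly_concave \<alpha> p"
proof
  assume conc: "Tr_G_jointly_concave \<alpha> p"
  define c where "c = (1 - \<alpha>) / p"
  have c: "c > 0" using \<alpha> p by (simp add: c_def)
  text \<open>
    With \<open>z = 1/\<mu>\<close>, the matrices have eigenvalues \<open>1, \<mu> - 1\<close> and \<open>3, \<mu> + 1\<close>, so that opposite rotations by
    \<open>r\<close> give a diagonal midpoint with eigenvalues close to \<open>2, \<mu>\<close>. For \<open>v\<close> proportional to \<open>(x, 1)\<close> the
    choice of \<open>\<xi>\<close>, \<open>\<rho>\<close> below makes \<open>x + r\<close>, \<open>x - r\<close> proportional to \<open>1\<^sup>p, 3\<^sup>p\<close>, the values at which
    convexity of \<open>u\<^sup>2 s\<^bsup>-p\<^esup>\<close> would force midpoint concavity of \<open>s\<^sup>p\<close>. The scale \<open>x\<^sup>2 \<sim> z\<^bsup>p+1\<^esup>\<close> makes this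
    correction of the same order \<open>z\<close> as the terms \<open>\<plusminus> p z\<close> from \<open>(\<mu> \<mp> 1)\<^bsup>-p\<^esup>\<close>, which cancel. \<open>K0\<close>, \<open>K1\<close>,
    \<open>K2\<close> are the normalized values of \<open>\<langle>v, A\<^bsup>-p\<^esup> v\<rangle>\<close> at the midpoint and the two matrices.
  \<close>
  define \<xi> where "\<xi> = (1 + 3 powr p) / 2"
  define \<rho> where "\<rho> = (1 - 3 powr p) / 2"
  have p0: "p > 0" using p by simp
  have three: "3 powr p > (1 :: real)" using p by simp
  have \<xi>: "\<xi> > 0" and \<rho>: "\<rho> < 0" using three by (auto simp: \<xi>_def \<rho>_def)
  define b where "b = \<xi>\<^sup>2" define d where "d = \<xi> * \<rho>" define e where "e = \<rho>\<^sup>2"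
  have bde: "b > 0" "d < 0" "e > 0" using \<xi> \<rho> by (auto simp: b_def d_def e_def mult_pos_neg)
  define K1 where "K1 z = (1 * z powr (p+1) + (1/z - 1) powr (-p) * (1 - d * z powr (p+1))^2) / (1
      + e * z powr (p+1)) * z powr (-p)" for z :: real
  define K2 where "K2 z = (3 powr p * z powr (p+1) + (1/z + 1) powr (-p) * (1 + d * z powr
      (p+1))^2) / (1 + e * z powr (p+1)) * z powr (-p)" for z :: real
  define K0 where "K0 z = (((2 + e * z powr p) / (1 + e * z powr (p+1))) powr (-p) * (b * z powr
      (p+1))
    + ((1/z + 2 * e * z powr (p+1)) / (1 + e * z powr (p+1))) powr (-p)) * z powr
      (-p)" for z :: real
  \<comment> \<open>In the slope 1 + p the summand 1 comes from the eigenvalue 1 and p from (1 -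
    z)^(-p). The slopes 3^p - p and 2^(-p) b of \<open>K2\<close> and \<open>K0\<close> arise in the
    same way; the denominators and the terms with \<open>d\<close> and \<open>e\<close> contribute
    only order z^(p+1) or smaller.\<close>
  have "((\<lambda>z. (K1 z - 1) / z) \<longlongrightarrow> 1 + p) (at_right 0)"
    unfolding K1_def using p bde by real_asymp
  note L1 = tendsto_diff_quotient_powr[OF this, of c]
  \<comment> \<open>A positive parameter \<open>B\<close> stands for the constant
    \<open>3 powr p\<close> during the expansion.\<close>
  have "((\<lambda>z. ((B * z powr (p+1) + (1/z + 1) powr (-p) * (1 + d * z powr (p+1))^2) / (1 + e * z
      powr (p+1)) * z powr (-p) - 1) / z) \<longlongrightarrow> B - p) (at_right 0)"
    if "B > 0" for B using that p bde by real_asymp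
  hence "((\<lambda>z. (K2 z - 1) / z) \<longlongrightarrow> 3 powr p - p) (at_right 0)"
    unfolding K2_def by simp
  note L2 = tendsto_diff_quotient_powr[OF this, of c]
  have "((\<lambda>z. (K0 z - 1) / z) \<longlongrightarrow> 2 powr (-p) * b) (at_right 0)"
    unfolding K0_def using p bde by real_asymp
  note L0 = tendsto_diff_quotient_powr[OF this, of c]
  have ineq: "K1 z powr (- c) + K2 z powr (- c) \<le> 2 * K0 z powr (- c)" if z: "0 < z" "z < 1" for z
  proof -
    \<comment> \<open>Half the exponent p + 1, because \<open>x\<close> and \<open>r\<close> enter
      through their squares and their product.\<close>
    define q where "q = z powr ((p + 1) / 2)"
    have "(p + 1) / 2 + (p + 1) / 2 = p + 1" by simp
    hence q: "q > 0" "q\<^sup>2 = z powr (p + 1)"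
      using z by (simp_all only: q_def power2_eq_square powr_add[symmetric]) simp_all
    define x where "x = \<xi> * q"
    define r where "r = \<rho> * q"
    have x: "x > 0" using q \<xi> by (simp add: x_def)
    have sq: "x\<^sup>2 = b * z powr (p+1)" "r\<^sup>2 = e * z powr (p+1)" "r * x = d * z powr (p+1)"
      using q by (simp_all add: x_def r_def b_def d_def e_def power_mult_distrib flip:
        power2_eq_square)
    have xr: "(x + r)\<^sup>2 = z powr (p+1)" "(x - r)\<^sup>2 = (3 powr p)\<^sup>2 * z powr (p+1)"
    proof -
      have "x + r = (\<xi> + \<rho>) * q" "x - r = (\<xi> - \<rho>) * q" by (simp_all add: x_def r_def algebra_simps)
      moreover have "\<xi> + \<rho> = 1" "\<xi> - \<rho> = 3 powr p" by (simp_all add: \<xi>_def \<rho>_def field_simps)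
      ultimately show "(x + r)\<^sup>2 = z powr (p+1)" "(x - r)\<^sup>2 = (3 powr p)\<^sup>2 * z powr (p+1)"
        using q by (simp_all add: power_mult_distrib)
    qed
    have three': "(3 powr p)\<^sup>2 * 3 powr (-p) = (3 powr p :: real)"
      by (simp add: power2_eq_square powr_minus)
    have zz: "u * z powr (- p) * z powr p = u" for u
      using z by (simp add: powr_minus mult.assoc)
    have zp: "z powr (p+1) / z = z powr p" using z by (simp add: powr_add)
    \<comment> \<open>Positivity of the large eigenvalue at the first endpoint, which is why z < 1
      is assumed. Both endpoints have the gap 2 - 1/z, as the diagonal midpoint requires.\<close>
    have "1/z - 1 > 0" using z by simp
    hence "(((x + r)\<^sup>2 * 1 powr (- p) + (1 - r * x)\<^sup>2 * (1/z - 1) powr (- p)) / (1 + r\<^sup>2)) powr (-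
        ((1 - \<alpha>) / p))
      + (((x - r)\<^sup>2 * 3 powr (- p) + (1 + r * x)\<^sup>2 * (1/z + 1) powr (- p)) / (1 + r\<^sup>2)) powr (- ((1
        - \<alpha>) / p))
      \<le> 2 * (x\<^sup>2 * (((1 + 3) / 2 + r\<^sup>2 * (((1/z - 1) + (1/z + 1)) / 2)) / (1 + r\<^sup>2)) powr (- p)
        + ((((1/z - 1) + (1/z + 1)) / 2 + r\<^sup>2 * ((1 + 3) / 2)) / (1 + r\<^sup>2)) powr (- p)) powr (- ((1
          - \<alpha>) / p))"
      using z by (intro concave_rot_ineq[OF conc \<alpha> p0 x]) (auto intro: add_pos_pos)
    also have "((x + r)\<^sup>2 * 1 powr (- p) + (1 - r * x)\<^sup>2 * (1/z - 1) powr (- p)) / (1 + r\<^sup>2) = K1 z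
        * z powr p"
      unfolding xr sq K1_def zz by (simp add: mult.commute)
    also have "((x - r)\<^sup>2 * 3 powr (- p) + (1 + r * x)\<^sup>2 * (1/z + 1) powr (- p)) / (1 + r\<^sup>2) = K2 z
        * z powr p"
    proof -
      have "(x - r)\<^sup>2 * 3 powr (- p) = 3 powr p * z powr (p+1)" 
      proof -
        have "(x - r)\<^sup>2 * 3 powr (- p) = ((3 powr p)\<^sup>2 * 3 powr (-p)) * z powr (p+1)"
          unfolding xr by (simp only: mult_ac)
        thus ?thesis unfolding three' .
      qed
      thus ?thesis unfolding sq K2_def zz by (simp add: mult.commute)
    qed
    also have "x\<^sup>2 * (((1 + 3) / 2 + r\<^sup>2 * (((1/z - 1) + (1/z + 1)) / 2)) / (1 + r\<^sup>2)) powr (- p)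
        + ((((1/z - 1) + (1/z + 1)) / 2 + r\<^sup>2 * ((1 + 3) / 2)) / (1 + r\<^sup>2)) powr (- p) = K0 z * z
          powr p"
    proof -
      have f1: "(1 + 3) / 2 + r\<^sup>2 * (((1/z - 1) + (1/z + 1)) / 2) = 2 + e * z powr p"
        unfolding sq zp[symmetric] by simp
      have f2: "((1/z - 1) + (1/z + 1)) / 2 + r\<^sup>2 * ((1 + 3) / 2) = 1/z + 2 * e * z powr (p+1)"
        unfolding sq by simp
      show ?thesis unfolding K0_def zz using f1 f2 unfolding sq by (simp only: mult.commute)
    qed
    finally have "(z powr p) powr (- c) * (K1 z powr (- c) + K2 z powr (- c)) \<le> (z powr p) powr (-
        c) * (2 * K0 z powr (- c))"
      by (simp add: powr_mult c_def[symmetric] algebra_simps)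
    thus ?thesis using z by simp
  qed
  \<comment> \<open>Subtracting the common value 1 and dividing by z leaves the slopes. The terms p
    cancel and the factor - c reverses the inequality, giving 2 * 2^(-p) * \<xi>^2 \<le> 1 + 3^p = 2
    * \<xi>, that is \<xi> \<le> 2^p, against strict convexity.\<close>
  have "- c * (1 + p) + - c * (3 powr p - p) \<le> 2 * (- c * (2 powr (-p) * b))"
  proof (rule tendsto_le[OF _ tendsto_mult[OF tendsto_const L0] tendsto_add[OF L1 L2]])
    have "(K1 z powr (- c) - 1) / z + (K2 z powr (- c) - 1) / z \<le> 2 * ((K0 z powr (- c) - 1) / z)"
      if "0 < z" "z < 1" for z
      using divide_right_mono[OF ineq[OF that], of z] that by (simp add: diff_divide_distrib
        add_divide_distrib)
    thus "\<forall>\<^sub>F z in at_right 0. (K1 z powr (- c) - 1) / z + (K2 z powr (- c) - 1) / z \<le> 2 * ((K0 z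
        powr (- c) - 1) / z)"
      using eventually_at_right_real[of 0 "1 :: real"] by (auto elim: eventually_mono)
  qed simp
  hence "c * (2 * (2 powr (-p) * b)) \<le> c * (1 + 3 powr p)" by (simp add: algebra_simps)
  hence "2 powr (-p) * \<xi>\<^sup>2 \<le> \<xi>" using c by (simp add: b_def \<xi>_def)
  hence "2 powr (-p) * \<xi> \<le> 1" using \<xi> by (simp add: power2_eq_square flip: mult.assoc)
  hence "\<xi> \<le> 2 powr p" by (simp add: powr_minus field_simps)
  thus False using powr_midpoint_strict[OF p] by (simp add: \<xi>_def)
qed

theorem theorem5p15:
  fixes \<alpha> p :: real
  assumes "\<alpha> \<in> {0<..} - {1}" and "p > 0"
  shows "Tr_G_jointly_concave \<alpha> p \<longleftrightarrow> (0 < \<alpha> \<and> \<alpha> < 1) \<and> p \<le> 1"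
proof
  assume conc: "Tr_G_jointly_concave \<alpha> p"
  have "\<alpha> < 1" using assms not_concave_alpha_gt_1[of \<alpha> p] conc by (cases "\<alpha> > 1") auto
  moreover from this have "p \<le> 1" using assms not_concave_p_gt_1[of \<alpha> p] conc by (cases "p > 1")
    auto
  ultimately show "(0 < \<alpha> \<and> \<alpha> < 1) \<and> p \<le> 1" using assms by simp
next
  assume "(0 < \<alpha> \<and> \<alpha> < 1) \<and> p \<le> 1"
  thus "Tr_G_jointly_concave \<alpha> p" using assms Tr_G_concave[of \<alpha> p] by simp
qed

end
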